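(* Let $D$ be a non-commutative division ring with $\operatorname{char}(D)\neq 2$, and let $m,n$ be positive integers with $(m,n)\neq(1,1)$. If $g_1,g_2:D\to D$ are additive maps such that $$g_1(y)y^{-m}+y^n g_2(y^{-1})=0$$ for all $y\in D^*$, then $g_1=g_2=0$.
   Context: Rings are associative with unity. $D^*$ denotes the set of units (non-zero elements) of $D$. A map $g:D\to D$ is additive if $g(x+y)=g(x)+g(y)$ for all $x,y\in D$. *)

theory Defs
  imports Complex_Main
begin

end

theory Submission
  imports Defs "HOL-Algebra.Exponent" "HOL-Library.FuncSet"
begin

text \<open>Put \<open>f = g1\<close> and \<open>g = - g2\<close>. The hypothesis reads \<open>f y = y\<^sup>n g (y\<^sup>-\<^sup>1) y\<^sup>m\<close>, hence also
  \<open>g y = y\<^sup>n f (y\<^sup>-\<^sup>1) y\<^sup>m\<close>, so \<open>h = f + g\<close> and \<open>h = f - g\<close> satisfy \<open>h y = \<plusminus> y\<^sup>n h (y\<^sup>-\<^sup>1) y\<^sup>m\<close>.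
  Replacing \<open>y\<close> by \<open>-y\<close> and by \<open>2 y\<close> settles odd \<open>n + m\<close> and characteristic 0; let \<open>n + m\<close> be even
  and the characteristic \<open>p\<close> be odd. Hua-type identities such as \<open>y\<^sup>-\<^sup>1 - (1 + y)\<^sup>-\<^sup>1 = (y (1 + y))\<^sup>-\<^sup>1\<close> bound
  the degree of \<open>(1 + y)\<^sup>n w (1 + y)\<^sup>m - y\<^sup>n w y\<^sup>m\<close> in \<open>y\<close>, where \<open>w = h 1\<close> (plus sign) or
  \<open>w = h y\<close> (minus sign).

  If the center is infinite, one compares homogeneous parts with respect to central scalars.
  The lowest interesting part has degree a power \<open>q\<close> of \<open>p\<close>, and forces \<open>x\<^sup>q\<close> to be central for every
  \<open>x\<close> violating the desired commutation. A non-central such \<open>x\<close> has a partner \<open>b\<close> with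
  \<open>x b = (b + 1) x\<close>, and then \<open>b\<^sup>q\<close> cannot be central.

  If the center is finite, degrees are measured by iterated differences instead, and factors \<open>x\<close> on
  either side can be cancelled when some element is transcendental over the center. This gives
  \<open>[h t, t] = 0\<close> for transcendental \<open>t\<close>. There are enough of them: if all elements commuting with a
  non-central algebraic \<open>a\<close> were algebraic, then \<open>a\<close> and a suitable eigenvector of conjugation by \<open>a\<close>
  would generate a finite non-commutative division ring.\<close>

section \<open>Division rings and purely inseparable elements\<close>

text \<open>A violator \<open>x\<close> is purely inseparable, but its partner \<open>b\<close> need
  not be a violator. The relation \<open>x * b = (b + 1) * x\<close> survives adding to
  \<open>b\<close> anything that commutes with \<open>x\<close>, and each time a central multiple of
  \<open>x\<close> makes a violator of \<open>b\<close>. With a finite center scalars no longer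
  separate degrees, and difference degrees are treacherous: in a commutative field of characteristic
  \<open>p\<close> the function \<open>x ^ (p - 1)\<close> has degree \<open>p - 1\<close>, yet its
  product with \<open>x\<close> is additive. A transcendental \<open>t\<close> repairs this, because
  the maps sending \<open>x\<close> to \<open>a * x * t ^ u\<close> are independent for distinct
  \<open>u\<close>; a factor \<open>x\<close> can then be cancelled at the cost of exactly one
  degree. If the leading part has \<open>w\<close> on both sides of a power of \<open>x\<close>, no
  common factor can be cancelled; differences twisted by \<open>t\<close> suppress one of the two
  terms, and what survives is a bound for the commutator of \<open>w\<close> with \<open>t\<close>.
  The plus sign comes first: there \<open>h\<close> is determined by \<open>h 1\<close>, and over an
  infinite center the minus sign is reduced to it by comparing \<open>h (z * x)\<close> with
  \<open>h (inverse z * x)\<close> for central \<open>z\<close>.\<close>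

definition center :: "'a::division_ring set"
  where "center = {z. \<forall>x. z * x = x * z}"

lemma centerD: "z \<in> center \<Longrightarrow> z * x = x * z"
  by (simp add: center_def)

lemma center_of_nat [simp]: "of_nat k \<in> center"
  unfolding center_def using mult_of_nat_commute by blast

lemma center_mult:
  assumes "y \<in> center" "z \<in> center"
  shows "y * z \<in> center"
  unfolding center_def
proof (rule CollectI, rule allI)
  fix x
  have "y * z * x = y * (x * z)"
    using assms(2) by (simp add: mult.assoc centerD)
  also have "\<dots> = x * (y * z)"
    using assms(1) by (simp add: mult.assoc[symmetric] centerD)
  finally show "y * z * x = x * (y * z)" .
qed

lemma center_add: "y \<in> center \<Longrightarrow> z \<in> center \<Longrightarrow> y + z \<in> center"
  unfolding center_def by (simp add: distrib_left distrib_right)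

lemma center_minus: "z \<in> center \<Longrightarrow> - z \<in> center"
  unfolding center_def by simp

lemma center_1 [simp]: "1 \<in> center"
  by (simp add: center_def)

lemma center_0 [simp]: "0 \<in> center"
  by (simp add: center_def)

lemma center_power: "z \<in> center \<Longrightarrow> z ^ k \<in> center"
  by (induction k) (simp_all add: center_mult)

lemma commutes_inverse:
  fixes t :: "'a::division_ring"
  assumes "t * x = x * t"
  shows "inverse t * x = x * inverse t"
proof (cases "t = 0")
  case False
  have "x * inverse t = inverse t * (t * x) * inverse t"
    using False by (simp add: mult.assoc[symmetric])
  also have "\<dots> = inverse t * (x * t) * inverse t"
    using assms by simp
  also have "\<dots> = inverse t * x"
    using False by (simp add: mult.assoc)
  finally show ?thesis by simp
qed simp

lemma center_inverse: "z \<in> center \<Longrightarrow> inverse z \<in> center"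
  unfolding center_def by (auto intro: commutes_inverse)

lemma center_mult_cancel:
  assumes "u \<in> center" "u \<noteq> 0" "u * a \<in> center"
  shows "a \<in> center"
proof -
  have "inverse u * (u * a) \<in> center"
    using assms center_inverse center_mult by blast
  then show ?thesis using assms by (simp add: mult.assoc[symmetric])
qed

section \<open>Commuting elements: powers, the binomial theorem, zeros of polynomials\<close>

lemma power_mult_commuting:
  fixes a b :: "'a::monoid_mult"
  assumes "a * b = b * a"
  shows "(a * b) ^ k = a ^ k * b ^ k"
proof (induction k)
  case (Suc k)
  have b: "b * a ^ k = a ^ k * b"
    using assms power_commuting_commutes[of a b k] by simp
  have "(a * b) ^ Suc k = a * (b * a ^ k) * b ^ k"
    by (simp add: Suc mult.assoc)
  also have "\<dots> = a ^ Suc k * b ^ Suc k"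
    by (simp add: b mult.assoc)
  finally show ?case .
qed simp

lemma center_power_mult:
  assumes "z \<in> center"
  shows "(z * x) ^ k = z ^ k * x ^ k"
  using assms by (intro power_mult_commuting) (simp add: centerD)

text \<open>Pascal's rule for an arbitrary family \<open>P i j\<close> instead of monomials, so that
  one index shift serves both the binomial theorem and the iterated commutator.\<close>

lemma pascal_sum:
  fixes P :: "nat \<Rightarrow> nat \<Rightarrow> 'a::semiring_1"
  shows "(\<Sum>i\<le>n. of_nat (n choose i) * P (Suc i) (n - i)) + (\<Sum>i\<le>n. of_nat (n choose i) * P i (Suc n - i))
    = (\<Sum>i\<le>Suc n. of_nat (Suc n choose i) * P i (Suc n - i))"
proof -
  have "(\<Sum>i\<le>n. of_nat (n choose i) * P (Suc i) (n - i))
      = (\<Sum>i\<le>Suc n. (if i = 0 then 0 else of_nat (n choose (i - 1))) * P i (Suc n - i))"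
    by (simp only: sum.atMost_Suc_shift) simp
  moreover have "(\<Sum>i\<le>n. of_nat (n choose i) * P i (Suc n - i)) = (\<Sum>i\<le>Suc n. of_nat (n choose i) * P i (Suc n - i))"
    by (simp add: binomial_eq_0)
  ultimately show ?thesis
    by (simp only: sum.distrib[symmetric] distrib_right[symmetric])
       (rule sum.cong, rule refl, rename_tac i, case_tac i, auto simp: add.commute binomial_eq_0)
qed

lemma binomial_commuting:
  fixes a b :: "'a::ring_1"
  assumes "a * b = b * a"
  shows "(a + b) ^ n = (\<Sum>i\<le>n. of_nat (n choose i) * a ^ i * b ^ (n - i))"
proof (induction n)
  case (Suc n)
  have ba: "b * a ^ k = a ^ k * b" for k
    using assms power_commuting_commutes[of a b k] by simp
  have "(a + b) ^ Suc n = (\<Sum>i\<le>n. a * (of_nat (n choose i) * a ^ i * b ^ (n - i)))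
      + (\<Sum>i\<le>n. b * (of_nat (n choose i) * a ^ i * b ^ (n - i)))"
    by (simp only: power_Suc Suc distrib_right sum_distrib_left sum.distrib)
  also have "(\<Sum>i\<le>n. a * (of_nat (n choose i) * a ^ i * b ^ (n - i)))
      = (\<Sum>i\<le>n. of_nat (n choose i) * (a ^ Suc i * b ^ (n - i)))"
    by (simp only: mult.assoc[symmetric] power_Suc mult_of_nat_commute[of _ a, symmetric])
  also have "(\<Sum>i\<le>n. b * (of_nat (n choose i) * a ^ i * b ^ (n - i)))
      = (\<Sum>i\<le>n. of_nat (n choose i) * (a ^ i * b ^ (Suc n - i)))"
  proof (intro sum.cong refl)
    fix i assume "i \<in> {..n}"
    then have "Suc n - i = Suc (n - i)" by auto
    moreover have "b * (of_nat (n choose i) * a ^ i * b ^ (n - i)) = of_nat (n choose i) * (b * a ^ i) * b ^ (n - i)"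
      by (simp only: mult.assoc[symmetric] mult_of_nat_commute[of _ b, symmetric])
    ultimately show "b * (of_nat (n choose i) * a ^ i * b ^ (n - i)) = of_nat (n choose i) * (a ^ i * b ^ (Suc n - i))"
      by (simp add: ba mult.assoc)
  qed
  finally show ?case
    by (simp only: pascal_sum[of n "\<lambda>i j. a ^ i * b ^ j"] mult.assoc)
qed simp

text \<open>Coefficients stay to the left of the powers of \<open>z\<close>, so evaluation respects
  a right factor \<open>z - z0\<close> only at points commuting with \<open>z0\<close>. The quotient
  does not depend on \<open>z\<close> and keeps the leading coefficient, as the induction on the
  degree requires.\<close>

lemma synthetic_division:
  fixes a :: "nat \<Rightarrow> 'a::ring_1"
  shows "\<exists>b r. b d = a (Suc d) \<and>
    (\<forall>z. z * z0 = z0 * z \<longrightarrow> (\<Sum>j\<le>Suc d. a j * z ^ j) = (\<Sum>j\<le>d. b j * z ^ j) * (z - z0) + r)"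
proof (induction d arbitrary: a)
  case 0
  show ?case
    by (rule exI[of _ "\<lambda>_. a 1"], rule exI[of _ "a 0 + a 1 * z0"]) (simp add: algebra_simps)
next
  case (Suc d)
  \<comment> \<open>With \<open>c\<close> the top coefficient,
    \<open>c z^(d+2) = c z^(d+1) (z - z0) + c z0 z^(d+1)\<close>; the last term is absorbed into the
    coefficient of \<open>z^(d+1)\<close>.\<close>
  define a' where "a' = a(Suc d := a (Suc d) + a (Suc (Suc d)) * z0)"
  obtain b r where b: "\<And>z. z * z0 = z0 * z \<Longrightarrow>
      (\<Sum>j\<le>Suc d. a' j * z ^ j) = (\<Sum>j\<le>d. b j * z ^ j) * (z - z0) + r"
    using Suc[of a'] by blast
  define b' where "b' = b(Suc d := a (Suc (Suc d)))"
  have "(\<Sum>j\<le>Suc (Suc d). a j * z ^ j) = (\<Sum>j\<le>Suc d. b' j * z ^ j) * (z - z0) + r"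
    if z: "z * z0 = z0 * z" for z
  proof -
    have zz: "z0 * z ^ k = z ^ k * z0" for k
      using z power_commuting_commutes[of z z0 k] by simp
    have "(\<Sum>j\<le>Suc d. b' j * z ^ j) * (z - z0)
        = (\<Sum>j\<le>d. b j * z ^ j) * (z - z0) + a (Suc (Suc d)) * z ^ Suc d * (z - z0)"
      by (simp add: b'_def distrib_right del: power_Suc)
    moreover have "(\<Sum>j\<le>Suc d. a' j * z ^ j)
        = (\<Sum>j\<le>Suc d. a j * z ^ j) + a (Suc (Suc d)) * z0 * z ^ Suc d"
      by (simp add: a'_def distrib_right del: power_Suc)
    moreover have "a (Suc (Suc d)) * z ^ Suc d * (z - z0)
        = a (Suc (Suc d)) * z ^ Suc (Suc d) - a (Suc (Suc d)) * z0 * z ^ Suc d"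
      using zz[of "Suc d"] by (simp only: right_diff_distrib mult.assoc power_Suc2)
    moreover have "(\<Sum>j\<le>Suc (Suc d). a j * z ^ j)
        = (\<Sum>j\<le>Suc d. a j * z ^ j) + a (Suc (Suc d)) * z ^ Suc (Suc d)"
      by (rule sum.atMost_Suc)
    moreover have "A2 = T1 + r"
      if "T1 = T2 + C" "A1 = A + E" "C = F - E" "A2 = A + F" "A1 = T2 + r"
      for A A1 A2 C E F T1 T2 :: 'a
    proof -
      have "T1 + r = A1 + C" using that(1,5) by (simp add: add_ac)
      then show ?thesis using that(2,3,4) by simp
    qed
    ultimately show ?thesis using b[OF z] by blast
  qed
  then show ?case
    by (intro exI[of _ b'] exI[of _ r]) (simp add: b'_def)
qed

text \<open>Dividing by \<open>z - z0\<close> at one zero lowers the degree and keeps the other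
  zeros, because they commute with \<open>z0\<close>. This kills the leading coefficient, and a
  second use of the induction hypothesis kills the rest. The coefficients may fail to commute with
  anything.\<close>

lemma commuting_vandermonde:
  fixes a :: "nat \<Rightarrow> 'a::division_ring"
  assumes "\<And>z w. z \<in> S \<Longrightarrow> w \<in> S \<Longrightarrow> z * w = w * z"
    and "infinite S \<or> d < card S"
    and "\<And>z. z \<in> S \<Longrightarrow> (\<Sum>j\<le>d. a j * z ^ j) = 0"
    and "j \<le> d"
  shows "a j = 0"
  using assms
proof (induction d arbitrary: a S j)
  case 0
  then obtain z where "z \<in> S" by (cases "S = {}") auto
  with 0 show ?case by force
next
  case (Suc d)
  have "S \<noteq> {}" using Suc.prems(2) by auto
  then obtain z0 where z0: "z0 \<in> S" by blast
  obtain b r where b: "b d = a (Suc d)"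
    and div: "\<And>z. z * z0 = z0 * z \<Longrightarrow>
      (\<Sum>j\<le>Suc d. a j * z ^ j) = (\<Sum>j\<le>d. b j * z ^ j) * (z - z0) + r"
    using synthetic_division[of d a z0] by blast
  have r: "r = 0" using div[of z0] Suc.prems(3)[OF z0] by simp
  have "b d = 0"
  proof (rule Suc.IH[of "S - {z0}"])
    show "infinite (S - {z0}) \<or> d < card (S - {z0})"
      using Suc.prems(2) z0 by (auto simp: card_Diff_singleton)
    fix z assume z: "z \<in> S - {z0}"
    then have "(\<Sum>j\<le>d. b j * z ^ j) * (z - z0) = 0"
      using div[of z] Suc.prems(1,3) z0 r by (metis DiffD1 add.right_neutral)
    with z show "(\<Sum>j\<le>d. b j * z ^ j) = 0" by simp
  qed (use Suc.prems(1) in auto)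
  with b have top: "a (Suc d) = 0" by simp
  show ?case
  proof (cases "j = Suc d")
    case False
    show ?thesis
    proof (rule Suc.IH[of S])
      show "\<And>z. z \<in> S \<Longrightarrow> (\<Sum>j\<le>d. a j * z ^ j) = 0"
        using Suc.prems(3) top by simp
    qed (use Suc.prems False in auto)
  qed (simp add: top)
qed

lemma center_vandermonde:
  fixes a :: "nat \<Rightarrow> 'a::division_ring"
  assumes "infinite (center :: 'a set)"
    and "\<And>z. z \<in> center \<Longrightarrow> z \<noteq> 0 \<Longrightarrow> (\<Sum>j\<le>d. a j * z ^ j) = 0" and "j \<le> d"
  shows "a j = 0"
  by (rule commuting_vandermonde[of "center - {0}"]) (use assms in \<open>auto simp: centerD\<close>)

section \<open>The characteristic, and binomial coefficients modulo a prime\<close>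

lemma prime_CHAR_division_ring:
  assumes "CHAR('a::division_ring) > 0"
  shows "prime CHAR('a)"
  unfolding prime_nat_iff
proof (intro conjI allI impI)
  show "1 < CHAR('a)"
    using assms CHAR_not_1[where 'a='a] by linarith
next
  fix a assume "a dvd CHAR('a)"
  then obtain b where ab: "CHAR('a) = a * b" by (elim dvdE)
  have "of_nat a * of_nat b = (0 :: 'a)"
    using ab by (metis of_nat_CHAR of_nat_mult)
  then have "CHAR('a) dvd a \<or> CHAR('a) dvd b"
    by (simp add: of_nat_eq_0_iff_char_dvd)
  then show "a = 1 \<or> a = CHAR('a)"
    using ab assms by (auto simp: dvd_mult_cancel1 dvd_mult_cancel2)
qed

lemma two_nonzero:
  assumes "CHAR('a::division_ring) \<noteq> 2"
  shows "(2::'a) \<noteq> 0"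
proof
  assume "(2::'a) = 0"
  then have "of_nat 2 = (0::'a)" by simp
  then have "CHAR('a) dvd 2" by (simp only: of_nat_eq_0_iff_char_dvd)
  then have "CHAR('a) = 1" using assms two_is_prime_nat unfolding prime_nat_iff by blast
  then show False using CHAR_not_1[where 'a = 'a] by simp
qed

text \<open>From \<open>i * (N choose i) = N * ((N - 1) choose (i - 1))\<close> with
  \<open>N = p ^ v * r\<close>: were the coefficient prime to \<open>p\<close>, then
  \<open>p ^ v\<close> would divide \<open>i\<close>.\<close>

lemma prime_dvd_prime_power_choose:
  assumes "prime (p::nat)" "0 < i" "i < p ^ v"
  shows "p dvd (p ^ v * r choose i)"
proof (rule ccontr)
  assume "\<not> p dvd (p ^ v * r choose i)"
  then have cop: "coprime (p ^ v) (p ^ v * r choose i)"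
    using assms(1) by (simp add: prime_imp_coprime)
  have "i * (p ^ v * r choose i) = p ^ v * r * ((p ^ v * r - 1) choose (i - 1))"
    using assms(2) by (simp add: times_binomial_minus1_eq)
  then have "p ^ v dvd i * (p ^ v * r choose i)"
    by (metis dvd_triv_left mult.assoc)
  with cop have "p ^ v dvd i"
    by (simp add: coprime_dvd_mult_left_iff)
  with assms(2,3) show False by (auto dest: dvd_imp_le)
qed

text \<open>The coefficient from Wielandt's proof of Sylow's theorem; its multiplicity at
  \<open>p\<close> is that of \<open>r\<close>.\<close>

lemma not_prime_dvd_prime_power_choose:
  assumes "prime (p::nat)" "\<not> p dvd r"
  shows "\<not> p dvd (p ^ v * r choose p ^ v)"
proof
  assume *: "p dvd (p ^ v * r choose p ^ v)"
  have r: "r > 0" using assms(2) by (auto intro: Nat.gr0I)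
  then have "p ^ v \<le> p ^ v * r" by simp
  then have "(p ^ v * r choose p ^ v) > 0" by (rule zero_less_binomial)
  with * assms(1) have "multiplicity p (p ^ v * r choose p ^ v) > 0"
    by (subst multiplicity_gt_zero_iff) (auto dest: not_prime_unit)
  moreover have "multiplicity p (p ^ v * r choose p ^ v) = multiplicity p r"
    using const_p_fac r assms(1) by blast
  moreover have "multiplicity p r = 0"
    using assms(2) by (simp add: not_dvd_imp_multiplicity_0)
  ultimately show False by simp
qed

text \<open>Frobenius with arbitrary summands \<open>T i\<close>, to serve powers of
  \<open>b + 1\<close> as well as iterated commutators.\<close>

lemma char_binomial_sum:
  assumes "prime p" "of_nat p = (0::'a::ring_1)"
  shows "(\<Sum>i\<le>p ^ v. of_nat (p ^ v choose i) * T i) = T 0 + (T (p ^ v) :: 'a)"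
proof -
  have "(\<Sum>i\<le>p ^ v. of_nat (p ^ v choose i) * T i) = (\<Sum>i\<in>{0, p ^ v}. of_nat (p ^ v choose i) * T i)"
  proof (rule sum.mono_neutral_right)
    show "\<forall>i\<in>{..p ^ v} - {0, p ^ v}. of_nat (p ^ v choose i) * T i = 0"
    proof
      fix i assume "i \<in> {..p ^ v} - {0, p ^ v}"
      then have "p dvd (p ^ v * 1 choose i)"
        using prime_dvd_prime_power_choose[OF assms(1), of i v 1] by auto
      then obtain r where "p ^ v choose i = p * r" by auto
      then show "of_nat (p ^ v choose i) * T i = 0" by (simp add: assms(2))
    qed
  qed auto
  then show ?thesis using prime_gt_0_nat[OF assms(1)] by simp
qed

text \<open>The commutator with \<open>x\<close> is left multiplication by \<open>x\<close> plus
  right multiplication by \<open>- x\<close>; these operators commute, whence a binomial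
  formula.\<close>

lemma iterated_commutator:
  fixes x y :: "'a::ring_1"
  shows "((\<lambda>y. x * y - y * x) ^^ n) y = (\<Sum>i\<le>n. of_nat (n choose i) * (x ^ i * y * (- x) ^ (n - i)))"
proof (induction n)
  case (Suc n)
  define t where "t i = of_nat (n choose i) * (x ^ i * y * (- x) ^ (n - i))" for i
  have "((\<lambda>y. x * y - y * x) ^^ Suc n) y = (\<Sum>i\<le>n. x * t i) + (\<Sum>i\<le>n. t i * (- x))"
    by (simp add: Suc t_def[symmetric] sum_distrib_left sum_distrib_right sum_negf)
  also have "(\<Sum>i\<le>n. x * t i) = (\<Sum>i\<le>n. of_nat (n choose i) * (x ^ Suc i * y * (- x) ^ (n - i)))"
    by (simp only: t_def mult.assoc[symmetric] power_Suc mult_of_nat_commute[of _ x, symmetric])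
  also have "(\<Sum>i\<le>n. t i * (- x)) = (\<Sum>i\<le>n. of_nat (n choose i) * (x ^ i * y * (- x) ^ (Suc n - i)))"
  proof (intro sum.cong refl)
    fix i assume "i \<in> {..n}"
    then have e: "Suc n - i = Suc (n - i)" by auto
    show "t i * (- x) = of_nat (n choose i) * (x ^ i * y * (- x) ^ (Suc n - i))"
      unfolding t_def e power_Suc2 by (simp only: mult.assoc)
  qed
  finally show ?case by (simp only: pascal_sum[of n "\<lambda>i j. x ^ i * y * (- x) ^ j"])
qed simp

text \<open>If \<open>x\<close> is purely inseparable over the center, then \<open>ad x\<close> is nilpotent, and
  the last two terms \<open>u\<close>, \<open>w = [x, u]\<close> of a chain of iterates give \<open>b = u w\<^sup>-\<^sup>1 x\<close>.\<close>

lemma inseparable_shift: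
  fixes x :: "'a::division_ring"
  assumes p: "prime p" "of_nat p = (0::'a)"
    and central: "x ^ (p ^ v) \<in> center" and "x \<notin> center"
  obtains b where "x * b = (b + 1) * x"
proof -
  from \<open>x \<notin> center\<close> obtain y where y: "x * y \<noteq> y * x" by (auto simp: center_def)
  define t where "t n = ((\<lambda>y. x * y - y * x) ^^ n) y" for n
  have t_Suc: "t (Suc n) = x * t n - t n * x" for n by (simp add: t_def)
  \<comment> \<open>In characteristic \<open>p\<close> the \<open>p ^ v\<close>-fold commutator with
    \<open>x\<close> is the commutator with the central \<open>x ^ (p ^ v)\<close>, hence zero; the
    sign of \<open>- x\<close> needs a separate look at \<open>p = 2\<close>.\<close>
  have "t (p ^ v) = y * (- x) ^ (p ^ v) + x ^ (p ^ v) * y"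
    unfolding t_def iterated_commutator char_binomial_sum[OF p] by simp
  also have "(- x) ^ (p ^ v) = (- 1) ^ (p ^ v) * x ^ (p ^ v)"
    by (rule power_minus)
  also have "y * ((- 1) ^ (p ^ v) * x ^ (p ^ v)) = (- 1) ^ (p ^ v) * (x ^ (p ^ v) * y)"
    using centerD[OF central, of y] by (cases "even (p ^ v)") auto
  also have "\<dots> + x ^ (p ^ v) * y = ((- 1) ^ (p ^ v) + 1) * (x ^ (p ^ v) * y)"
    by (simp add: distrib_right)
  also have "(- 1) ^ (p ^ v) + 1 = (0::'a)"
  proof (cases "p = 2")
    case True
    with p(2) show ?thesis by (cases "even (p ^ v)") auto
  next
    case False
    then have "odd p" using p(1) prime_odd_nat[of p] prime_ge_2_nat[of p] by linarith
    then show ?thesis by simp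
  qed
  finally have "t (p ^ v) = 0" by simp
  moreover have t01: "t 0 \<noteq> 0" "t (Suc 0) \<noteq> 0" using y by (auto simp: t_def)
  moreover define k where "k = (LEAST n. t n = 0)"
  ultimately have k: "t k = 0" "\<And>j. j < k \<Longrightarrow> t j \<noteq> 0"
    using LeastI[of "\<lambda>n. t n = 0"] not_less_Least[of _ "\<lambda>n. t n = 0"] by blast+
  have "k \<noteq> 0" using k(1) t01(1) by metis
  moreover have "k \<noteq> Suc 0" using k(1) t01(2) by metis
  ultimately obtain m where m: "k = Suc (Suc m)"
    by (metis not0_implies_Suc)
  define n where "n = Suc m"
  have n: "t (Suc n) = 0" "t n \<noteq> 0" and m: "n = Suc m"
    using k m by (auto simp: n_def)
  define u w where "u = t m" and "w = t n"
  have w: "w \<noteq> 0" "x * w = w * x" and u: "x * u - u * x = w"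
    using n t_Suc[of n] t_Suc[of m] m by (auto simp: u_def w_def)
  have "x * (u * inverse w * x) = (x * u) * inverse w * x"
    by (simp add: mult.assoc)
  also have "\<dots> = (w + u * x) * inverse w * x"
    using u by (simp add: diff_eq_eq)
  also have "\<dots> = x + u * (x * inverse w) * x"
    using w(1) by (simp add: distrib_right mult.assoc)
  also have "x * inverse w = inverse w * x"
    using commutes_inverse[of w x] w(2) by simp
  finally have "x * (u * inverse w * x) = (u * inverse w * x + 1) * x"
    by (simp add: distrib_right mult.assoc add.commute)
  then show thesis by (rule that)
qed

text \<open>Conjugation by \<open>x\<close> sends \<open>b\<close> to \<open>b + 1\<close>, hence
  \<open>b ^ q\<close> to \<open>(b + 1) ^ q = b ^ q + 1\<close> for \<open>q = p ^ v\<close>; a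
  central \<open>b ^ q\<close> would be fixed.\<close>

lemma inseparable_contradiction:
  fixes x b :: "'a::division_ring"
  assumes p: "prime p" "of_nat p = (0::'a)"
    and "x \<noteq> 0" "x * b = (b + 1) * x" "b ^ (p ^ v) \<in> center"
  shows False
proof -
  have pw: "x * b ^ k = (b + 1) ^ k * x" for k
  proof (induction k)
    case (Suc k)
    have "x * b ^ Suc k = (x * b) * b ^ k" by (simp add: mult.assoc)
    also have "\<dots> = (b + 1) * (x * b ^ k)" by (simp only: assms(4) mult.assoc)
    also have "\<dots> = (b + 1) ^ Suc k * x" by (simp only: Suc mult.assoc power_Suc)
    finally show ?case .
  qed simp
  have "(b + 1) ^ (p ^ v) * x = b ^ (p ^ v) * x"
    using pw[of "p ^ v"] centerD[OF assms(5), of x] by (rule trans[OF sym sym])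
  then have "(b + 1) ^ (p ^ v) = b ^ (p ^ v)" using assms(3) by (rule mult_right_cancel[THEN iffD1, rotated])
  moreover have "(b + 1) ^ (p ^ v) = 1 + b ^ (p ^ v)"
    using binomial_commuting[of b 1 "p ^ v"] char_binomial_sum[OF p, of v "(^) b"] by simp
  ultimately show False by simp
qed

text \<open>\<open>P\<close> describes the violators, known to have central \<open>p ^ v\<close>-th
  powers. The partner \<open>b\<close> of \<open>x\<close> may violate \<open>P\<close>; the premise
  \<open>close\<close> supplies a correction \<open>c\<close> that leads back to \<open>P\<close>
  without disturbing the relation between \<open>x\<close> and \<open>b\<close>.\<close>

lemma inseparable_absurd:
  fixes x :: "'a::division_ring"
  assumes p: "prime p" "of_nat p = (0::'a)" and x: "P x" "x \<notin> center"
    and central: "\<And>y. P y \<Longrightarrow> y ^ (p ^ v) \<in> center" and close: "\<And>b. \<exists>c. c * x = x * c \<and> P (b + c)"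
  shows False
proof -
  obtain b where b: "x * b = (b + 1) * x" using inseparable_shift[OF p central[OF x(1)] x(2)] by blast
  obtain c where c: "c * x = x * c" "P (b + c)" using close by blast
  have "x * (b + c) = (b + c + 1) * x" using b c(1) by (simp add: distrib_left distrib_right)
  moreover have "x \<noteq> 0" using x(2) by auto
  ultimately show False using inseparable_contradiction[OF p] central[OF c(2)] by blast
qed

section \<open>Polynomials with central arguments\<close>

text \<open>The part of degree \<open>d\<close> in \<open>x\<close> of
  \<open>(1 + x) ^ n * w * (1 + x) ^ m\<close>, with \<open>w\<close> held fixed. Indices beyond
  \<open>n\<close> or \<open>m\<close> contribute nothing, their binomial coefficients being
  zero.\<close>

definition hom_part :: "nat \<Rightarrow> nat \<Rightarrow> 'a::division_ring \<Rightarrow> nat \<Rightarrow> 'a \<Rightarrow> 'a"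
  where "hom_part n m w d x
    = (\<Sum>i\<le>d. of_nat ((n choose i) * (m choose (d - i))) * (x ^ i * w * x ^ (d - i)))"

lemma sandwich_binomial:
  fixes x y w :: "'a::ring_1"
  assumes "x * y = y * x"
  shows "(x + y) ^ n * w * (x + y) ^ m = (\<Sum>(i, j)\<in>{..n} \<times> {..m}.
    of_nat ((n choose i) * (m choose j)) * (x ^ i * y ^ (n - i) * w * (x ^ j * y ^ (m - j))))"
proof -
  have "(x + y) ^ n * w * (x + y) ^ m = (\<Sum>i\<le>n. \<Sum>j\<le>m.
      of_nat (n choose i) * x ^ i * y ^ (n - i) * w * (of_nat (m choose j) * x ^ j * y ^ (m - j)))"
    by (simp only: binomial_commuting[OF assms] sum_distrib_right[of _ _ w] sum_product)
  also have "\<dots> = (\<Sum>i\<le>n. \<Sum>j\<le>m.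
      of_nat ((n choose i) * (m choose j)) * (x ^ i * y ^ (n - i) * w * (x ^ j * y ^ (m - j))))"
  proof (intro sum.cong refl)
    fix i j
    have "of_nat (n choose i) * x ^ i * y ^ (n - i) * w * (of_nat (m choose j) * x ^ j * y ^ (m - j))
        = of_nat (n choose i) * ((x ^ i * y ^ (n - i) * w) * of_nat (m choose j)) * (x ^ j * y ^ (m - j))"
      by (simp only: mult.assoc)
    also have "(x ^ i * y ^ (n - i) * w) * of_nat (m choose j) = of_nat (m choose j) * (x ^ i * y ^ (n - i) * w)"
      by (rule mult_of_nat_commute[symmetric])
    finally show "of_nat (n choose i) * x ^ i * y ^ (n - i) * w * (of_nat (m choose j) * x ^ j * y ^ (m - j))
        = of_nat ((n choose i) * (m choose j)) * (x ^ i * y ^ (n - i) * w * (x ^ j * y ^ (m - j)))"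
      by (simp add: mult.assoc)
  qed
  finally show ?thesis by (simp only: sum.cartesian_product)
qed

lemma sandwich_expand:
  fixes w :: "'a::division_ring"
  shows "(1 + x) ^ n * w * (1 + x) ^ m = (\<Sum>d\<le>n + m. hom_part n m w d x)"
proof -
  define t where "t i j = of_nat ((n choose i) * (m choose j)) * (x ^ i * w * x ^ j)" for i j
  have t0: "t i j = 0" if "\<not> (i \<le> n \<and> j \<le> m)" for i j
  proof -
    have "n choose i = 0 \<or> m choose j = 0" using that by auto
    then show ?thesis unfolding t_def by (elim disjE) (simp_all only: mult_zero_left mult_zero_right of_nat_0)
  qed
  have "(1 + x) ^ n * w * (1 + x) ^ m = (\<Sum>(i,j)\<in>{..n} \<times> {..m}. t i j)"
    using sandwich_binomial[of x 1 n w m] by (simp add: t_def add.commute)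
  \<comment> \<open>The rectangle is enlarged to a triangle by terms with a zero binomial
    coefficient, so that regrouping by total degree becomes a library reindexing.\<close>
  also have "\<dots> = (\<Sum>(i,j)\<in>{(i,j). i + j \<le> n + m}. t i j)"
  proof (rule sum.mono_neutral_left)
    have "{(i,j). i + j \<le> n + m} \<subseteq> {..n + m} \<times> {..n + m}" by auto
    then show "finite {(i,j). i + j \<le> n + m}" by (rule finite_subset) auto
    show "\<forall>i\<in>{(i, j). i + j \<le> n + m} - {..n} \<times> {..m}. (case i of (i, j) \<Rightarrow> t i j) = 0"
      using t0 by auto
  qed auto
  also have "\<dots> = (\<Sum>d\<le>n + m. \<Sum>i\<le>d. t i (d - i))"
    by (rule sum.triangle_reindex_eq)
  finally show ?thesis by (simp add: t_def hom_part_def)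
qed

lemma hom_part_top [simp]: "hom_part n m w (n + m) x = x ^ n * w * x ^ m"
proof -
  have "hom_part n m w (n + m) x
    = (\<Sum>i\<in>{n}. of_nat ((n choose i) * (m choose (n + m - i))) * (x ^ i * w * x ^ (n + m - i)))"
    unfolding hom_part_def
  proof (rule sum.mono_neutral_right)
    show "\<forall>i\<in>{..n + m} - {n}.
      of_nat ((n choose i) * (m choose (n + m - i))) * (x ^ i * w * x ^ (n + m - i)) = 0"
    proof
      fix i assume "i \<in> {..n + m} - {n}"
      then have "i > n \<or> n + m - i > m" by auto
      then show "of_nat ((n choose i) * (m choose (n + m - i))) * (x ^ i * w * x ^ (n + m - i)) = 0"
        by (auto simp: binomial_eq_0)
    qed
  qed auto
  then show ?thesis by simp
qed

lemma hom_part_scale: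
  assumes z: "z \<in> center"
  shows "hom_part n m w d (z * x) = z ^ d * hom_part n m w d x"
  unfolding hom_part_def sum_distrib_left
proof (intro sum.cong refl)
  fix i assume i: "i \<in> {..d}"
  have zc: "z ^ k * y = y * z ^ k" for k y
    by (rule centerD[OF center_power[OF z]])
  have "(z * x) ^ i * w * (z * x) ^ (d - i) = z ^ i * (x ^ i * w * z ^ (d - i)) * x ^ (d - i)"
    by (simp add: center_power_mult[OF z] mult.assoc)
  also have "x ^ i * w * z ^ (d - i) = z ^ (d - i) * (x ^ i * w)"
    by (rule zc[symmetric])
  also have "z ^ i * (z ^ (d - i) * (x ^ i * w)) * x ^ (d - i) = z ^ d * (x ^ i * w * x ^ (d - i))"
    using i by (simp add: mult.assoc[symmetric] power_add[symmetric])
  finally have e: "(z * x) ^ i * w * (z * x) ^ (d - i) = z ^ d * (x ^ i * w * x ^ (d - i))" .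
  show "of_nat ((n choose i) * (m choose (d - i))) * ((z * x) ^ i * w * (z * x) ^ (d - i))
      = z ^ d * (of_nat ((n choose i) * (m choose (d - i))) * (x ^ i * w * x ^ (d - i)))"
    unfolding e using zc[of d "of_nat ((n choose i) * (m choose (d - i)))"]
    by (simp only: mult.assoc[symmetric])
qed

lemma sandwich_scale:
  assumes "z \<in> center"
  shows "(z * x) ^ n * w * (z * x) ^ m = z ^ (n + m) * (x ^ n * w * x ^ m)"
  using hom_part_scale[OF assms, of n m w "n + m" x] by simp

lemma hom_part_central:
  assumes w: "w \<in> center"
  shows "hom_part n m w d x = of_nat (n + m choose d) * w * x ^ d"
proof -
  have "hom_part n m w d x = (\<Sum>i\<le>d. of_nat ((n choose i) * (m choose (d - i))) * (w * x ^ d))"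
    unfolding hom_part_def
  proof (intro sum.cong refl)
    fix i assume i: "i \<in> {..d}"
    have "x ^ i * w * x ^ (d - i) = w * (x ^ i * x ^ (d - i))"
      using centerD[OF w, of "x ^ i"] by (simp add: mult.assoc[symmetric])
    then show "of_nat ((n choose i) * (m choose (d - i))) * (x ^ i * w * x ^ (d - i))
      = of_nat ((n choose i) * (m choose (d - i))) * (w * x ^ d)"
      using i by (simp add: power_add[symmetric])
  qed
  also have "\<dots> = of_nat (\<Sum>i\<le>d. (n choose i) * (m choose (d - i))) * (w * x ^ d)"
    by (simp only: sum_distrib_right[symmetric] of_nat_sum)
  finally show ?thesis by (simp add: vandermonde mult.assoc)
qed

text \<open>Let \<open>p ^ v\<close> be the exact power of \<open>p\<close> in \<open>l\<close>,
  where \<open>l\<close> is \<open>n\<close> if \<open>p\<close> divides it and \<open>m\<close>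
  otherwise. All \<open>l choose i\<close> with \<open>0 < i < p ^ v\<close> vanish in the ring, so
  every term with factors \<open>x\<close> on both sides of \<open>w\<close> disappears, while
  \<open>l choose p ^ v\<close> keeps one of the two end terms alive.\<close>

lemma hom_part_prime_power:
  assumes char: "CHAR('a::division_ring) = p" "prime p" and nm: "n > 0" "m > 0"
  obtains v \<alpha> \<beta> where "p dvd n \<or> p dvd m \<Longrightarrow> v > 0" "p ^ v < n + m"
    "of_nat \<alpha> \<noteq> (0::'a) \<or> of_nat \<beta> \<noteq> (0::'a)"
    "\<And>w x :: 'a. hom_part n m w (p ^ v) x = of_nat \<alpha> * (x ^ (p ^ v) * w) + of_nat \<beta> * (w * x ^ (p ^ v))"
proof -
  define l where "l = (if p dvd n then n else m)"
  define v where "v = multiplicity p l"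
  have l0: "l > 0" using nm by (simp add: l_def)
  then obtain r where r: "l = p ^ v * r" "\<not> p dvd r"
    using char(2) multiplicity_decompose' not_prime_unit unfolding v_def by (metis neq0_conv)
  have v0: "v > 0" if "p dvd n \<or> p dvd m"
    using that r by (cases v) (auto simp: l_def split: if_splits)
  have k0: "p ^ v > 0" using char(2) prime_gt_0_nat by auto
  have "p ^ v \<le> l" using r l0 by (cases r) auto
  with nm have kN: "p ^ v < n + m" by (auto simp: l_def split: if_splits)
  have zero: "of_nat (l choose i) = (0::'a)" if "0 < i" "i < p ^ v" for i
    using prime_dvd_prime_power_choose[OF char(2) that] char(1) r
    by (simp add: of_nat_eq_0_iff_char_dvd)
  have nz: "of_nat (l choose p ^ v) \<noteq> (0::'a)"
    using not_prime_dvd_prime_power_choose[OF char(2) r(2)] char(1) r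
    by (simp add: of_nat_eq_0_iff_char_dvd)
  have "hom_part n m w (p ^ v) x = (\<Sum>i\<in>{0, p ^ v}. of_nat ((n choose i) * (m choose (p ^ v - i)))
      * (x ^ i * w * x ^ (p ^ v - i)))" for w x :: 'a
    unfolding hom_part_def
  proof (rule sum.mono_neutral_right)
    show "\<forall>i\<in>{..p ^ v} - {0, p ^ v}. of_nat ((n choose i) * (m choose (p ^ v - i)))
      * (x ^ i * w * x ^ (p ^ v - i)) = 0"
    proof
      fix i assume "i \<in> {..p ^ v} - {0, p ^ v}"
      then have "0 < i" "i < p ^ v" "0 < p ^ v - i" "p ^ v - i < p ^ v" by auto
      then have "of_nat (n choose i) = (0::'a) \<or> of_nat (m choose (p ^ v - i)) = (0::'a)"
        using zero unfolding l_def by (cases "p dvd n") auto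
      then show "of_nat ((n choose i) * (m choose (p ^ v - i))) * (x ^ i * w * x ^ (p ^ v - i)) = 0"
        by auto
    qed
  qed auto
  then have H: "hom_part n m w (p ^ v) x
      = of_nat (n choose p ^ v) * (x ^ (p ^ v) * w) + of_nat (m choose p ^ v) * (w * x ^ (p ^ v))" for w x :: 'a
    using k0 by (simp add: add.commute)
  have "of_nat (n choose p ^ v) \<noteq> (0::'a) \<or> of_nat (m choose p ^ v) \<noteq> (0::'a)"
    using nz by (auto simp: l_def split: if_splits)
  with v0 kN H show thesis by (intro that[of v "n choose p ^ v" "m choose p ^ v"]) auto
qed

text \<open>The derivative of \<open>x ^ k\<close> in direction \<open>y\<close>: the sum of all
  \<open>x ^ i * y * x ^ (k - 1 - i)\<close>, which is the coefficient of \<open>z\<close> in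
  \<open>(x + z * y) ^ k\<close> for central \<open>z\<close>.\<close>

primrec powd :: "nat \<Rightarrow> 'a::division_ring \<Rightarrow> 'a \<Rightarrow> 'a" where
  "powd 0 x y = 0"
| "powd (Suc k) x y = x * powd k x y + y * x ^ k"

lemma powd_left: "powd k x (x * y) = x * powd k x y"
  by (induction k) (simp_all add: distrib_left mult.assoc)

lemma powd_right: "powd k x (y * x) = powd k x y * x"
  by (induction k) (simp_all add: distrib_right mult.assoc power_commutes)

text \<open>The sum telescopes. This converts a derivative vanishing in every direction into
  centrality of \<open>x ^ k\<close>.\<close>

lemma powd_commutator: "x * powd k x y - powd k x y * x = x ^ k * y - y * x ^ k"
proof (induction k)
  case (Suc k)
  have "x * powd (Suc k) x y - powd (Suc k) x y * x
      = x * (x * powd k x y - powd k x y * x) + (x * y * x ^ k - y * x ^ Suc k)"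
    by (simp add: algebra_simps power_commutes)
  also have "\<dots> = x ^ Suc k * y - y * x ^ Suc k"
    by (simp add: Suc right_diff_distrib mult.assoc)
  finally show ?case .
qed simp

lemma powd_0_imp_central:
  assumes "\<And>y. powd k x y = 0"
  shows "x ^ k \<in> center"
  using powd_commutator[of x k] assms by (simp add: center_def)

text \<open>The values \<open>Y = powd k x y\<close> are stable under multiplication by
  \<open>x\<close> on either side. Subtracting \<open>x\<close> times the relation for
  \<open>y\<close> from the relation for \<open>x * y\<close> leaves
  \<open>\<beta> * ((w * x - x * w) * Y)\<close>; the mirror image leaves
  \<open>\<alpha> * (Y * (x * w - w * x))\<close>.\<close>

lemma powd_annihilator:
  assumes c: "\<alpha> \<in> center" "\<beta> \<in> center" "\<alpha> \<noteq> 0 \<or> \<beta> \<noteq> 0"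
    and zero: "\<And>y. \<alpha> * (powd k x y * w) + \<beta> * (w * powd k x y) = 0"
    and "x * w \<noteq> w * x"
  shows "powd k x y = 0"
proof -
  define Y where "Y = powd k x y"
  have 0: "\<alpha> * (Y * w) + \<beta> * (w * Y) = 0" using zero[of y] by (simp add: Y_def)
  have 1: "\<alpha> * (x * Y * w) + \<beta> * (w * (x * Y)) = 0"
    using zero[of "x * y"] by (simp add: Y_def powd_left)
  have 2: "\<alpha> * (Y * x * w) + \<beta> * (w * (Y * x)) = 0"
    using zero[of "y * x"] by (simp add: Y_def powd_right)
  have ca: "x * (\<alpha> * u) = \<alpha> * (x * u)" "x * (\<beta> * u) = \<beta> * (x * u)" for u
    using centerD[OF c(1), of x] centerD[OF c(2), of x] by (simp_all only: mult.assoc[symmetric])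
  have "\<beta> * ((w * x - x * w) * Y) = (\<alpha> * (x * Y * w) + \<beta> * (w * (x * Y)))
      - x * (\<alpha> * (Y * w) + \<beta> * (w * Y))"
    by (simp add: algebra_simps ca)
  then have b: "\<beta> * ((w * x - x * w) * Y) = 0" by (simp only: 0 1) simp
  have "\<alpha> * (Y * (x * w - w * x)) = (\<alpha> * (Y * x * w) + \<beta> * (w * (Y * x)))
      - (\<alpha> * (Y * w) + \<beta> * (w * Y)) * x"
    by (simp add: algebra_simps)
  then have a: "\<alpha> * (Y * (x * w - w * x)) = 0" by (simp only: 0 2) simp
  from a b c(3) assms(5) show ?thesis by (auto simp: Y_def)
qed

text \<open>Coefficients form a total sequence and the formula is demanded for every cutoff past
  some \<open>d\<close>, so that two such functions can always be brought to a common
  cutoff.\<close>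

definition zpoly :: "('a::division_ring \<Rightarrow> 'a) \<Rightarrow> (nat \<Rightarrow> 'a) \<Rightarrow> bool"
  where "zpoly F a \<longleftrightarrow> (\<exists>d. \<forall>e\<ge>d. a e = 0 \<and> (\<forall>z\<in>center. F z = (\<Sum>j<e. a j * z ^ j)))"

lemma zpolyI:
  assumes "\<And>e. e \<ge> d \<Longrightarrow> a e = 0" "\<And>z. z \<in> center \<Longrightarrow> F z = (\<Sum>j<d. a j * z ^ j)"
  shows "zpoly F a"
  unfolding zpoly_def
proof (intro exI[of _ d] allI impI conjI ballI)
  fix e z assume e: "e \<ge> d" and z: "z \<in> (center :: 'a set)"
  have "(\<Sum>j<d. a j * z ^ j) = (\<Sum>j<e. a j * z ^ j)"
    by (rule sum.mono_neutral_left) (use e assms(1) in auto)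
  with assms(2)[OF z] show "F z = (\<Sum>j<e. a j * z ^ j)" by simp
qed (rule assms(1))

lemma zpolyE:
  assumes "zpoly F a"
  obtains d where "\<And>e. e \<ge> d \<Longrightarrow> a e = 0" "\<And>e z. e \<ge> d \<Longrightarrow> z \<in> center \<Longrightarrow> F z = (\<Sum>j<e. a j * z ^ j)"
  using assms unfolding zpoly_def by metis

text \<open>The difference of the two polynomials has infinitely many commuting zeros. All
  comparisons of homogeneous parts pass through this lemma.\<close>

lemma zpoly_unique:
  fixes F :: "'a::division_ring \<Rightarrow> 'a"
  assumes "infinite (center :: 'a set)" "zpoly F a" "zpoly G b" "\<And>z. z \<in> center \<Longrightarrow> F z = G z"
  shows "a j = b j"
proof -
  obtain d1 where d1: "\<And>e z. e \<ge> d1 \<Longrightarrow> z \<in> center \<Longrightarrow> F z = (\<Sum>j<e. a j * z ^ j)"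
    by (rule zpolyE[OF assms(2)]) blast
  obtain d2 where d2: "\<And>e z. e \<ge> d2 \<Longrightarrow> z \<in> center \<Longrightarrow> G z = (\<Sum>j<e. b j * z ^ j)"
    by (rule zpolyE[OF assms(3)]) blast
  define e where "e = j + d1 + d2"
  have "a j - b j = 0"
  proof (rule center_vandermonde[OF assms(1)])
    show "j \<le> e" by (simp add: e_def)
    fix z :: 'a assume z: "z \<in> center"
    have "(\<Sum>j<Suc e. a j * z ^ j) = (\<Sum>j<Suc e. b j * z ^ j)"
      by (rule trans[OF d1[symmetric] trans[OF assms(4) d2]]) (use z in \<open>auto simp: e_def\<close>)
    then show "(\<Sum>j\<le>e. (a j - b j) * z ^ j) = 0"
      by (simp only: left_diff_distrib sum_subtractf lessThan_Suc_atMost) simp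
  qed
  then show ?thesis by simp
qed

lemma zpoly_const: "zpoly (\<lambda>_. c) (\<lambda>j. if j = 0 then c else 0)"
  by (rule zpolyI[of 1]) auto

lemma zpoly_add:
  assumes "zpoly F a" "zpoly G b"
  shows "zpoly (\<lambda>z. F z + G z) (\<lambda>j. a j + b j)"
proof -
  obtain d1 where d1: "\<And>e. e \<ge> d1 \<Longrightarrow> a e = 0"
    "\<And>e z. e \<ge> d1 \<Longrightarrow> z \<in> center \<Longrightarrow> F z = (\<Sum>j<e. a j * z ^ j)"
    by (rule zpolyE[OF assms(1)]) blast
  obtain d2 where d2: "\<And>e. e \<ge> d2 \<Longrightarrow> b e = 0"
    "\<And>e z. e \<ge> d2 \<Longrightarrow> z \<in> center \<Longrightarrow> G z = (\<Sum>j<e. b j * z ^ j)"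
    by (rule zpolyE[OF assms(2)]) blast
  show ?thesis
  proof (rule zpolyI[of "d1 + d2"])
    fix z :: 'a assume z: "z \<in> center"
    have "F z = (\<Sum>j<d1 + d2. a j * z ^ j)" "G z = (\<Sum>j<d1 + d2. b j * z ^ j)"
      using z by (auto intro: d1(2) d2(2))
    then show "F z + G z = (\<Sum>j<d1 + d2. (a j + b j) * z ^ j)"
      by (simp add: distrib_right sum.distrib)
  qed (simp add: d1(1) d2(1))
qed

lemma zpoly_lmult:
  assumes "zpoly F a"
  shows "zpoly (\<lambda>z. c * F z) (\<lambda>j. c * a j)"
proof -
  obtain d where d: "\<And>e. e \<ge> d \<Longrightarrow> a e = 0"
    "\<And>e z. e \<ge> d \<Longrightarrow> z \<in> center \<Longrightarrow> F z = (\<Sum>j<e. a j * z ^ j)"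
    by (rule zpolyE[OF assms]) blast
  show ?thesis
    by (rule zpolyI[of d]) (use d(1) in simp, simp add: d(2)[of d] sum_distrib_left mult.assoc)
qed

lemma zpoly_rmult:
  assumes "zpoly F a"
  shows "zpoly (\<lambda>z. F z * c) (\<lambda>j. a j * c)"
proof -
  obtain d where d: "\<And>e. e \<ge> d \<Longrightarrow> a e = 0"
    "\<And>e z. e \<ge> d \<Longrightarrow> z \<in> center \<Longrightarrow> F z = (\<Sum>j<e. a j * z ^ j)"
    by (rule zpolyE[OF assms]) blast
  show ?thesis
  proof (rule zpolyI[of d])
    fix z :: 'a assume z: "z \<in> center"
    have "a j * z ^ j * c = a j * c * z ^ j" for j
      using centerD[OF center_power[OF z], of j c] by (simp add: mult.assoc)
    then show "F z * c = (\<Sum>j<d. a j * c * z ^ j)"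
      using d(2)[of d z] z by (simp add: sum_distrib_right)
  qed (use d in auto)
qed

lemma zpoly_diff:
  assumes "zpoly F a" "zpoly G b"
  shows "zpoly (\<lambda>z. F z - G z) (\<lambda>j. a j - b j)"
  using zpoly_add[OF assms(1) zpoly_lmult[OF assms(2), of "-1"]] by simp

lemma zpoly_shift1:
  assumes "zpoly F a"
  shows "zpoly (\<lambda>z. z * F z) (\<lambda>j. case j of 0 \<Rightarrow> 0 | Suc i \<Rightarrow> a i)"
proof -
  obtain d where d: "\<And>e. e \<ge> d \<Longrightarrow> a e = 0"
    "\<And>e z. e \<ge> d \<Longrightarrow> z \<in> center \<Longrightarrow> F z = (\<Sum>j<e. a j * z ^ j)"
    by (rule zpolyE[OF assms]) blast
  show ?thesis
  proof (rule zpolyI[of "Suc d"])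
    fix z :: 'a assume z: "z \<in> center"
    have "z * F z = F z * z" by (rule centerD[OF z])
    also have "\<dots> = (\<Sum>j<d. a j * z ^ Suc j)"
      using d(2)[of d z] z by (simp add: sum_distrib_right power_commutes mult.assoc)
    also have "\<dots> = (\<Sum>j<Suc d. (case j of 0 \<Rightarrow> 0 | Suc i \<Rightarrow> a i) * z ^ j)"
      by (simp only: sum.lessThan_Suc_shift) simp
    finally show "z * F z = (\<Sum>j<Suc d. (case j of 0 \<Rightarrow> 0 | Suc i \<Rightarrow> a i) * z ^ j)" .
  qed (use d in \<open>auto split: nat.splits\<close>)
qed

lemma zpoly_shift:
  assumes "zpoly F a"
  shows "zpoly (\<lambda>z. z ^ e * F z) (\<lambda>j. if j < e then 0 else a (j - e))"
proof (induction e)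
  case (Suc e)
  have "(\<lambda>j. case j of 0 \<Rightarrow> 0 | Suc i \<Rightarrow> (if i < e then 0 else a (i - e)))
      = (\<lambda>j. if j < Suc e then 0 else a (j - Suc e))"
    by (auto split: nat.splits)
  with zpoly_shift1[OF Suc] show ?case by (simp add: mult.assoc)
qed (use assms in simp)

lemma zpoly_monom: "zpoly (\<lambda>z. z ^ e * c) (\<lambda>j. if j = e then c else 0)"
  using zpoly_shift[OF zpoly_const[of c], of e]
  by (rule back_subst[of "zpoly _"]) auto

text \<open>Needed because a minus solution obeys a scaling law only for squares of central
  elements.\<close>

lemma zpoly_square:
  assumes "zpoly F a"
  shows "zpoly (\<lambda>z. F (z ^ 2)) (\<lambda>j. if even j then a (j div 2) else 0)"
proof -
  obtain d where d: "\<And>e. e \<ge> d \<Longrightarrow> a e = 0"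
    "\<And>e z. e \<ge> d \<Longrightarrow> z \<in> center \<Longrightarrow> F z = (\<Sum>j<e. a j * z ^ j)"
    by (rule zpolyE[OF assms]) blast
  show ?thesis
  proof (rule zpolyI[of "2 * d"])
    fix z :: 'a assume z: "z \<in> center"
    have "F (z ^ 2) = (\<Sum>j<d. a j * z ^ (2 * j))"
      using d(2)[of d "z ^ 2"] z by (simp add: center_power power_mult[symmetric] mult.commute)
    also have "\<dots> = (\<Sum>i\<in>(*) 2 ` {..<d}. (if even i then a (i div 2) else 0) * z ^ i)"
      by (subst sum.reindex) (auto simp: inj_on_def)
    also have "\<dots> = (\<Sum>i<2 * d. (if even i then a (i div 2) else 0) * z ^ i)"
      by (rule sum.mono_neutral_left) (auto elim!: evenE)
    finally show "F (z ^ 2) = (\<Sum>i<2 * d. (if even i then a (i div 2) else 0) * z ^ i)" .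
  qed (use d in auto)
qed

lemma zpoly_power:
  "\<exists>q. zpoly (\<lambda>z. (x + z * y) ^ k) q \<and> q 0 = x ^ k \<and> q 1 = powd k x y"
proof (induction k)
  case 0
  show ?case using zpoly_const[of 1] by (intro exI[of _ "\<lambda>j. if j = 0 then 1 else 0"]) simp
next
  case (Suc k)
  then obtain q where q: "zpoly (\<lambda>z. (x + z * y) ^ k) q" "q 0 = x ^ k" "q 1 = powd k x y" by blast
  have "zpoly (\<lambda>z. x * (x + z * y) ^ k + z * (y * (x + z * y) ^ k))
      (\<lambda>j. x * q j + (case j of 0 \<Rightarrow> 0 | Suc i \<Rightarrow> y * q i))"
    by (intro zpoly_add zpoly_lmult zpoly_shift1 q(1))
  then show ?case
    using q by (intro exI[of _ "\<lambda>j. x * q j + (case j of 0 \<Rightarrow> 0 | Suc i \<Rightarrow> y * q i)"])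
      (simp add: distrib_right mult.assoc)
qed

lemma zpoly_sandwich:
  "zpoly (\<lambda>z. (1 + z * x) ^ n * w * (1 + z * x) ^ m)
    (\<lambda>d. if d \<le> n + m then hom_part n m w d x else 0)"
proof (rule zpolyI[of "Suc (n + m)"])
  fix z :: 'a assume z: "z \<in> center"
  show "(1 + z * x) ^ n * w * (1 + z * x) ^ m
    = (\<Sum>d<Suc (n + m). (if d \<le> n + m then hom_part n m w d x else 0) * z ^ d)"
    unfolding sandwich_expand hom_part_scale[OF z] lessThan_Suc_atMost
    by (intro sum.cong refl) (simp add: centerD[OF center_power[OF z]])
qed auto

section \<open>Additivity of homogeneous parts over an infinite center\<close>

text \<open>For the derivation \<open>d\<close> given by commutation with \<open>c\<close>,
  \<open>d (d y) = 0\<close> and Leibniz give \<open>0 = d (d (x * x)) = 2 * (d x * d x)\<close>,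
  and a division ring has no nilpotents.\<close>

lemma central_if_ad_square_zero:
  fixes c :: "'a::division_ring"
  assumes two: "(2::'a) \<noteq> 0" and sq: "\<And>x. c * (c * x - x * c) = (c * x - x * c) * c"
  shows "c \<in> center"
  unfolding center_def
proof (rule CollectI, rule allI)
  fix x
  define d where "d y = c * y - y * c" for y
  have dd: "d (d y) = 0" for y using sq[of y] by (simp add: d_def)
  have leib: "d (y * z) = d y * z + y * d z" for y z by (simp add: d_def algebra_simps)
  have d_add: "d (y + z) = d y + d z" for y z by (simp add: d_def algebra_simps)
  have "d (d (x * x)) = 2 * (d x * d x)"
    by (simp only: leib d_add dd) (simp only: mult_zero_left mult_zero_right mult_2 add_0 add_0_right)
  then have "2 * (d x * d x) = 0" by (simp only: dd)
  with two have "d x = 0" by simp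
  then show "c * x = x * c" by (simp add: d_def)
qed

text \<open>If \<open>p\<close> does not divide \<open>N\<close>, take \<open>N - 1\<close>.
  Otherwise take the exact power of \<open>p\<close> in \<open>N\<close>: it is odd, so the evenness
  of \<open>N\<close> keeps it strictly below \<open>N\<close>.\<close>

lemma exists_binomial_nonzero:
  assumes "prime (p::nat)" "p \<noteq> 2" "even N" "N > 2"
  shows "\<exists>d. 2 \<le> d \<and> d < N \<and> \<not> p dvd (N choose d)"
proof (cases "p dvd N")
  case False
  have "N choose (N - 1) = N" using assms by (subst binomial_symmetric) auto
  with False assms show ?thesis by (intro exI[of _ "N - 1"]) auto
next
  case True
  define v where "v = multiplicity p N"
  obtain r where r: "N = p ^ v * r" "\<not> p dvd r"
    using assms multiplicity_decompose' not_prime_unit unfolding v_def by (metis not_less_zero)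
  have "v > 0" using True r by (cases v) auto
  have "odd p" using assms prime_odd_nat[of p] prime_ge_2_nat[of p] by linarith
  then have "odd (p ^ v)" by simp
  then have "p ^ v \<noteq> N" using assms by metis
  moreover have "p ^ v \<le> N" using r assms by (cases r) auto
  moreover have "p \<le> p ^ v" using \<open>v > 0\<close> assms prime_gt_0_nat[of p] by (simp add: self_le_power)
  moreover have "\<not> p dvd (N choose p ^ v)"
    using not_prime_dvd_prime_power_choose[OF assms(1) r(2)] r by simp
  ultimately show ?thesis using assms prime_ge_2_nat[of p] by (intro exI[of _ "p ^ v"]) auto
qed

text \<open>In \<open>(s * x) ^ d * s = s * (x * s) ^ d\<close> replace \<open>s\<close> by
  \<open>s + z\<close> with \<open>z\<close> central. As \<open>d > 1\<close>, the coefficient of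
  \<open>z\<close> gives \<open>(s * x) ^ d = (x * s) ^ d\<close>, and additivity turns this into
  \<open>(s * x - x * s) ^ d = 0\<close>.\<close>

lemma power_not_additive_infinite_center:
  fixes d :: nat
  assumes inf: "infinite (center :: 'a::division_ring set)" and "(center :: 'a set) \<noteq> UNIV"
    and "d \<ge> 2" and add: "\<And>x y :: 'a. (x + y) ^ d = x ^ d + y ^ d"
  shows False
proof -
  obtain s :: 'a where "s \<notin> center" using assms(2) by auto
  then obtain x where x: "s * x \<noteq> x * s" by (auto simp: center_def)
  have conj: "(a * y) ^ d * a = a * (y * a) ^ d" for a y :: 'a
  proof -
    have "(a * y) ^ k * a = a * (y * a) ^ k" for k
    proof (induction k)
      case (Suc k)
      have "(a * y) ^ Suc k * a = a * y * ((a * y) ^ k * a)" by (simp add: mult.assoc)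
      also have "\<dots> = a * (y * a) ^ Suc k" by (simp only: Suc power_Suc mult.assoc)
      finally show ?case .
    qed simp
    then show ?thesis .
  qed
  have "zpoly (\<lambda>z. z ^ 1 * ((s * x) ^ d - (x * s) ^ d) + z ^ d * (x ^ d * s - s * x ^ d))
      (\<lambda>j. (if j = 1 then (s * x) ^ d - (x * s) ^ d else 0)
        + (if j = d then x ^ d * s - s * x ^ d else 0))"
    by (intro zpoly_add zpoly_monom)
  moreover have "z ^ 1 * ((s * x) ^ d - (x * s) ^ d) + z ^ d * (x ^ d * s - s * x ^ d) = 0"
    if z: "z \<in> center" for z
  proof -
    have zx: "(z * x) ^ d = z ^ d * x ^ d" by (rule center_power_mult[OF z])
    have zd: "z ^ d * y = y * z ^ d" for y by (rule centerD[OF center_power[OF z]])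
    have "((s + z) * x) ^ d * (s + z) = (s + z) * (x * (s + z)) ^ d" by (rule conj)
    moreover have "(s + z) * x = s * x + z * x" "x * (s + z) = x * s + z * x"
      using centerD[OF z, of x] by (simp_all add: algebra_simps)
    ultimately have "((s * x) ^ d + z ^ d * x ^ d) * (s + z) = (s + z) * ((x * s) ^ d + z ^ d * x ^ d)"
      by (simp add: add zx)
    then have "(s * x) ^ d * s + z ^ d * x ^ d * s + z * ((s * x) ^ d) + z * (z ^ d * x ^ d)
      = s * (x * s) ^ d + s * (z ^ d * x ^ d) + z * ((x * s) ^ d) + z * (z ^ d * x ^ d)"
      using centerD[OF z, of "(s * x) ^ d"] centerD[OF z, of "z ^ d * x ^ d"]
      by (simp add: distrib_left distrib_right add_ac)
    moreover have "s * (z ^ d * x ^ d) = z ^ d * (s * x ^ d)"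
      using zd[of s] by (simp only: mult.assoc[symmetric])
    ultimately have "z * (s * x) ^ d + z ^ d * (x ^ d * s) = z * (x * s) ^ d + z ^ d * (s * x ^ d)"
      using conj[of s x] by (simp add: mult.assoc add_ac)
    moreover have "P - Q + (R - T) = 0" if "P + R = Q + T" for P Q R T :: 'a
      using that by (simp add: algebra_simps)
    ultimately show ?thesis by (simp only: right_diff_distrib power_one_right)
  qed
  ultimately have "(s * x) ^ d - (x * s) ^ d = 0"
    using zpoly_unique[OF inf _ zpoly_const[of 0], where j = 1] \<open>d \<ge> 2\<close> by fastforce
  moreover have "(s * x - x * s + x * s) ^ d = (s * x - x * s) ^ d + (x * s) ^ d"
    by (rule add)
  ultimately have "(s * x - x * s) ^ d = 0" by simp
  with x show False by simp
qed

text \<open>By \<open>plus_solution_additive\<close> the displayed expression is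
  \<open>2 * f r\<close> for a plus solution with \<open>w = f 1\<close>, so \<open>add\<close> is
  the additivity of \<open>f\<close>. Scaling both arguments by central \<open>z\<close> separates
  the degrees; the subtracted terms remove degrees 0 and \<open>n + m\<close>, so only the parts
  strictly between are reached.\<close>

lemma plus_hom_parts_additive:
  fixes w :: "'a::division_ring"
  assumes inf: "infinite (center :: 'a set)"
    and add: "\<And>x y. (1 + (x + y)) ^ n * w * (1 + (x + y)) ^ m - (x + y) ^ n * w * (x + y) ^ m - w
      = ((1 + x) ^ n * w * (1 + x) ^ m - x ^ n * w * x ^ m - w)
      + ((1 + y) ^ n * w * (1 + y) ^ m - y ^ n * w * y ^ m - w)"
    and d: "0 < d" "d < n + m"
  shows "hom_part n m w d (x + y) = hom_part n m w d x + hom_part n m w d y"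
proof -
  define A where "A r = (1 + r) ^ n * w * (1 + r) ^ m - r ^ n * w * r ^ m - w" for r
  define a where "a x = (\<lambda>e. (if e \<le> n + m then hom_part n m w e x else 0)
     - (if e = n + m then hom_part n m w (n + m) x else 0) - (if e = 0 then w else 0))" for x
  have zA: "zpoly (\<lambda>z. A (z * x)) (a x)" for x
  proof -
    have "zpoly (\<lambda>z. (1 + z * x) ^ n * w * (1 + z * x) ^ m - z ^ (n + m) * hom_part n m w (n + m) x - w) (a x)"
      unfolding a_def by (intro zpoly_diff zpoly_sandwich zpoly_monom zpoly_const)
    then show ?thesis
      unfolding zpoly_def A_def
      using hom_part_scale[where n = n and m = m and w = w and d = "n + m" and x = x]
      by (simp only: hom_part_top) simp
  qed
  have "a (x + y) d = a x d + a y d"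
  proof (rule zpoly_unique[OF inf zA zpoly_add[OF zA zA]])
    show "A (z * (x + y)) = A (z * x) + A (z * y)" for z
      unfolding A_def distrib_left by (rule add)
  qed
  with d show ?thesis by (simp add: a_def)
qed

text \<open>For central \<open>w\<close> the part of degree \<open>d\<close> is
  \<open>(n + m choose d) * w * x ^ d\<close>; where the coefficient survives, the
  \<open>d\<close>-th power map would be additive.\<close>

lemma plus_solution_central_infinite_center:
  fixes w :: "'a::division_ring"
  assumes inf: "infinite (center :: 'a set)" and noncomm: "(center :: 'a set) \<noteq> UNIV"
    and char: "CHAR('a) = p" "prime p" "p \<noteq> 2"
    and nm: "n > 0" "m > 0" "even (n + m)" "n + m > 2"
    and hom: "\<And>d x y. 0 < d \<Longrightarrow> d < n + m \<Longrightarrow>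
      hom_part n m w d (x + y) = hom_part n m w d x + hom_part n m w d y"
    and w: "w \<in> center"
  shows "w = 0"
proof (rule ccontr)
  assume "w \<noteq> 0"
  obtain d where d: "2 \<le> d" "d < n + m" "\<not> p dvd (n + m choose d)"
    using exists_binomial_nonzero[OF char(2,3) nm(3,4)] by blast
  define u where "u = of_nat (n + m choose d) * w"
  have "u \<noteq> 0" using d(3) char(1) \<open>w \<noteq> 0\<close> by (simp add: u_def of_nat_eq_0_iff_char_dvd)
  have "(x + y) ^ d = x ^ d + y ^ d" for x y :: 'a
  proof -
    have "u * (x + y) ^ d = u * (x ^ d + y ^ d)"
      using hom[of d x y] d by (simp add: hom_part_central[OF w] u_def distrib_left)
    with \<open>u \<noteq> 0\<close> show ?thesis by simp
  qed
  with power_not_additive_infinite_center[OF inf noncomm d(1)] show False by blast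
qed

text \<open>Replacing \<open>x\<close> by \<open>x + z y\<close> with \<open>z\<close> central, the coefficient of \<open>z\<close> must vanish.\<close>

lemma additive_sandwich_powd:
  fixes w :: "'a::division_ring"
  assumes inf: "infinite (center :: 'a set)" and "k \<ge> 2"
    and H: "\<And>x. H x = \<alpha> * (x ^ k * w) + \<beta> * (w * x ^ k)"
    and add: "\<And>x y. H (x + y) = H x + H y" and scale: "\<And>z x. z \<in> center \<Longrightarrow> H (z * x) = z ^ k * H x"
  shows "\<alpha> * (powd k x y * w) + \<beta> * (w * powd k x y) = 0"
proof -
  obtain q where q: "zpoly (\<lambda>z. (x + z * y) ^ k) q" "q 1 = powd k x y"
    using zpoly_power by blast
  have "zpoly (\<lambda>z. \<alpha> * ((x + z * y) ^ k * w) + \<beta> * (w * (x + z * y) ^ k))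
      (\<lambda>j. \<alpha> * (q j * w) + \<beta> * (w * q j))"
    by (intro zpoly_add zpoly_lmult zpoly_rmult q(1))
  moreover have "zpoly (\<lambda>z. H x + z ^ k * H y) (\<lambda>j. (if j = 0 then H x else 0) + (if j = k then H y else 0))"
    by (intro zpoly_add zpoly_monom zpoly_const)
  ultimately have "\<alpha> * (q 1 * w) + \<beta> * (w * q 1) = (if 1 = (0::nat) then H x else 0) + (if 1 = k then H y else 0)"
    by (rule zpoly_unique[OF inf]) (simp only: H[symmetric] add scale)
  with q(2) \<open>k \<ge> 2\<close> show ?thesis by simp
qed

text \<open>When \<open>p\<close> divides an exponent, the part of degree \<open>p ^ v\<close> has
  \<open>v > 0\<close>, so it is additive of degree at least 2 and its derivative vanishes.
  Violators are the elements not commuting with \<open>w\<close>; if \<open>b\<close> is none, then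
  \<open>b + x\<close> is one.\<close>

lemma plus_solution_divisible_infinite_center:
  fixes w :: "'a::division_ring"
  assumes inf: "infinite (center :: 'a set)"
    and char: "CHAR('a) = p" "prime p"
    and nm: "n > 0" "m > 0" "p dvd n \<or> p dvd m"
    and hom: "\<And>d x y. 0 < d \<Longrightarrow> d < n + m \<Longrightarrow>
      hom_part n m w d (x + y) = hom_part n m w d x + hom_part n m w d y"
  shows "w \<in> center"
proof (rule ccontr)
  assume "w \<notin> center"
  then obtain x where "w * x \<noteq> x * w" by (auto simp: center_def)
  then have x: "x * w \<noteq> w * x" by simp
  obtain v \<alpha> \<beta> where v: "v > 0" "p ^ v < n + m" "of_nat \<alpha> \<noteq> (0::'a) \<or> of_nat \<beta> \<noteq> (0::'a)"
    and H: "\<And>w x :: 'a. hom_part n m w (p ^ v) x = of_nat \<alpha> * (x ^ (p ^ v) * w) + of_nat \<beta> * (w * x ^ (p ^ v))"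
    by (rule hom_part_prime_power[OF char nm(1,2)]) (use nm(3) in blast)
  have p0: "of_nat p = (0::'a)" using char(1) by (metis of_nat_CHAR)
  have "p \<le> p ^ v" using v(1) char(2) prime_gt_0_nat[of p] by (simp add: self_le_power)
  then have k2: "p ^ v \<ge> 2" using prime_ge_2_nat[OF char(2)] by linarith
  have central: "y ^ (p ^ v) \<in> center" if y: "y * w \<noteq> w * y" for y
  proof (rule powd_0_imp_central)
    fix y'
    show "powd (p ^ v) y y' = 0"
    proof (rule powd_annihilator[OF _ _ v(3) _ y])
      have "p > 0" using prime_gt_0_nat[OF char(2)] .
      then show "of_nat \<alpha> * (powd (p ^ v) y u * w) + of_nat \<beta> * (w * powd (p ^ v) y u) = 0" for u
        using k2 v(2) by (intro additive_sandwich_powd[OF inf k2 H] hom hom_part_scale) auto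
    qed auto
  qed
  show False
  proof (rule inseparable_absurd[where P = "\<lambda>y. y * w \<noteq> w * y", OF char(2) p0 x _ central])
    show "x \<notin> center" using x centerD[of x w] by blast
    show "\<exists>c. c * x = x * c \<and> (b + c) * w \<noteq> w * (b + c)" for b
    proof (cases "b * w = w * b")
      case True
      then show ?thesis using x by (intro exI[of _ x]) (simp add: distrib_left distrib_right)
    qed (intro exI[of _ 0], simp)
  qed
qed

lemma hom_part_2:
  "2 * hom_part n m w 2 x = of_nat (n * (n - 1)) * (x * x * w) + of_nat (2 * n * m) * (x * w * x)
    + of_nat (m * (m - 1)) * (w * x * x)"
proof -
  have "2 * (k choose 2) = k * (k - 1)" for k :: nat
    by (cases "even k") (auto simp: choose_two)
  then have c: "2 * of_nat (k choose 2) = (of_nat (k * (k - 1)) :: 'a)" for k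
    by (metis of_nat_mult of_nat_numeral)
  have "{..2} = {0, 1, 2::nat}" by auto
  then have "hom_part n m w 2 x = of_nat (m choose 2) * (w * x * x) + of_nat (n * m) * (x * w * x)
      + of_nat (n choose 2) * (x * x * w)"
    by (simp add: hom_part_def power2_eq_square mult.assoc add_ac)
  then have "2 * hom_part n m w 2 x = (2 * of_nat (m choose 2)) * (w * x * x) + (2 * of_nat (n * m)) * (x * w * x)
      + (2 * of_nat (n choose 2)) * (x * x * w)"
    by (simp only: distrib_left mult.assoc)
  also have "2 * of_nat (n * m) = (of_nat (2 * n * m) :: 'a)"
    by (simp add: mult.assoc)
  finally show ?thesis by (simp only: c add_ac)
qed

text \<open>The even part of degree two vanishes; it and its linearizations in direction \<open>1\<close> decide
  the case where neither exponent is divisible by the characteristic.\<close>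

lemma plus_solution_coprime_infinite_center:
  fixes w :: "'a::division_ring"
  assumes char: "CHAR('a) = p" "prime p" "p \<noteq> 2"
    and nm: "n > 0" "m > 0" "n + m > 2" "\<not> p dvd n" "\<not> p dvd m"
    and hom: "\<And>d x y. 0 < d \<Longrightarrow> d < n + m \<Longrightarrow>
      hom_part n m w d (x + y) = hom_part n m w d x + hom_part n m w d y"
  shows "w \<in> center"
proof (rule ccontr)
  assume nc: "w \<notin> center"
  then have w0: "w \<noteq> 0" by auto
  have two: "(2::'a) \<noteq> 0" by (rule two_nonzero) (simp add: char)
  define a b where "a = (of_nat n :: 'a)" and "b = (of_nat m :: 'a)"
  have ab0: "a \<noteq> 0" "b \<noteq> 0"
    using nm(4,5) char(1) by (simp_all add: a_def b_def of_nat_eq_0_iff_char_dvd)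
  have ac: "y * a = a * y" "y * (a * u) = a * (y * u)" for y u
    unfolding a_def using mult_of_nat_commute[of n y] by (simp_all only: mult.assoc[symmetric])
  have bc: "y * b = b * y" "y * (b * u) = b * (y * u)" for y u
    unfolding b_def using mult_of_nat_commute[of m y] by (simp_all only: mult.assoc[symmetric])
  define Q where "Q x = a * (a - 1) * (x * x * w) + 2 * (a * b * (x * w * x)) + b * (b - 1) * (w * x * x)" for x
  have Q0: "Q x = 0" for x
  proof -
    define h where "h = hom_part n m w 2"
    have add: "h (y + y') = h y + h y'" for y y' unfolding h_def using nm by (intro hom) auto
    have "h (- 1 * x) = (- 1) ^ 2 * h x"
      unfolding h_def by (rule hom_part_scale) (simp add: center_def)
    then have "h (- x) = h x" by simp
    moreover have "h 0 = 0" using add[of 0 0] by simp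
    then have "h x + h (- x) = 0" using add[of x "- x"] by simp
    ultimately have "2 * h x = 0" by (simp add: mult_2)
    then have "of_nat (n * (n - 1)) * (x * x * w) + of_nat (2 * n * m) * (x * w * x)
      + of_nat (m * (m - 1)) * (w * x * x) = 0"
      unfolding h_def by (simp only: hom_part_2)
    moreover have "of_nat (n * (n - 1)) = a * (a - 1)" "of_nat (m * (m - 1)) = b * (b - 1)"
      using nm by (simp_all add: a_def b_def of_nat_diff)
    moreover have "of_nat (2 * n * m) = 2 * (a * b)" by (simp add: a_def b_def mult.assoc)
    ultimately have "a * (a - 1) * (x * x * w) + 2 * (a * b) * (x * w * x) + b * (b - 1) * (w * x * x) = 0"
      by (simp only:)
    then show ?thesis by (simp add: Q_def mult.assoc)
  qed
  \<comment> \<open>The common factor that appears when \<open>Q\<close> is polarized in direction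
    \<open>1\<close>.\<close>
  define s where "s = a + b - 1"
  have lin: "s * (a * (x * w) + b * (w * x)) = 0" for x
  proof -
    have "Q (x + 1) - Q x - Q 1 = 2 * (s * (a * (x * w) + b * (w * x)))"
      unfolding Q_def s_def
      by (simp add: algebra_simps mult_2 ac[of x] ac[of w] ac[of b] bc[of x] bc[of w])
    with Q0 two show ?thesis by simp
  qed
  show False
  proof (cases "s = 0")
    case False
    with lin have l: "a * (x * w) + b * (w * x) = 0" for x by simp
    from l[of 1] have "(a + b) * w = 0" by (simp add: distrib_right)
    with w0 have "b = - a" by (simp add: add_eq_0_iff)
    with l have "a * (x * w - w * x) = 0" for x by (simp add: algebra_simps)
    with ab0 have "w * x = x * w" for x by simp
    with nc show False by (simp add: center_def)
  next
    case True
    then have b: "b = 1 - a" by (simp add: s_def eq_diff_eq add.commute)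
    \<comment> \<open>If \<open>a + b = 1\<close>, then \<open>Q x\<close> is \<open>- a * b\<close>
      times the double commutator of \<open>x\<close> with \<open>w\<close>. Polarizing in direction
      \<open>w\<close> exchanges the roles, which makes the commutator with \<open>w\<close> square
      to zero.\<close>
    have S: "x * x * w - 2 * (x * w * x) + w * x * x = 0" for x
    proof -
      have "Q x = - (a * b * (x * x * w - 2 * (x * w * x) + w * x * x))"
        unfolding Q_def b by (simp add: algebra_simps mult_2)
      with Q0[of x] ab0 show ?thesis by simp
    qed
    have "w * (w * x - x * w) = (w * x - x * w) * w" for x
    proof -
      define S where "S x = x * x * w - 2 * (x * w * x) + w * x * x" for x
      have "S (x + w) - S x - S w = - (w * (w * x - x * w) - (w * x - x * w) * w)"
        unfolding S_def by (simp add: algebra_simps mult_2)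
      with S show ?thesis by (simp add: S_def)
    qed
    then show False using central_if_ad_square_zero[OF two] nc by blast
  qed
qed

lemma plus_solution_infinite_center:
  fixes w :: "'a::division_ring"
  assumes inf: "infinite (center :: 'a set)" and noncomm: "(center :: 'a set) \<noteq> UNIV"
    and char: "CHAR('a) = p" "prime p" "p \<noteq> 2"
    and nm: "n > 0" "m > 0" "even (n + m)" "n + m > 2"
    and add: "\<And>x y. (1 + (x + y)) ^ n * w * (1 + (x + y)) ^ m - (x + y) ^ n * w * (x + y) ^ m - w
      = ((1 + x) ^ n * w * (1 + x) ^ m - x ^ n * w * x ^ m - w)
      + ((1 + y) ^ n * w * (1 + y) ^ m - y ^ n * w * y ^ m - w)"
  shows "w = 0"
proof -
  note hom = plus_hom_parts_additive[OF inf add]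
  have "w \<in> center"
    using plus_solution_divisible_infinite_center[OF inf char(1,2) nm(1,2) _ hom]
      plus_solution_coprime_infinite_center[OF char nm(1,2,4) _ _ hom] by blast
  then show ?thesis
    using plus_solution_central_infinite_center[OF inf noncomm char nm hom] by blast
qed

section \<open>Additive maps semi-invariant under inversion\<close>

definition inv_solution :: "'a::division_ring \<Rightarrow> nat \<Rightarrow> nat \<Rightarrow> ('a \<Rightarrow> 'a) \<Rightarrow> bool"
  where "inv_solution s n m f \<longleftrightarrow> (\<forall>x y. f (x + y) = f x + f y) \<and>
    (\<forall>y. y \<noteq> 0 \<longrightarrow> f y = s * (y ^ n * f (inverse y) * y ^ m))"

lemma inv_solution_add: "inv_solution s n m f \<Longrightarrow> f (x + y) = f x + f y"
  unfolding inv_solution_def by blast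

lemma inv_solution_eq:
  "inv_solution s n m f \<Longrightarrow> y \<noteq> 0 \<Longrightarrow> f y = s * (y ^ n * f (inverse y) * y ^ m)"
  unfolding inv_solution_def by blast

lemma inv_solution_0: "inv_solution s n m f \<Longrightarrow> f 0 = 0"
  using inv_solution_add[of s n m f 0 0] by simp

lemma inv_solution_minus: "inv_solution s n m f \<Longrightarrow> f (- x) = - f x"
  using inv_solution_add[of s n m f x "- x"] inv_solution_0[of s n m f]
  by (simp add: eq_neg_iff_add_eq_0 add.commute)

lemma inv_solution_diff: "inv_solution s n m f \<Longrightarrow> f (x - y) = f x - f y"
  using inv_solution_add[of s n m f x "- y"] inv_solution_minus[of s n m f y] by simp

lemma inv_solution_inverse:
  assumes "inv_solution s n m f" "s = 1 \<or> s = -1" "y \<noteq> 0"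
  shows "f (inverse y) = s * (inverse y ^ n * f y * inverse y ^ m)"
  using assms unfolding inv_solution_def by (metis inverse_inverse_eq inverse_nonzero_iff_nonzero)

text \<open>This is \<open>y\<^sup>-\<^sup>1 - (1 + y)\<^sup>-\<^sup>1 = (y (1 + y))\<^sup>-\<^sup>1\<close> under \<open>f\<close>.\<close>

lemma inv_solution_square:
  fixes y :: "'a::division_ring"
  assumes f: "inv_solution s n m f" and s: "s = 1 \<or> s = -1" and nm: "n > 0" "m > 0" "even (n + m)"
  shows "(1 + y) ^ n * f y * (1 + y) ^ m = f y + f (y * y) + y ^ n * f y * y ^ m + y ^ n * f 1 * y ^ m"
proof -
  \<comment> \<open>The claim contains no inverses but its derivation needs \<open>y\<close> and
    \<open>1 + y\<close> invertible. At \<open>y = -1\<close> both sides vanish because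
    \<open>n + m\<close> is even.\<close>
  consider "y = 0" | "y = -1" | "y \<noteq> 0" "1 + y \<noteq> 0"
    by (metis add.commute add_eq_0_iff)
  then show ?thesis
  proof cases
    case 1
    then show ?thesis using nm inv_solution_0[OF f] by simp
  next
    case 2
    have "(- 1) ^ n * w * (- 1) ^ m = w" for w :: 'a
      using nm(3) by (cases "even n") auto
    then show ?thesis using 2 nm inv_solution_minus[OF f, of 1] by simp
  next
    case 3
    define u where "u = y * (1 + y)"
    have u0: "u \<noteq> 0" using 3 by (simp add: u_def)
    have comm: "y * (1 + y) = (1 + y) * y" by (simp add: algebra_simps)
    have inv: "inverse u = inverse y - inverse (1 + y)"
    proof (rule inverse_unique)
      have "u * inverse y = 1 + y" using 3 by (simp add: u_def comm mult.assoc)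
      moreover have "u * inverse (1 + y) = y" using 3 by (simp add: u_def mult.assoc)
      ultimately show "u * (inverse y - inverse (1 + y)) = 1" by (simp add: right_diff_distrib)
    qed
    have pow: "u ^ k = y ^ k * (1 + y) ^ k" "u ^ k = (1 + y) ^ k * y ^ k" for k
      using power_mult_commuting[OF comm, of k] power_mult_commuting[OF comm[symmetric], of k]
      by (simp_all only: u_def comm)
    have ss: "s * (A * (s * B) * C) = A * B * C" for A B C using s by auto
    have "f u = s * (u ^ n * (f (inverse y) - f (inverse (1 + y))) * u ^ m)"
      using f u0 unfolding inv_solution_def inv[symmetric] inv_solution_diff[OF f, symmetric] by blast
    also have "\<dots> = s * (u ^ n * (s * (inverse y ^ n * f y * inverse y ^ m)) * u ^ m)
        - s * (u ^ n * (s * (inverse (1 + y) ^ n * f (1 + y) * inverse (1 + y) ^ m)) * u ^ m)"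
      unfolding inv_solution_inverse[OF f s 3(1)] inv_solution_inverse[OF f s 3(2)]
      by (simp only: right_diff_distrib left_diff_distrib)
    also have "s * (u ^ n * (s * (inverse y ^ n * f y * inverse y ^ m)) * u ^ m)
        = (u ^ n * inverse y ^ n) * f y * (inverse y ^ m * u ^ m)"
      by (simp only: ss) (simp only: mult.assoc)
    also have "u ^ n * inverse y ^ n = (1 + y) ^ n"
      using 3 unfolding pow(2) power_inverse by (simp add: mult.assoc)
    also have "inverse y ^ m * u ^ m = (1 + y) ^ m"
      using 3 unfolding pow(1) power_inverse by (simp add: mult.assoc[symmetric])
    also have "s * (u ^ n * (s * (inverse (1 + y) ^ n * f (1 + y) * inverse (1 + y) ^ m)) * u ^ m)
        = (u ^ n * inverse (1 + y) ^ n) * f (1 + y) * (inverse (1 + y) ^ m * u ^ m)"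
      by (simp only: ss) (simp only: mult.assoc)
    also have "u ^ n * inverse (1 + y) ^ n = y ^ n"
      using 3 unfolding pow(1) power_inverse by (simp add: mult.assoc)
    also have "inverse (1 + y) ^ m * u ^ m = y ^ m"
      using 3 unfolding pow(2) power_inverse by (simp add: mult.assoc[symmetric])
    finally have "f (y + y * y) = (1 + y) ^ n * f y * (1 + y) ^ m - y ^ n * f (1 + y) * y ^ m"
      by (simp add: u_def distrib_left)
    then show ?thesis
      by (simp add: inv_solution_add[OF f] algebra_simps)
  qed
qed

text \<open>This is \<open>(1 - y)\<^sup>-\<^sup>1 + (1 - y\<^sup>-\<^sup>1)\<^sup>-\<^sup>1 = 1\<close> under \<open>f\<close>.\<close>

lemma plus_solution_double:
  fixes r :: "'a::division_ring"
  assumes f: "inv_solution 1 n m f" and nm: "n > 0" "m > 0" "even (n + m)"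
  shows "2 * f r = f 1 + r ^ n * f 1 * r ^ m - (1 - r) ^ n * f 1 * (1 - r) ^ m"
proof -
  consider "r = 0" | "r = 1" | "r \<noteq> 0" "1 - r \<noteq> 0" by auto
  then show ?thesis
  proof cases
    case 1
    then show ?thesis using nm inv_solution_0[OF f] by simp
  next
    case 2
    then show ?thesis using nm by (simp add: mult_2)
  next
    case 3
    \<comment> \<open>Since \<open>1 - r = (- r) * u\<close> with commuting factors, sandwiching the
      identity between \<open>(1 - r) ^ n\<close> and \<open>(1 - r) ^ m\<close> clears every
      inverse.\<close>
    define u where "u = 1 - inverse r"
    have ur: "1 - r = (- r) * u" "1 - r = u * (- r)" using 3 by (simp_all add: u_def algebra_simps)
    then have u0: "u \<noteq> 0" using 3 by auto
    have comm: "- r * u = u * (- r)" using ur by (rule trans[OF sym])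
    have pow: "(1 - r) ^ k = (- r) ^ k * u ^ k" "(1 - r) ^ k = u ^ k * (- r) ^ k" for k
      using power_mult_commuting[OF comm, of k] power_mult_commuting[OF comm[symmetric], of k]
      by (simp_all only: ur(1) comm)
    have "inverse (1 - r) + inverse u = 1"
    proof -
      have "inverse (1 - r) = inverse u * inverse (- r)"
        unfolding ur(1) using 3 u0 by (simp add: nonzero_inverse_mult_distrib)
      then have "inverse (1 - r) + inverse u = inverse u * (1 - inverse r)"
        using 3 by (simp add: right_diff_distrib nonzero_inverse_minus_eq)
      then show ?thesis using u0 by (simp add: u_def)
    qed
    then have "f (inverse (1 - r)) + f (inverse u) = f 1"
      using inv_solution_add[OF f, of "inverse (1 - r)" "inverse u"] by simp
    then have "inverse (1 - r) ^ n * f (1 - r) * inverse (1 - r) ^ m + inverse u ^ n * f u * inverse u ^ m = f 1"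
      using inv_solution_inverse[OF f _ 3(2)] inv_solution_inverse[OF f _ u0] by simp
    then have "(1 - r) ^ n * (inverse (1 - r) ^ n * f (1 - r) * inverse (1 - r) ^ m
        + inverse u ^ n * f u * inverse u ^ m) * (1 - r) ^ m = (1 - r) ^ n * f 1 * (1 - r) ^ m"
      by (simp only:)
    then have "((1 - r) ^ n * inverse (1 - r) ^ n) * f (1 - r) * (inverse (1 - r) ^ m * (1 - r) ^ m)
        + ((1 - r) ^ n * inverse u ^ n) * f u * (inverse u ^ m * (1 - r) ^ m) = (1 - r) ^ n * f 1 * (1 - r) ^ m"
      by (simp only: distrib_left distrib_right mult.assoc)
    moreover have "(1 - r) ^ n * inverse u ^ n = (- r) ^ n"
      unfolding pow(1) power_inverse using u0 by (simp add: mult.assoc)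
    moreover have "inverse u ^ m * (1 - r) ^ m = (- r) ^ m"
      unfolding pow(2) power_inverse using u0 by (simp add: mult.assoc[symmetric])
    moreover have "(1 - r) ^ n * inverse (1 - r) ^ n = 1" "inverse (1 - r) ^ m * (1 - r) ^ m = 1"
      using right_inverse[OF power_not_zero[OF 3(2)], of n] left_inverse[OF power_not_zero[OF 3(2)], of m]
      by (simp_all only: power_inverse)
    ultimately have e1: "f (1 - r) + (- r) ^ n * f u * (- r) ^ m = (1 - r) ^ n * f 1 * (1 - r) ^ m"
      by (simp only: mult_1_left mult_1_right)
    have fu: "f u = f 1 - f (inverse r)" unfolding u_def by (rule inv_solution_diff[OF f])
    have "(- r) ^ n * f u * (- r) ^ m = r ^ n * f u * r ^ m"
      using nm(3) by (cases "even n") (auto simp: power_minus_odd)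
    also have "\<dots> = r ^ n * f 1 * r ^ m - r ^ n * f (inverse r) * r ^ m"
      by (simp only: fu right_diff_distrib left_diff_distrib)
    also have "r ^ n * f (inverse r) * r ^ m = f r"
      using inv_solution_eq[OF f 3(1)] by simp
    finally have e2: "(- r) ^ n * f u * (- r) ^ m = r ^ n * f 1 * r ^ m - f r" .
    have "f 1 - f r + (r ^ n * f 1 * r ^ m - f r) = (1 - r) ^ n * f 1 * (1 - r) ^ m"
      using e1 unfolding e2 inv_solution_diff[OF f] .
    then have "f r + f r + (1 - r) ^ n * f 1 * (1 - r) ^ m = f 1 + r ^ n * f 1 * r ^ m"
      by (simp only: diff_add_eq add_diff_eq diff_diff_eq diff_eq_eq eq_diff_eq add_ac)
    then show ?thesis by (simp only: mult_2 eq_diff_eq)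
  qed
qed

text \<open>Replace \<open>r\<close> by \<open>- r\<close> in the previous lemma, signs cancelling
  since \<open>n + m\<close> is even. Where 2 is nonzero, a plus solution is thus determined by
  \<open>f 1\<close>, and it only remains to prove \<open>f 1 = 0\<close>.\<close>

lemma plus_solution_additive:
  fixes f :: "'a::division_ring \<Rightarrow> 'a"
  assumes f: "inv_solution 1 n m f" and nm: "n > 0" "m > 0" "even (n + m)"
  shows "2 * f r = (1 + r) ^ n * f 1 * (1 + r) ^ m - r ^ n * f 1 * r ^ m - f 1"
proof -
  have "(- r) ^ n * x * (- r) ^ m = r ^ n * x * r ^ m" for x
    using nm(3) by (cases "even n") (auto simp: power_minus_odd)
  with plus_solution_double[OF f nm, of "- r"]
  have "- (2 * f r) = f 1 + r ^ n * f 1 * r ^ m - (1 + r) ^ n * f 1 * (1 + r) ^ m"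
    by (simp add: inv_solution_minus[OF f])
  then have "2 * f r = - (f 1 + r ^ n * f 1 * r ^ m - (1 + r) ^ n * f 1 * (1 + r) ^ m)"
    by (metis minus_minus)
  then show ?thesis by simp
qed

lemma minus_solution_1:
  fixes f :: "'a::division_ring \<Rightarrow> 'a"
  assumes f: "inv_solution (-1) n m f" and two: "(2::'a) \<noteq> 0"
  shows "f 1 = 0"
proof -
  have "f 1 = - f 1" using inv_solution_eq[OF f, of 1] by simp
  then have "2 * f 1 = 0" by (simp add: mult_2 eq_neg_iff_add_eq_0)
  with two show ?thesis by simp
qed

lemma inv_solution_odd:
  fixes f :: "'a::division_ring \<Rightarrow> 'a"
  assumes f: "inv_solution s n m f" and two: "(2::'a) \<noteq> 0" and odd: "odd (n + m)"
  shows "f y = 0"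
proof (cases "y = 0")
  case False
  have e: "f x = s * (x ^ n * f (inverse x) * x ^ m)" if "x \<noteq> 0" for x
    using inv_solution_eq[OF f that] .
  have "(- y) ^ n * x * (- y) ^ m = - (y ^ n * x * y ^ m)" for x
    using odd by (cases "even n") (auto simp: power_minus_odd)
  then have "f (- y) = s * (y ^ n * f (inverse y) * y ^ m)"
    using e[of "- y"] False by (simp add: nonzero_inverse_minus_eq inv_solution_minus[OF f])
  then have "- f y = f y" using e[of y] False by (simp add: inv_solution_minus[OF f])
  then have "2 * f y = 0" by (simp add: mult_2 neg_eq_iff_add_eq_0)
  with two show ?thesis by simp
qed (simp add: inv_solution_0[OF f])

text \<open>Comparing the equations at \<open>y\<close> and \<open>2 * y\<close> yields
  \<open>4 * f y = 2 ^ (n + m) * f y\<close>; here \<open>n + m > 2\<close> is decisive.\<close>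

lemma inv_solution_char_0:
  fixes f :: "'a::division_ring \<Rightarrow> 'a"
  assumes f: "inv_solution s n m f" and s: "s = 1 \<or> s = -1" and char: "CHAR('a) = 0" and nm: "n + m > 2"
  shows "f y = 0"
proof (cases "y = 0")
  case False
  have inj: "k = 0" if "of_nat k = (0::'a)" for k
    using that char by (simp add: of_nat_eq_0_iff_char_dvd)
  have two: "(2::'a) \<noteq> 0" using inj[of 2] by auto
  have e: "f x = s * (x ^ n * f (inverse x) * x ^ m)" if "x \<noteq> 0" for x
    using inv_solution_eq[OF f that] .
  have f2: "f (2 * x) = 2 * f x" for x by (simp add: mult_2 inv_solution_add[OF f])
  have t: "(2::'a) \<in> center" using center_of_nat[of 2] by simp
  have "2 * inverse (2 * y) = inverse (2 * y) * 2" by (rule centerD[OF t])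
  also have "\<dots> = inverse y"
    by (simp only: nonzero_inverse_mult_distrib[OF two False] mult.assoc left_inverse[OF two] mult_1_right)
  finally have "f (inverse y) = f (2 * inverse (2 * y))" by simp
  then have h: "2 * f (inverse (2 * y)) = f (inverse y)" by (simp add: f2)
  have "f (2 * y) = s * ((2 * y) ^ n * f (inverse (2 * y)) * (2 * y) ^ m)"
    using e[of "2 * y"] two False by simp
  then have "2 * (2 * f y) = 2 * (s * ((2 * y) ^ n * f (inverse (2 * y)) * (2 * y) ^ m))"
    by (simp add: f2)
  also have "\<dots> = s * ((2 * y) ^ n * (2 * f (inverse (2 * y))) * (2 * y) ^ m)"
    by (simp add: mult_2 distrib_left distrib_right)
  also have "\<dots> = s * (2 ^ (n + m) * (y ^ n * f (inverse y) * y ^ m))"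
    by (simp only: sandwich_scale[OF t] h)
  also have "\<dots> = 2 ^ (n + m) * f y"
    using s e[OF False] by auto
  finally have "(2 ^ (n + m) - 4) * f y = 0"
    by (simp add: left_diff_distrib mult.assoc[symmetric])
  moreover have "(2::'a) ^ (n + m) \<noteq> 4"
  proof
    assume "(2::'a) ^ (n + m) = 4"
    moreover have le: "(2::nat) ^ 3 \<le> 2 ^ (n + m)" using nm by (intro power_increasing) auto
    ultimately have "of_nat (2 ^ (n + m) - 4) = (0::'a)" by (subst of_nat_diff) auto
    then have "(2::nat) ^ (n + m) - 4 = 0" by (rule inj)
    with le show False by simp
  qed
  ultimately show ?thesis by simp
qed (simp add: inv_solution_0[OF f])

section \<open>Infinite center\<close>

lemma plus_solution_zero_infinite_center:
  fixes f :: "'a::division_ring \<Rightarrow> 'a"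
  assumes inf: "infinite (center :: 'a set)" and noncomm: "(center :: 'a set) \<noteq> UNIV"
    and char: "CHAR('a) = p" "prime p" "p \<noteq> 2" and two: "(2::'a) \<noteq> 0"
    and nm: "n > 0" "m > 0" "even (n + m)" "n + m > 2"
    and f: "inv_solution 1 n m f"
  shows "f r = 0"
proof -
  note A = plus_solution_additive[OF f nm(1-3)]
  have "f 1 = 0"
  proof (rule plus_solution_infinite_center[OF inf noncomm char nm])
    fix x y
    show "(1 + (x + y)) ^ n * f 1 * (1 + (x + y)) ^ m - (x + y) ^ n * f 1 * (x + y) ^ m - f 1
      = ((1 + x) ^ n * f 1 * (1 + x) ^ m - x ^ n * f 1 * x ^ m - f 1)
      + ((1 + y) ^ n * f 1 * (1 + y) ^ m - y ^ n * f 1 * y ^ m - f 1)"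
      unfolding A[symmetric] inv_solution_add[OF f] by (rule distrib_left)
  qed
  then have "2 * f r = 0" unfolding A by simp
  with two show ?thesis by simp
qed

text \<open>The equation at \<open>z * y\<close> and at \<open>inverse z * y\<close> exchanges the
  two terms of \<open>h x = f (z * x) - z ^ (n + m) * f (inverse z * x)\<close>, each with a minus
  sign; so \<open>h\<close> is a plus solution and vanishes. Evaluate it at
  \<open>z * x\<close>.\<close>

lemma minus_solution_scale:
  fixes f :: "'a::division_ring \<Rightarrow> 'a"
  assumes inf: "infinite (center :: 'a set)" and noncomm: "(center :: 'a set) \<noteq> UNIV"
    and char: "CHAR('a) = p" "prime p" "p \<noteq> 2" and two: "(2::'a) \<noteq> 0"
    and nm: "n > 0" "m > 0" "even (n + m)" "n + m > 2"
    and f: "inv_solution (-1) n m f" and z: "z \<in> center"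
  shows "f (z ^ 2 * x) = z ^ (n + m) * f x"
proof (cases "z = 0")
  case True
  with nm show ?thesis by (simp add: inv_solution_0[OF f])
next
  case False
  have z': "inverse z \<in> center" by (rule center_inverse[OF z])
  define h where "h x = f (z * x) - z ^ (n + m) * f (inverse z * x)" for x
  have "inv_solution 1 n m h"
    unfolding inv_solution_def
  proof (intro conjI allI impI)
    fix x y
    show "h (x + y) = h x + h y"
      by (simp add: h_def distrib_left inv_solution_add[OF f])
  next
    fix y :: 'a assume y: "y \<noteq> 0"
    have inv: "inverse (z * y) = inverse z * inverse y" "inverse (inverse z * y) = z * inverse y"
      using False y centerD[OF z', of "inverse y"] centerD[OF z, of "inverse y"]
      by (simp_all add: nonzero_inverse_mult_distrib)
    have 1: "f (z * y) = - (z ^ (n + m) * (y ^ n * f (inverse z * inverse y) * y ^ m))"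
      using inv_solution_eq[OF f, of "z * y"] False y by (simp add: inv sandwich_scale[OF z])
    have "f (inverse z * y) = - (inverse z ^ (n + m) * (y ^ n * f (z * inverse y) * y ^ m))"
      using inv_solution_eq[OF f, of "inverse z * y"] False y by (simp add: inv sandwich_scale[OF z'])
    then have "z ^ (n + m) * f (inverse z * y)
        = - ((z ^ (n + m) * inverse z ^ (n + m)) * (y ^ n * f (z * inverse y) * y ^ m))"
      by (simp only: mult_minus_right mult.assoc)
    then have 2: "z ^ (n + m) * f (inverse z * y) = - (y ^ n * f (z * inverse y) * y ^ m)"
      using right_inverse[OF power_not_zero[OF False], of "n + m"] by (simp only: power_inverse mult_1_left)
    have "y ^ n * (z ^ (n + m) * u) * y ^ m = z ^ (n + m) * (y ^ n * u * y ^ m)" for u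
      using centerD[OF center_power[OF z], of "n + m" "y ^ n"] by (simp only: mult.assoc[symmetric])
    then have "y ^ n * h (inverse y) * y ^ m
      = y ^ n * f (z * inverse y) * y ^ m - z ^ (n + m) * (y ^ n * f (inverse z * inverse y) * y ^ m)"
      by (simp only: h_def right_diff_distrib left_diff_distrib)
    then show "h y = 1 * (y ^ n * h (inverse y) * y ^ m)"
      by (simp add: h_def 1 2)
  qed
  then have h0: "h x = 0" for x
    by (rule plus_solution_zero_infinite_center[OF inf noncomm char two nm])
  have "inverse z * (z * x) = x" using False by (simp add: mult.assoc[symmetric])
  with h0[of "z * x"] show ?thesis
    by (simp add: h_def power2_eq_square mult.assoc)
qed

lemma zpoly_binomial:
  "zpoly (\<lambda>z. (a + z) ^ k) (\<lambda>j. if j \<le> k then of_nat (k choose j) * a ^ (k - j) else 0)"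
proof (rule zpolyI[of "Suc k"])
  fix z :: 'a assume z: "z \<in> center"
  have "(a + z) ^ k = (z + a) ^ k" by (simp add: add.commute)
  also have "\<dots> = (\<Sum>j\<le>k. of_nat (k choose j) * z ^ j * a ^ (k - j))"
    by (rule binomial_commuting[OF centerD[OF z]])
  also have "\<dots> = (\<Sum>j\<le>k. of_nat (k choose j) * a ^ (k - j) * z ^ j)"
    by (intro sum.cong refl) (simp only: mult.assoc centerD[OF center_power[OF z]])
  finally show "(a + z) ^ k = (\<Sum>j<Suc k. (if j \<le> k then of_nat (k choose j) * a ^ (k - j) else 0) * z ^ j)"
    by (simp only: lessThan_Suc_atMost) simp
qed auto

text \<open>Two rounds of the inseparability argument. Violators are first the \<open>x\<close> not
  commuting with \<open>f x\<close>, which makes \<open>f\<close> central valued, then the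
  \<open>x\<close> with \<open>f x\<close> nonzero.\<close>

lemma minus_solution_infinite_center:
  fixes f :: "'a::division_ring \<Rightarrow> 'a"
  assumes inf: "infinite (center :: 'a set)" and noncomm: "(center :: 'a set) \<noteq> UNIV"
    and char: "CHAR('a) = p" "prime p" "p \<noteq> 2" and two: "(2::'a) \<noteq> 0"
    and nm: "n > 0" "m > 0" "even (n + m)" "n + m > 2"
    and f: "inv_solution (-1) n m f"
  shows "f y = 0"
proof (rule ccontr)
  assume fy: "f y \<noteq> 0"
  define N where "N = n + m"
  have N: "N > 2" using nm by (simp add: N_def)
  have f_add: "f (x + y) = f x + f y" for x y by (rule inv_solution_add[OF f])
  have f_scale: "f (z ^ 2 * x) = z ^ N * f x" if "z \<in> center" for z x
    unfolding N_def by (rule minus_solution_scale[OF inf noncomm char two nm f that])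
  have f1: "f 1 = 0" by (rule minus_solution_1[OF f two])
  have p0: "of_nat p = (0::'a)" using char(1) by (metis of_nat_CHAR)
  \<comment> \<open>Put \<open>z ^ 2 * x\<close> into \<open>inv_solution_square\<close>. The part
    of degree \<open>d\<close> acquires weight \<open>N + 2 * d\<close> in \<open>z\<close>, whereas
    the right side has only the weights \<open>N\<close>, \<open>2 * N\<close> and
    \<open>3 * N\<close>; strictly inside, only the middle degree can match.\<close>
  have hp: "hom_part n m (f x) d x = (if 2 * d = N then f (x * x) else 0)" if d: "0 < d" "d < N" for x d
  proof -
    define S where "S z = (1 + z * x) ^ n * f x * (1 + z * x) ^ m" for z
    define e where "e = (\<lambda>d. if d \<le> n + m then hom_part n m (f x) d x else 0)"
    have "zpoly S e" unfolding S_def e_def by (rule zpoly_sandwich)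
    then have "zpoly (\<lambda>z. z ^ N * S (z ^ 2)) (\<lambda>j. if j < N then 0 else if even (j - N) then e ((j - N) div 2) else 0)"
      by (intro zpoly_shift zpoly_square)
    moreover have "zpoly (\<lambda>z. z ^ N * f x + z ^ (2 * N) * f (x * x) + z ^ (3 * N) * (x ^ n * f x * x ^ m))
      (\<lambda>j. (if j = N then f x else 0) + (if j = 2 * N then f (x * x) else 0)
        + (if j = 3 * N then x ^ n * f x * x ^ m else 0))"
      by (intro zpoly_add zpoly_monom)
    moreover have "z ^ N * S (z ^ 2)
        = z ^ N * f x + z ^ (2 * N) * f (x * x) + z ^ (3 * N) * (x ^ n * f x * x ^ m)"
      if z: "z \<in> center" for z
    proof -
      define y where "y = z ^ 2 * x"
      have z2: "z ^ 2 \<in> center" by (rule center_power[OF z])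
      have zN: "A * (z ^ N * B) = z ^ N * (A * B)" for A B
        using centerD[OF center_power[OF z], of N A] by (simp only: mult.assoc[symmetric])
      have "y * y = (z ^ 2) ^ 2 * (x * x)"
        using center_power_mult[OF z2, of x 2] by (simp add: y_def power2_eq_square)
      then have "f (y * y) = (z ^ 2) ^ N * f (x * x)"
        using f_scale[OF z2] by simp
      then have fyy: "f (y * y) = z ^ (2 * N) * f (x * x)" by (simp only: power_mult)
      have "y ^ n * (z ^ N * f x) * y ^ m = z ^ N * (y ^ n * f x * y ^ m)"
        by (simp only: zN mult.assoc)
      also have "y ^ n * f x * y ^ m = hom_part n m (f x) (n + m) (z ^ 2 * x)"
        by (simp add: y_def)
      also have "\<dots> = (z ^ 2) ^ N * (x ^ n * f x * x ^ m)"
        unfolding hom_part_scale[OF z2] by (simp add: N_def)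
      finally have top: "y ^ n * f y * y ^ m = z ^ (3 * N) * (x ^ n * f x * x ^ m)"
        using f_scale[OF z, of x] by (simp add: y_def power_mult[symmetric] power_add[symmetric] mult.assoc[symmetric])
      have "z ^ N * S (z ^ 2) = (1 + y) ^ n * f y * (1 + y) ^ m"
        using f_scale[OF z, of x] by (simp only: S_def y_def zN mult.assoc)
      also have "\<dots> = f y + f (y * y) + y ^ n * f y * y ^ m + y ^ n * f 1 * y ^ m"
        by (rule inv_solution_square[OF f _ nm(1-3)]) simp
      finally show ?thesis
        using f_scale[OF z, of x] f1 by (simp only: fyy top) (simp add: y_def)
    qed
    ultimately have "(if N + 2 * d < N then 0 else if even (N + 2 * d - N) then e ((N + 2 * d - N) div 2) else 0)
      = (if N + 2 * d = N then f x else 0) + (if N + 2 * d = 2 * N then f (x * x) else 0)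
        + (if N + 2 * d = 3 * N then x ^ n * f x * x ^ m else 0)"
      by (rule zpoly_unique[OF inf])
    with d show ?thesis by (auto simp: e_def N_def split: if_splits)
  qed
  have "\<exists>v \<alpha> \<beta>. p ^ v < n + m \<and> (of_nat \<alpha> \<noteq> (0::'a) \<or> of_nat \<beta> \<noteq> (0::'a)) \<and>
    (\<forall>w x :: 'a. hom_part n m w (p ^ v) x = of_nat \<alpha> * (x ^ (p ^ v) * w) + of_nat \<beta> * (w * x ^ (p ^ v)))"
    by (rule hom_part_prime_power[OF char(1,2) nm(1,2)]) iprover
  then obtain v \<alpha> \<beta> where v: "p ^ v < n + m" "of_nat \<alpha> \<noteq> (0::'a) \<or> of_nat \<beta> \<noteq> (0::'a)"
    and H: "\<And>w x :: 'a. hom_part n m w (p ^ v) x = of_nat \<alpha> * (x ^ (p ^ v) * w) + of_nat \<beta> * (w * x ^ (p ^ v))"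
    by metis
  define k where "k = p ^ v"
  have k: "0 < k" "k < N" using v(1) prime_gt_0_nat[OF char(2)] by (simp_all add: k_def N_def)
  \<comment> \<open>Apply \<open>hp\<close> in degree \<open>k\<close> to
    \<open>x + z ^ 2 * u\<close> and read off the coefficient of \<open>z ^ 2\<close>. The
    contribution of \<open>f u\<close> starts at weight \<open>N > 2\<close>, and the right side,
    present only if \<open>2 * k = N\<close>, has weights 0, \<open>N\<close> and
    \<open>2 * N\<close>.\<close>
  have lin: "of_nat \<alpha> * (powd k x u * f x) + of_nat \<beta> * (f x * powd k x u) = 0" for x u
  proof -
    obtain q where q: "zpoly (\<lambda>z. (x + z * u) ^ k) q" "q 1 = powd k x u"
      using zpoly_power by blast
    define P where "P w z = of_nat \<alpha> * ((x + z * u) ^ k * w) + of_nat \<beta> * (w * (x + z * u) ^ k)" for w z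
    define c where "c w j = of_nat \<alpha> * (q j * w) + of_nat \<beta> * (w * q j)" for w j
    have zP: "zpoly (P w) (c w)" for w
      unfolding P_def c_def by (intro zpoly_add zpoly_lmult zpoly_rmult q(1))
    have "zpoly (\<lambda>z. P (f x) (z ^ 2) + z ^ N * P (f u) (z ^ 2))
      (\<lambda>j. (if even j then c (f x) (j div 2) else 0)
        + (if j < N then 0 else if even (j - N) then c (f u) ((j - N) div 2) else 0))"
      by (intro zpoly_add zpoly_shift zpoly_square zP)
    moreover define r where "r y = (if 2 * k = N then y else (0::'a))" for y
    have "zpoly (\<lambda>z. z ^ 0 * r (f (x * x)) + z ^ N * r (f (x * u + u * x)) + z ^ (2 * N) * r (f (u * u)))
      (\<lambda>j. (if j = 0 then r (f (x * x)) else 0) + (if j = N then r (f (x * u + u * x)) else 0)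
        + (if j = 2 * N then r (f (u * u)) else 0))"
      by (intro zpoly_add zpoly_monom)
    moreover have "P (f x) (z ^ 2) + z ^ N * P (f u) (z ^ 2)
      = z ^ 0 * r (f (x * x)) + z ^ N * r (f (x * u + u * x)) + z ^ (2 * N) * r (f (u * u))"
      if z: "z \<in> center" for z
    proof -
      define y where "y = x + z ^ 2 * u"
      have z2: "z ^ 2 \<in> center" by (rule center_power[OF z])
      have zN: "A * (z ^ N * B) = z ^ N * (A * B)" for A B
        using centerD[OF center_power[OF z], of N A] by (simp only: mult.assoc[symmetric])
      have fyy: "f y = f x + z ^ N * f u" by (simp only: y_def f_add f_scale[OF z])
      have "P (f x) (z ^ 2) + z ^ N * P (f u) (z ^ 2) = of_nat \<alpha> * (y ^ k * f y) + of_nat \<beta> * (f y * y ^ k)"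
        unfolding P_def y_def[symmetric] fyy
        by (simp only: distrib_left distrib_right zN[of "y ^ k"] zN[of "of_nat \<alpha>"] zN[of "of_nat \<beta>"] mult.assoc add_ac)
      also have "\<dots> = (if 2 * k = N then f (y * y) else 0)"
        using hp[OF k, of y] unfolding k_def H by simp
      also have "y * y = x * x + z ^ 2 * (x * u + u * x) + (z ^ 2) ^ 2 * (u * u)"
      proof -
        have a: "A * (z ^ 2 * B) = z ^ 2 * (A * B)" for A B
          using centerD[OF z2, of A] by (simp only: mult.assoc[symmetric])
        show ?thesis unfolding y_def power2_eq_square[of "z ^ 2"]
          by (simp only: distrib_left distrib_right mult.assoc a[of x] a[of u] add_ac)
      qed
      also have "f \<dots> = f (x * x) + z ^ N * f (x * u + u * x) + z ^ (2 * N) * f (u * u)"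
        by (simp only: f_add f_scale[OF z] f_scale[OF z2] power_mult)
      finally show ?thesis by (simp add: r_def)
    qed
    ultimately have "(if even (2::nat) then c (f x) (2 div 2) else 0)
        + (if 2 < N then 0 else if even (2 - N) then c (f u) ((2 - N) div 2) else 0)
      = (if 2 = (0::nat) then r (f (x * x)) else 0) + (if 2 = N then r (f (x * u + u * x)) else 0)
        + (if 2 = 2 * N then r (f (u * u)) else 0)"
      by (rule zpoly_unique[OF inf])
    then show ?thesis using N q(2) by (simp add: c_def)
  qed
  have dich: "x * f x = f x * x \<or> x ^ (p ^ v) \<in> center" for x
    using powd_annihilator[OF center_of_nat center_of_nat v(2) lin, of x] powd_0_imp_central[of k x]
    unfolding k_def by blast
  have zcomm: "zpoly (\<lambda>z. (x + z ^ 2 * u) * (f x + z ^ N * f u) - (f x + z ^ N * f u) * (x + z ^ 2 * u))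
    (\<lambda>j. (if j = 0 then x * f x - f x * x else 0) + (if j = 2 then u * f x - f x * u else 0)
      + (if j = N then x * f u - f u * x else 0) + (if j = N + 2 then u * f u - f u * u else 0))" for x u
  proof -
    have "zpoly (\<lambda>z. z ^ 0 * (x * f x - f x * x) + z ^ 2 * (u * f x - f x * u)
        + z ^ N * (x * f u - f u * x) + z ^ (N + 2) * (u * f u - f u * u))
      (\<lambda>j. (if j = 0 then x * f x - f x * x else 0) + (if j = 2 then u * f x - f x * u else 0)
      + (if j = N then x * f u - f u * x else 0) + (if j = N + 2 then u * f u - f u * u else 0))"
      by (intro zpoly_add zpoly_monom)
    moreover have "(x + z ^ 2 * u) * (f x + z ^ N * f u) - (f x + z ^ N * f u) * (x + z ^ 2 * u)
      = z ^ 0 * (x * f x - f x * x) + z ^ 2 * (u * f x - f x * u)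
        + z ^ N * (x * f u - f u * x) + z ^ (N + 2) * (u * f u - f u * u)" if z: "z \<in> center" for z
    proof -
      have a: "A * (z ^ i * B) = z ^ i * (A * B)" for A B i
        using centerD[OF center_power[OF z], of i A] by (simp only: mult.assoc[symmetric])
      have "z ^ 2 * (z ^ N * B) = z ^ (N + 2) * B" "z ^ N * (z ^ 2 * B) = z ^ (N + 2) * B" for B
        by (simp_all only: mult.assoc[symmetric] power_add[symmetric] add.commute[of 2 N])
      then have "z ^ 2 * (u * (z ^ N * f u)) = z ^ (N + 2) * (u * f u)"
        "z ^ N * (f u * (z ^ 2 * u)) = z ^ (N + 2) * (f u * u)"
        by (simp_all only: a[of u N] a[of "f u" 2])
      then show ?thesis
        by (simp add: distrib_left distrib_right right_diff_distrib mult.assoc a[of x] a[of "f x"])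
    qed
    ultimately show ?thesis unfolding zpoly_def by simp
  qed
  \<comment> \<open>If \<open>f\<close> commutes with its argument everywhere, the coefficient of
    \<open>z ^ 2\<close> in \<open>zcomm\<close> gives the claim. Otherwise the top coefficient at
    \<open>b + z ^ 2 * a\<close> is the nonzero commutator of \<open>a\<close> and
    \<open>f a\<close>, so some shift of \<open>b\<close> is again a violator.\<close>
  have central_valued: "f x \<in> center" for x
  proof (cases "\<forall>x. x * f x = f x * x")
    case True
    have "u * f x = f x * u" for u
    proof -
      have "(x + z ^ 2 * u) * (f x + z ^ N * f u) - (f x + z ^ N * f u) * (x + z ^ 2 * u) = 0"
        if "z \<in> center" for z
        using True[rule_format, of "x + z ^ 2 * u"] by (simp only: f_add f_scale[OF that]) simp
      from zpoly_unique[OF inf zcomm zpoly_const[of 0] this, of 2] N show ?thesis by simp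
    qed
    then show ?thesis by (simp add: center_def)
  next
    case False
    then obtain a where a: "a * f a \<noteq> f a * a" by blast
    have False
    proof (rule inseparable_absurd[where P = "\<lambda>y. y * f y \<noteq> f y * y", OF char(2) p0 a])
      show "a \<notin> center" using a centerD by blast
      show "y ^ (p ^ v) \<in> center" if "y * f y \<noteq> f y * y" for y using dich[of y] that by blast
      fix b
      show "\<exists>c. c * a = a * c \<and> (b + c) * f (b + c) \<noteq> f (b + c) * (b + c)"
      proof (rule ccontr)
        assume no: "\<not> ?thesis"
        have "(b + z ^ 2 * a) * (f b + z ^ N * f a) - (f b + z ^ N * f a) * (b + z ^ 2 * a) = 0"
          if z: "z \<in> center" for z
        proof -
          have "(z ^ 2 * a) * a = a * (z ^ 2 * a)"
            using centerD[OF center_power[OF z], of 2 a, symmetric] by (simp only: mult.assoc[symmetric])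
          then have "(b + z ^ 2 * a) * f (b + z ^ 2 * a) = f (b + z ^ 2 * a) * (b + z ^ 2 * a)"
            using no by blast
          then show ?thesis by (simp only: f_add f_scale[OF z]) simp
        qed
        from zpoly_unique[OF inf zcomm zpoly_const[of 0] this, of "N + 2"] N a show False by simp
      qed
    qed
    then show ?thesis ..
  qed
  define q where "q = p ^ multiplicity p N"
  have "N \<noteq> 0" using N by simp
  then obtain r where r: "N = q * r" "\<not> p dvd r"
    using char(2) multiplicity_decompose' not_prime_unit unfolding q_def by metis
  have qN: "q \<le> N" using r N by (cases r) auto
  have Cq: "of_nat (N choose (N - q)) \<noteq> (0::'a)"
    using not_prime_dvd_prime_power_choose[OF char(2) r(2)] r(1) char(1) binomial_symmetric[OF qN]
    unfolding q_def by (metis of_nat_eq_0_iff_char_dvd)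
  \<comment> \<open>Central values give central \<open>b ^ N\<close> whenever \<open>f b\<close> is
    nonzero. This applies to all \<open>b = a + z ^ 2\<close>, because \<open>f 1 = 0\<close>; in
    the expansion of \<open>b ^ N\<close> the coefficient belonging to \<open>a ^ q\<close> is prime
    to \<open>p\<close>.\<close>
  have power_central: "a ^ q \<in> center" if fa: "f a \<noteq> 0" for a
  proof -
    have N_central: "b ^ N \<in> center" if fb: "f b \<noteq> 0" for b
    proof -
      have b0: "b \<noteq> 0" using fb inv_solution_0[OF f] by auto
      have "f b = - (b ^ n * f (inverse b) * b ^ m)"
        using inv_solution_eq[OF f b0] by simp
      also have "b ^ n * f (inverse b) * b ^ m = f (inverse b) * b ^ N"
        unfolding N_def power_add using centerD[OF central_valued[of "inverse b"], of "b ^ n"]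
        by (simp only: mult.assoc[symmetric])
      finally have e: "f (inverse b) * b ^ N = - f b" by simp
      then have "f (inverse b) \<noteq> 0" using fb by auto
      moreover have "f (inverse b) * b ^ N \<in> center" unfolding e by (rule center_minus[OF central_valued])
      ultimately show ?thesis by (rule center_mult_cancel[OF central_valued])
    qed
    have "of_nat (N choose (N - q)) * a ^ q * u = u * (of_nat (N choose (N - q)) * a ^ q)" for u
    proof -
      define e where "e = (\<lambda>j. if j \<le> N then of_nat (N choose j) * a ^ (N - j) else 0)"
      have "zpoly (\<lambda>z. (a + z) ^ N) e" unfolding e_def by (rule zpoly_binomial)
      then have ze: "zpoly (\<lambda>z. (a + z ^ 2) ^ N) (\<lambda>j. if even j then e (j div 2) else 0)"
        by (rule zpoly_square)
      have "(a + z ^ 2) ^ N * u = u * (a + z ^ 2) ^ N" if z: "z \<in> center" for z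
      proof -
        have "f (a + z ^ 2) = f a" using f_scale[OF z, of 1] by (simp add: f_add f1)
        with fa show ?thesis by (intro centerD N_central) simp
      qed
      from zpoly_unique[OF inf zpoly_rmult[OF ze] zpoly_lmult[OF ze] this, of "2 * (N - q)"] qN
      show ?thesis by (simp add: e_def)
    qed
    then have "of_nat (N choose (N - q)) * a ^ q \<in> center" by (simp add: center_def)
    then show ?thesis using Cq by (rule center_mult_cancel[OF center_of_nat, rotated])
  qed
  obtain x where x: "x \<notin> center" "f x \<noteq> 0"
  proof (cases "y \<in> center")
    case True
    from noncomm obtain b :: 'a where b: "b \<notin> center" by blast
    show thesis
    proof (cases "f b = 0")
      case 1: True
      have "y + b \<notin> center"
        using b center_add[OF center_minus[OF True], of "y + b"] by auto
      then show thesis using that[of "y + b"] 1 fy by (simp add: f_add)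
    qed (use that b in blast)
  qed (use that fy in blast)
  show False
  proof (rule inseparable_absurd[where P = "\<lambda>y. f y \<noteq> 0", OF char(2) p0 x(2,1)])
    show "y ^ (p ^ multiplicity p N) \<in> center" if "f y \<noteq> 0" for y
      using power_central[OF that] by (simp add: q_def)
    show "\<exists>c. c * x = x * c \<and> f (b + c) \<noteq> 0" for b
    proof (cases "f b = 0")
      case True
      then show ?thesis using x(2) by (intro exI[of _ x]) (simp add: f_add)
    qed (intro exI[of _ 0], simp)
  qed
qed

section \<open>Degrees of functions and transcendental elements\<close>

text \<open>\<open>dg d F\<close>: \<open>F\<close> is a polynomial function of degree less than \<open>d\<close>.\<close>

primrec dg :: "nat \<Rightarrow> ('a::division_ring \<Rightarrow> 'a) \<Rightarrow> bool" where
  "dg 0 F \<longleftrightarrow> (\<forall>x. F x = 0)"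
| "dg (Suc d) F \<longleftrightarrow> (\<forall>h. dg d (\<lambda>x. F (x + h) - F x))"

lemma dg_zero: "dg d (\<lambda>x. 0)"
  by (induction d) auto

lemma dg_map:
  assumes "\<And>x y. \<phi> (x - y) = \<phi> x - \<phi> y"
  shows "dg d F \<Longrightarrow> dg d (\<lambda>x. \<phi> (F x))"
proof (induction d arbitrary: F)
  case 0
  have "\<phi> 0 = 0" using assms[of 0 0] by simp
  with 0 show ?case by simp
next
  case (Suc d)
  then show ?case by (simp add: assms[symmetric])
qed

lemma dg_add: "dg d F \<Longrightarrow> dg d G \<Longrightarrow> dg d (\<lambda>x. F x + G x)"
proof (induction d arbitrary: F G)
  case (Suc d)
  have "dg d (\<lambda>x. (F (x + h) - F x) + (G (x + h) - G x))" for h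
    using Suc by simp
  then show ?case by (simp add: algebra_simps)
qed simp

lemma dg_uminus: "dg d F \<Longrightarrow> dg d (\<lambda>x. - F x)"
  by (rule dg_map) simp_all

lemma dg_diff: "dg d F \<Longrightarrow> dg d G \<Longrightarrow> dg d (\<lambda>x. F x - G x)"
  using dg_add[OF _ dg_uminus, of d F G] by simp

lemma dg_lmult: "dg d F \<Longrightarrow> dg d (\<lambda>x. c * F x)"
  by (rule dg_map) (simp_all add: right_diff_distrib)

lemma dg_rmult: "dg d F \<Longrightarrow> dg d (\<lambda>x. F x * c)"
  by (rule dg_map) (simp_all add: left_diff_distrib)

lemma dg_sum: "(\<And>i. i \<in> I \<Longrightarrow> dg d (F i)) \<Longrightarrow> dg d (\<lambda>x. \<Sum>i\<in>I. F i x)"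
  by (induction I rule: infinite_finite_induct) (simp_all add: dg_zero dg_add)

lemma dg_Suc: "dg d F \<Longrightarrow> dg (Suc d) F"
  by (induction d arbitrary: F) auto

lemma dg_mono:
  assumes "d \<le> e" "dg d F"
  shows "dg e F"
  using assms(1)
proof (induction e rule: dec_induct)
  case base
  show ?case by (rule assms(2))
next
  case (step e)
  then show ?case by (intro dg_Suc)
qed

lemma dg_shift: "dg d F \<Longrightarrow> dg d (\<lambda>x. F (x + a))"
proof (induction d arbitrary: F)
  case (Suc d)
  have "dg d (\<lambda>x. F (x + a + h) - F (x + a))" for h
    using Suc.IH[of "\<lambda>x. F (x + h) - F x"] Suc.prems by simp
  then show ?case by (simp add: add_ac)
qed simp

lemma dg_diff_shift: "dg (Suc d) F \<Longrightarrow> dg d (\<lambda>x. F (x + a) - F (x + b))"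
proof -
  assume "dg (Suc d) F"
  then have "dg d (\<lambda>x. F (x + (a - b)) - F x)" by simp
  from dg_shift[OF this, of b] show ?thesis by simp
qed

text \<open>Bookkeeping for families indexed by powers of \<open>t\<close>: subtracting a copy
  multiplied by \<open>t\<close> shifts its index by one.\<close>

lemma dg_shifted_coefficients:
  assumes "\<And>u. u \<le> b \<Longrightarrow> dg d (A u)" "\<And>u. u \<le> b \<Longrightarrow> dg d (B u)" "u \<le> Suc b"
  shows "dg d (\<lambda>x. (if u \<le> b then A u x else 0) - (case u of 0 \<Rightarrow> 0 | Suc v \<Rightarrow> B v x))"
proof (rule dg_diff)
  show "dg d (\<lambda>x. if u \<le> b then A u x else 0)"
    using assms(1) dg_zero by (cases "u \<le> b") simp_all
  show "dg d (\<lambda>x. case u of 0 \<Rightarrow> 0 | Suc v \<Rightarrow> B v x)"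
    using assms(2,3) dg_zero by (cases u) simp_all
qed

lemma dg_const: "dg (Suc 0) (\<lambda>x. c)"
  by simp

lemma dg_1D:
  assumes "dg (Suc 0) F"
  shows "F x = F y"
proof -
  have "\<forall>h x. F (x + h) - F x = 0" using assms unfolding dg.simps .
  then have "F (y + (x - y)) - F y = 0" by (elim allE)
  then show ?thesis by simp
qed

lemma dg_additive: "(\<And>x y. f (x + y) = f x + f y) \<Longrightarrow> dg (Suc (Suc 0)) f"
  by simp

text \<open>Discrete Leibniz rule: the difference of \<open>F * G\<close> is the difference of
  \<open>F\<close> times the shifted \<open>G\<close>, plus \<open>F\<close> times the difference of
  \<open>G\<close>. Bounds are strict, hence the form with \<open>Suc\<close>.\<close>

lemma dg_mult:
  "dg (Suc a) F \<Longrightarrow> dg (Suc b) G \<Longrightarrow> dg (Suc (a + b)) (\<lambda>x. F x * G x)"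
proof (induction "a + b" arbitrary: a b F G rule: less_induct)
  case less
  have "dg (a + b) (\<lambda>x. F (x + h) * G (x + h) - F x * G x)" for h
  proof -
    have 1: "dg (a + b) (\<lambda>x. (F (x + h) - F x) * G (x + h))"
    proof (cases a)
      case 0
      have "F (x + h) - F x = 0" for x using less.prems(1) 0 dg_1D by fastforce
      then show ?thesis by (simp add: dg_zero)
    next
      case (Suc a')
      have "dg (Suc a') (\<lambda>x. F (x + h) - F x)" using less.prems(1) Suc by (simp del: dg.simps(2) add: dg.simps(2)[of "Suc a'"])
      moreover have "dg (Suc b) (\<lambda>x. G (x + h))" by (rule dg_shift[OF less.prems(2)])
      ultimately have "dg (Suc (a' + b)) (\<lambda>x. (F (x + h) - F x) * G (x + h))"
        by (rule less.hyps[rotated]) (simp add: Suc)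
      then show ?thesis by (simp only: Suc add_Suc)
    qed
    have 2: "dg (a + b) (\<lambda>x. F x * (G (x + h) - G x))"
    proof (cases b)
      case 0
      have "G (x + h) - G x = 0" for x using less.prems(2) 0 dg_1D by fastforce
      then show ?thesis by (simp add: dg_zero)
    next
      case (Suc b')
      have "dg (Suc b') (\<lambda>x. G (x + h) - G x)" using less.prems(2) Suc by (simp del: dg.simps(2) add: dg.simps(2)[of "Suc b'"])
      with less.prems(1) have "dg (Suc (a + b')) (\<lambda>x. F x * (G (x + h) - G x))"
        by (rule less.hyps[rotated]) (simp add: Suc)
      then show ?thesis by (simp only: Suc add_Suc_right)
    qed
    from dg_add[OF 1 2] show ?thesis by (simp add: algebra_simps)
  qed
  then show ?case by simp
qed

lemma dg_power: "dg (Suc k) (\<lambda>x. x ^ k)"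
proof (induction k)
  case (Suc k)
  have "dg (Suc (Suc 0)) (\<lambda>x::'a. x)" by simp
  from dg_mult[OF this Suc] show ?case by (simp del: dg.simps)
qed (simp add: dg_const)

lemma dg_sandwich:
  assumes "dg (Suc r) w"
  shows "dg (Suc (i + j + r)) (\<lambda>x. x ^ i * w x * x ^ j)"
  using dg_mult[OF dg_mult[OF dg_power assms] dg_power] by (simp only: add_ac)

section \<open>Transcendental elements and the cancellation of a factor \<open>x\<close>\<close>

definition transcendental :: "'a::division_ring \<Rightarrow> bool"
  where "transcendental t \<longleftrightarrow>
    (\<forall>d z. range z \<subseteq> center \<longrightarrow> (\<Sum>u\<le>d. z u * t ^ u) = 0 \<longrightarrow> (\<forall>u\<le>d. z u = 0))"

lemma transcendental_sum:
  assumes t: "transcendental t" and "finite U" and z: "\<And>u. u \<in> U \<Longrightarrow> z u \<in> center"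
    and zero: "(\<Sum>u\<in>U. z u * t ^ u) = 0" and u: "u \<in> U"
  shows "z u = 0"
proof -
  define y where "y u = (if u \<in> U then z u else 0)" for u
  obtain d where d: "U \<subseteq> {..d}" using \<open>finite U\<close> unfolding finite_nat_set_iff_bounded_le by auto
  have "(\<Sum>u\<le>d. y u * t ^ u) = (\<Sum>u\<in>U. z u * t ^ u)"
    by (rule sum.mono_neutral_cong_right) (use d in \<open>auto simp: y_def\<close>)
  moreover have "range y \<subseteq> center" using z by (auto simp: y_def)
  moreover have "u \<le> d" using d u by auto
  ultimately have "y u = 0"
    using t[unfolded transcendental_def, rule_format, of y d u] zero by simp
  with u show ?thesis by (simp add: y_def)
qed

lemma transcendental_nonzero: "transcendental t \<Longrightarrow> t \<noteq> 0"
  using transcendental_sum[of t "{1}" "\<lambda>_. 1" 1] by auto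

text \<open>Treats the ring and its opposite at once, so that cancellation on the right also yields
  cancellation on the left.\<close>

locale two_sided =
  fixes mul :: "'a::division_ring \<Rightarrow> 'a \<Rightarrow> 'a"  (infixl "\<odot>" 70)
  assumes mul_cases: "mul = (*) \<or> mul = (\<lambda>a b. b * a)"
begin

lemma mul_assoc: "a \<odot> b \<odot> c = a \<odot> (b \<odot> c)"
  using mul_cases by (auto simp: mult.assoc)

lemma mul_add: "(a + b) \<odot> c = a \<odot> c + b \<odot> c" "a \<odot> (b + c) = a \<odot> b + a \<odot> c"
  using mul_cases by (auto simp: distrib_left distrib_right)

lemma mul_diff: "(a - b) \<odot> c = a \<odot> c - b \<odot> c" "a \<odot> (b - c) = a \<odot> b - a \<odot> c"
  using mul_cases by (auto simp: left_diff_distrib right_diff_distrib)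

lemma mul_0: "0 \<odot> a = 0" "a \<odot> 0 = 0"
  using mul_cases by auto

lemma mul_1: "1 \<odot> a = a" "a \<odot> 1 = a"
  using mul_cases by auto

lemma mul_inverse: "a \<noteq> 0 \<Longrightarrow> inverse a \<odot> a = 1" "a \<noteq> 0 \<Longrightarrow> a \<odot> inverse a = 1"
  using mul_cases by auto

lemma mul_power: "t \<odot> t ^ u = t ^ Suc u" "t ^ u \<odot> t = t ^ Suc u"
  using mul_cases power_commutes[of t u] by auto

lemma mul_center:
  assumes "z \<in> center"
  shows "z \<odot> a = z * a"
  using mul_cases centerD[OF assms, of a] by auto

lemma mul_sum: "(\<Sum>u\<in>U. F u) \<odot> a = (\<Sum>u\<in>U. F u \<odot> a)" "a \<odot> (\<Sum>u\<in>U. F u) = (\<Sum>u\<in>U. a \<odot> F u)"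
  using mul_cases by (auto simp: sum_distrib_left sum_distrib_right)

lemma mul_comm_center:
  assumes "\<And>y. a \<odot> y = y \<odot> a"
  shows "a \<in> center"
proof -
  have "a * y = y * a" for y using assms[of y] mul_cases by auto
  then show ?thesis unfolding center_def by blast
qed

text \<open>Shortest-relation argument. Normalize one coefficient to 1; replacing \<open>x\<close>
  by \<open>y \<odot> x\<close> and subtracting \<open>y\<close> times the relation removes that
  term, so by induction all coefficients commute with every \<open>y\<close>. Then
  \<open>x = 1\<close> gives a central polynomial relation for \<open>t\<close>.\<close>

lemma linear_independence:
  assumes t: "transcendental t" and "finite U"
    and "\<And>x. (\<Sum>u\<in>U. a u \<odot> x \<odot> t ^ u) = 0" and "u \<in> U"
  shows "a u = 0"
  using assms(2-)
proof (induction U arbitrary: a u rule: finite_induct)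
  case (insert u0 U)
  have "a u0 = 0"
  proof (rule ccontr)
    assume a0: "a u0 \<noteq> 0"
    define b where "b u = inverse (a u0) \<odot> a u" for u
    have b0: "b u0 = 1" using a0 by (simp add: b_def mul_inverse)
    have bsum: "(\<Sum>u\<in>insert u0 U. b u \<odot> x \<odot> t ^ u) = 0" for x
    proof -
      have "(\<Sum>u\<in>insert u0 U. b u \<odot> x \<odot> t ^ u) = inverse (a u0) \<odot> (\<Sum>u\<in>insert u0 U. a u \<odot> x \<odot> t ^ u)"
        by (simp only: b_def mul_sum mul_assoc)
      then show ?thesis by (simp only: insert.prems(1) mul_0)
    qed
    have "b u \<odot> y - y \<odot> b u = 0" if "u \<in> U" for u y
    proof (rule insert.IH[OF _ that])
      fix x
      have "(\<Sum>u\<in>insert u0 U. (b u \<odot> y - y \<odot> b u) \<odot> x \<odot> t ^ u)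
        = (\<Sum>u\<in>insert u0 U. b u \<odot> (y \<odot> x) \<odot> t ^ u) - y \<odot> (\<Sum>u\<in>insert u0 U. b u \<odot> x \<odot> t ^ u)"
        by (simp only: mul_diff mul_sum mul_assoc sum_subtractf)
      then have "(\<Sum>u\<in>insert u0 U. (b u \<odot> y - y \<odot> b u) \<odot> x \<odot> t ^ u) = 0"
        by (simp only: bsum mul_0) simp
      then show "(\<Sum>u\<in>U. (b u \<odot> y - y \<odot> b u) \<odot> x \<odot> t ^ u) = 0"
        using insert.hyps by (simp add: b0 mul_1 mul_0)
    qed
    then have "b u \<in> center" if "u \<in> insert u0 U" for u
      using that b0 by (auto intro: mul_comm_center)
    moreover from this have "(\<Sum>u\<in>insert u0 U. b u * t ^ u) = 0"
      using bsum[of 1] by (simp only: mul_1 mul_center cong: sum.cong)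
    ultimately have "b u0 = 0"
      using transcendental_sum[OF t, of "insert u0 U" b u0] insert.hyps by blast
    with b0 show False by simp
  qed
  moreover have "a u = 0" if "u \<in> U"
  proof (rule insert.IH[OF _ that])
    show "\<And>x. (\<Sum>u\<in>U. a u \<odot> x \<odot> t ^ u) = 0"
      using insert.prems(1) insert.hyps \<open>a u0 = 0\<close> by (simp add: mul_0)
  qed
  ultimately show ?case using insert.prems(2) by blast
qed simp

lemma dg_mul: "dg d F \<Longrightarrow> dg d (\<lambda>x. F x \<odot> c)"
  by (rule dg_map) (simp_all add: mul_diff)

lemma sum_Suc_coefficients:
  "(\<Sum>u\<le>Suc a. ((if u \<le> a then A u else 0) - (case u of 0 \<Rightarrow> 0 | Suc v \<Rightarrow> B v)) \<odot> x \<odot> t ^ u)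
    = (\<Sum>u\<le>a. A u \<odot> x \<odot> t ^ u) - (\<Sum>u\<le>a. B u \<odot> x \<odot> t ^ Suc u)"
proof -
  have "(\<Sum>u\<le>Suc a. (if u \<le> a then A u else 0) \<odot> x \<odot> t ^ u) = (\<Sum>u\<le>a. A u \<odot> x \<odot> t ^ u)"
    by (simp add: mul_0)
  moreover have "(\<Sum>u\<le>Suc a. (case u of 0 \<Rightarrow> 0 | Suc v \<Rightarrow> B v) \<odot> x \<odot> t ^ u) = (\<Sum>u\<le>a. B u \<odot> x \<odot> t ^ Suc u)"
    by (simp only: sum.atMost_Suc_shift) (simp add: mul_0)
  ultimately show ?thesis by (simp only: mul_diff sum_subtractf)
qed

text \<open>The difference in direction \<open>h \<odot> t\<close> minus the difference in direction
  \<open>h\<close> times \<open>t\<close> yields a relation of the same shape: its coefficients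
  \<open>G'\<close> are differences of the \<open>G u\<close>, with one more power of
  \<open>t\<close>, and the terms where \<open>x\<close> itself was differenced have low degree.
  Constant coefficients are settled by \<open>linear_independence\<close>.\<close>

lemma strip_family:
  assumes t: "transcendental t"
    and "\<And>u. u \<le> a \<Longrightarrow> dg (Suc e) (G u)"
    and "dg (Suc e) (\<lambda>x. \<Sum>u\<le>a. G u x \<odot> x \<odot> t ^ u)"
    and "u \<le> a"
  shows "dg e (G u)"
  using assms(2-)
proof (induction e arbitrary: a G u)
  case 0
  have G: "G u x = G u 0" if "u \<le> a" for u x using 0(1)[OF that] by (rule dg_1D)
  have "(\<Sum>u\<le>a. G u 0 \<odot> x \<odot> t ^ u) = 0" for x
  proof -
    have "(\<Sum>u\<le>a. G u 0 \<odot> x \<odot> t ^ u) = (\<Sum>u\<le>a. G u x \<odot> x \<odot> t ^ u)"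
      by (intro sum.cong refl) (simp add: G[symmetric, of _ x])
    also have "\<dots> = (\<Sum>u\<le>a. G u 0 \<odot> 0 \<odot> t ^ u)" using 0(2) by (rule dg_1D)
    finally show ?thesis by (simp add: mul_0)
  qed
  then have "G u 0 = 0"
    using linear_independence[OF t, of "{..a}" "\<lambda>u. G u 0" u] 0(3) by simp
  then show ?case using G[OF 0(3)] by simp
next
  case (Suc e)
  define F where "F x = (\<Sum>u\<le>a. G u x \<odot> x \<odot> t ^ u)" for x
  define G' where "G' h u x = (if u \<le> a then G u (x + h \<odot> t) - G u x else 0)
    - (case u of 0 \<Rightarrow> 0 | Suc v \<Rightarrow> G v (x + h) - G v x)" for h u x
  have dgF: "dg (Suc e) (\<lambda>x. F (x + h) - F x)" for h
    using Suc.prems(2) unfolding F_def[abs_def] by simp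
  have dgG: "dg (Suc e) (\<lambda>x. G v (x + h) - G v x)" if "v \<le> a" for h v
    using Suc.prems(1)[OF that] by simp
  have step: "dg e (G' h u)" if "u \<le> Suc a" for h u
  proof (rule Suc.IH[OF _ _ that])
    fix u assume u: "u \<le> Suc a"
    show "dg (Suc e) (G' h u)"
      unfolding G'_def[abs_def] by (rule dg_shifted_coefficients[OF dgG dgG u])
  next
    have Fd: "F (x + k) - F x = (\<Sum>u\<le>a. (G u (x + k) - G u x) \<odot> x \<odot> t ^ u) + (\<Sum>u\<le>a. G u (x + k) \<odot> k \<odot> t ^ u)"
      for x k
      unfolding F_def sum_subtractf[symmetric] sum.distrib[symmetric]
      by (intro sum.cong refl) (simp add: mul_add mul_diff)
    have "(\<Sum>u\<le>Suc a. G' h u x \<odot> x \<odot> t ^ u)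
      = (F (x + h \<odot> t) - F x) - (F (x + h) - F x) \<odot> t
        - (\<Sum>u\<le>a. (G u (x + h \<odot> t) - G u (x + h)) \<odot> h \<odot> t ^ Suc u)" for x
    proof -
      have "(\<Sum>u\<le>a. G u (x + h \<odot> t) \<odot> (h \<odot> t) \<odot> t ^ u) = (\<Sum>u\<le>a. G u (x + h \<odot> t) \<odot> h \<odot> t ^ Suc u)"
        by (simp only: mul_assoc mul_power)
      moreover have "(\<Sum>u\<le>a. A u \<odot> y \<odot> t ^ u) \<odot> t = (\<Sum>u\<le>a. A u \<odot> y \<odot> t ^ Suc u)" for A y
        by (simp only: mul_sum mul_assoc mul_power)
      ultimately show ?thesis
        unfolding G'_def sum_Suc_coefficients Fd
        by (simp add: mul_add mul_diff sum_subtractf del: power_Suc)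
    qed
    moreover have "dg (Suc e) (\<lambda>x. (F (x + h \<odot> t) - F x) - (F (x + h) - F x) \<odot> t
        - (\<Sum>u\<le>a. (G u (x + h \<odot> t) - G u (x + h)) \<odot> h \<odot> t ^ Suc u))"
      by (intro dg_diff dg_mul dgF dg_sum dg_diff_shift Suc.prems(1)) auto
    ultimately show "dg (Suc e) (\<lambda>x. \<Sum>u\<le>Suc a. G' h u x \<odot> x \<odot> t ^ u)"
      by (simp only:)
  qed
  have t0: "t \<noteq> 0" by (rule transcendental_nonzero[OF t])
  \<comment> \<open>Every \<open>k\<close> has the form \<open>h \<odot> t\<close>. Thus
    \<open>G' h 0\<close> gives the differences of \<open>G 0\<close>, and
    \<open>G' h (Suc v)\<close> those of \<open>G (Suc v)\<close> up to a difference of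
    \<open>G v\<close>.\<close>
  have "\<forall>k. dg e (\<lambda>x. G u (x + k) - G u x)"
    using Suc.prems(3)
  proof (induction u)
    case 0
    show ?case
    proof
      fix k
      have "dg e (G' (k \<odot> inverse t) 0)" by (rule step) simp
      then show "dg e (\<lambda>x. G 0 (x + k) - G 0 x)"
        using t0 by (simp add: G'_def[abs_def] mul_assoc mul_inverse mul_1)
    qed
  next
    case (Suc v)
    show ?case
    proof
      fix k
      define h where "h = k \<odot> inverse t"
      have "dg e (G' h (Suc v))" using Suc.prems by (intro step) simp
      moreover have "dg e (\<lambda>x. G v (x + h) - G v x)" using Suc by simp
      ultimately have "dg e (\<lambda>x. G' h (Suc v) x + (G v (x + h) - G v x))" by (rule dg_add)
      moreover have "h \<odot> t = k" using t0 by (simp add: h_def mul_assoc mul_inverse mul_1)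
      ultimately show "dg e (\<lambda>x. G (Suc v) (x + k) - G (Suc v) x)"
        using Suc.prems by (simp add: G'_def)
    qed
  qed
  then show ?case by simp
qed

text \<open>\<open>strip_family\<close> with a single coefficient lowers an a priori bound
  \<open>k\<close> by one, as long as it exceeds the bound that the product allows.\<close>

lemma strip:
  fixes t :: 'a
  assumes t: "transcendental t"
  shows "dg k G \<Longrightarrow> dg (Suc d) (\<lambda>x. G x \<odot> x) \<Longrightarrow> dg d G"
proof (induction k)
  case 0
  then show ?case by (intro dg_mono[of 0 d]) auto
next
  case (Suc k)
  show ?case
  proof (cases "Suc k \<le> d")
    case True
    then show ?thesis using Suc.prems(1) by (rule dg_mono)
  next
    case False
    then have "dg (Suc k) (\<lambda>x. G x \<odot> x)" using Suc.prems(2) by (intro dg_mono[of "Suc d" "Suc k"]) auto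
    then have "dg k G"
      using strip_family[OF t, of 0 k "\<lambda>_. G" 0] Suc.prems(1) by (simp add: mul_1 del: dg.simps)
    then show ?thesis using Suc by blast
  qed
qed

end

interpretation right: two_sided "(*)"
  by unfold_locales simp

interpretation left: two_sided "\<lambda>a b. b * a"
  by unfold_locales simp

lemma strip_right_power:
  fixes t :: "'a::division_ring" and G :: "'a \<Rightarrow> 'a"
  assumes t: "transcendental t" and "dg k G"
  shows "dg (d + j) (\<lambda>x. G x * x ^ j) \<Longrightarrow> dg d G"
proof (induction j)
  case (Suc j)
  have "dg (Suc (d + j)) (\<lambda>x. (G x * x ^ j) * x)"
    using Suc.prems by (simp add: power_commutes mult.assoc del: dg.simps)
  moreover have "dg (Suc (k + j)) (\<lambda>x. G x * x ^ j)"
    by (rule dg_mult[OF dg_Suc[OF \<open>dg k G\<close>] dg_power])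
  ultimately show ?case using right.strip[OF t] Suc.IH by blast
qed simp

lemma strip_left_power:
  fixes t :: "'a::division_ring" and G :: "'a \<Rightarrow> 'a"
  assumes t: "transcendental t" and "dg k G"
  shows "dg (d + j) (\<lambda>x. x ^ j * G x) \<Longrightarrow> dg d G"
proof (induction j)
  case (Suc j)
  have "dg (Suc (d + j)) (\<lambda>x. x * (x ^ j * G x))"
    using Suc.prems by (simp add: mult.assoc del: dg.simps)
  moreover have "dg (Suc (j + k)) (\<lambda>x. x ^ j * G x)"
    by (rule dg_mult[OF dg_power dg_Suc[OF \<open>dg k G\<close>]])
  ultimately show ?case using left.strip[OF t] Suc.IH by blast
qed simp

text \<open>The differences \<open>\<Delta>\<^sub>t\<^sub>h - t \<Delta>\<^sub>h\<close> kill one linear factor standing on the left.\<close>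

primrec dl :: "'a::division_ring \<Rightarrow> nat \<Rightarrow> ('a \<Rightarrow> 'a) \<Rightarrow> bool" where
  "dl t 0 F \<longleftrightarrow> (\<forall>x. F x = 0)"
| "dl t (Suc d) F \<longleftrightarrow> (\<forall>h. dl t d (\<lambda>x. F (x + t * h) - F x - t * (F (x + h) - F x)))"

lemma dl_map:
  assumes "\<And>x y. \<phi> (x - y) = \<phi> x - \<phi> y" "\<And>x. \<phi> (t * x) = t * \<phi> x"
  shows "dl t d F \<Longrightarrow> dl t d (\<lambda>x. \<phi> (F x))"
proof (induction d arbitrary: F)
  case 0
  have "\<phi> 0 = 0" using assms(1)[of 0 0] by simp
  with 0 show ?case by simp
next
  case (Suc d)
  then show ?case by (simp add: assms[symmetric])
qed

lemma dl_add: "dl t d F \<Longrightarrow> dl t d G \<Longrightarrow> dl t d (\<lambda>x. F x + G x)"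
proof (induction d arbitrary: F G)
  case (Suc d)
  have "dl t d (\<lambda>x. (F (x + t * h) - F x - t * (F (x + h) - F x))
      + (G (x + t * h) - G x - t * (G (x + h) - G x)))" for h
    using Suc by simp
  moreover have "F (x + t * h) - F x - t * (F (x + h) - F x) + (G (x + t * h) - G x - t * (G (x + h) - G x))
      = F (x + t * h) + G (x + t * h) - (F x + G x) - t * (F (x + h) + G (x + h) - (F x + G x))" for h x
    by (simp add: algebra_simps)
  ultimately show ?case by simp
qed simp

lemma dl_rmult: "dl t d F \<Longrightarrow> dl t d (\<lambda>x. F x * c)"
  by (rule dl_map) (simp_all add: left_diff_distrib mult.assoc)

lemma dl_diff: "dl t d F \<Longrightarrow> dl t d G \<Longrightarrow> dl t d (\<lambda>x. F x - G x)"
  using dl_add[OF _ dl_rmult[of t d G "-1"], of F] by simp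

lemma dg_imp_dl: "dg d F \<Longrightarrow> dl t d F"
proof (induction d arbitrary: F)
  case (Suc d)
  have D: "dg d (\<lambda>x. F (x + h) - F x)" for h using Suc.prems by simp
  have "dg d (\<lambda>x. (F (x + t * h) - F x) - t * (F (x + h) - F x))" for h
    by (rule dg_diff[OF D dg_lmult[OF D]])
  then show ?case using Suc.IH by simp
qed simp

lemma dg_twisted_diff:
  assumes "dg (Suc d) F"
  shows "dg d (\<lambda>x. F (x + t * h) - F x - t * (F (x + h) - F x))"
proof -
  have D: "dg d (\<lambda>x. F (x + h) - F x)" for h using assms by simp
  show ?thesis by (rule dg_diff[OF D dg_lmult[OF D]])
qed

text \<open>The twisted difference annihilates \<open>t ^ v * x * c\<close>; on variable
  \<open>F v\<close> it gives the same shape with differenced coefficients, plus terms of low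
  ordinary degree. So the factor \<open>x\<close> does not raise the bound.\<close>

lemma dl_left_linear:
  fixes F :: "nat \<Rightarrow> 'a::division_ring \<Rightarrow> 'a"
  assumes "\<And>v. v \<le> b \<Longrightarrow> dg (Suc e) (F v)"
  shows "dl t (Suc e) (\<lambda>x. \<Sum>v\<le>b. t ^ v * x * F v x)"
  using assms
proof (induction e arbitrary: b F)
  case 0
  have F: "F v x = F v 0" if "v \<le> b" for v x using 0[OF that] by (rule dg_1D)
  have "(\<Sum>v\<le>b. t ^ v * x * F v x) = (\<Sum>v\<le>b. t ^ v * x * F v 0)" for x
    by (intro sum.cong refl) (simp add: F[of _ x])
  moreover have "(\<Sum>v\<le>b. t ^ v * (x + t * h) * F v 0) - (\<Sum>v\<le>b. t ^ v * x * F v 0)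
      - t * ((\<Sum>v\<le>b. t ^ v * (x + h) * F v 0) - (\<Sum>v\<le>b. t ^ v * x * F v 0)) = 0" for x h
  proof -
    have "(\<Sum>v\<le>b. t ^ v * (t * h) * F v 0) = t * (\<Sum>v\<le>b. t ^ v * h * F v 0)"
      unfolding sum_distrib_left
      by (intro sum.cong refl) (simp only: mult.assoc[symmetric] power_commutes)
    then show ?thesis by (simp add: distrib_left distrib_right sum.distrib)
  qed
  ultimately show ?case by simp
next
  case (Suc e)
  define \<Phi> where "\<Phi> x = (\<Sum>v\<le>b. t ^ v * x * F v x)" for x
  have "dl t (Suc e) (\<lambda>x. \<Phi> (x + t * h) - \<Phi> x - t * (\<Phi> (x + h) - \<Phi> x))" for h
  proof -
    define F' where "F' u x = (if u \<le> b then F u (x + t * h) - F u x else 0)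
      - (case u of 0 \<Rightarrow> 0 | Suc v \<Rightarrow> F v (x + h) - F v x)" for u x
    have dgF: "dg (Suc e) (\<lambda>x. F v (x + k) - F v x)" if "v \<le> b" for k v
      using Suc.prems[OF that] by simp
    have "dl t (Suc e) (\<lambda>x. \<Sum>v\<le>Suc b. t ^ v * x * F' v x)"
    proof (rule Suc.IH)
      fix u assume u: "u \<le> Suc b"
      show "dg (Suc e) (F' u)"
        unfolding F'_def[abs_def] by (rule dg_shifted_coefficients[OF dgF dgF u])
    qed
    moreover have "dl t (Suc e) (\<lambda>x. \<Sum>v\<le>b. t ^ Suc v * h * (F v (x + t * h) - F v (x + h)))"
      by (intro dg_imp_dl dg_sum dg_lmult dg_diff_shift Suc.prems) auto
    ultimately have "dl t (Suc e) (\<lambda>x. (\<Sum>v\<le>Suc b. t ^ v * x * F' v x)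
        + (\<Sum>v\<le>b. t ^ Suc v * h * (F v (x + t * h) - F v (x + h))))"
      by (rule dl_add)
    moreover have "(\<Sum>v\<le>Suc b. t ^ v * x * F' v x) + (\<Sum>v\<le>b. t ^ Suc v * h * (F v (x + t * h) - F v (x + h)))
        = \<Phi> (x + t * h) - \<Phi> x - t * (\<Phi> (x + h) - \<Phi> x)" for x
    proof -
      have "(\<Sum>v\<le>Suc b. t ^ v * x * F' v x) = (\<Sum>v\<le>b. t ^ v * x * (F v (x + t * h) - F v x))
          - (\<Sum>v\<le>b. t ^ Suc v * x * (F v (x + h) - F v x))"
        using left.sum_Suc_coefficients[where a = b and A = "\<lambda>v. F v (x + t * h) - F v x"
          and B = "\<lambda>v. F v (x + h) - F v x" and x = x and t = t]
        by (simp only: F'_def mult.assoc)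
      moreover have "\<Phi> (x + k) - \<Phi> x = (\<Sum>v\<le>b. t ^ v * x * (F v (x + k) - F v x)) + (\<Sum>v\<le>b. t ^ v * k * F v (x + k))" for k
        unfolding \<Phi>_def sum_subtractf[symmetric] sum.distrib[symmetric]
        by (intro sum.cong refl) (simp add: algebra_simps)
      moreover have "(\<Sum>v\<le>b. t ^ v * (t * h) * F v (x + t * h)) = (\<Sum>v\<le>b. t ^ Suc v * h * F v (x + t * h))"
        by (intro sum.cong refl) (simp only: mult.assoc[symmetric] power_Suc2)
      ultimately show ?thesis
        by (simp add: sum_distrib_left right_diff_distrib sum_subtractf distrib_left mult.assoc)
    qed
    ultimately show ?thesis by (simp only:)
  qed
  then show ?case unfolding \<Phi>_def by simp
qed

text \<open>Parallel to \<open>strip_family\<close>. For constant coefficients the twisted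
  difference of \<open>G u * x * t ^ u\<close> is \<open>(G u * t - t * G u) * h * t ^ u\<close>:
  twisted differences see a coefficient only through its commutator with \<open>t\<close>, so only
  that commutator gets the better bound.\<close>

lemma dl_strip_family:
  fixes t :: "'a::division_ring"
  assumes t: "transcendental t"
    and "\<And>u. u \<le> a \<Longrightarrow> dg (Suc e) (G u)"
    and "dl t (Suc e) (\<lambda>x. \<Sum>u\<le>a. G u x * x * t ^ u)"
    and "u \<le> a"
  shows "dl t e (\<lambda>x. G u x * t - t * G u x)"
  using assms(2-)
proof (induction e arbitrary: a G u)
  case 0
  have G: "G u x = G u 0" if "u \<le> a" for u x using 0(1)[OF that] by (rule dg_1D)
  have "(\<Sum>u\<le>a. (G u 0 * t - t * G u 0) * h * t ^ u) = 0" for h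
  proof -
    have F: "(\<Sum>u\<le>a. G u x * x * t ^ u) = (\<Sum>u\<le>a. G u 0 * x * t ^ u)" for x
      by (intro sum.cong refl) (simp add: G[of _ x])
    have "(\<Sum>u\<le>a. G u (0 + t * h) * (0 + t * h) * t ^ u) - (\<Sum>u\<le>a. G u 0 * 0 * t ^ u)
        - t * ((\<Sum>u\<le>a. G u (0 + h) * (0 + h) * t ^ u) - (\<Sum>u\<le>a. G u 0 * 0 * t ^ u)) = 0"
      using 0(2) unfolding dl.simps by (elim allE)
    then have "(\<Sum>u\<le>a. G u 0 * (t * h) * t ^ u) - t * (\<Sum>u\<le>a. G u 0 * h * t ^ u) = 0"
      unfolding F[of "0 + t * h"] F[of "0 + h"] by simp
    then show ?thesis
      by (simp add: left_diff_distrib sum_subtractf sum_distrib_left mult.assoc)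
  qed
  then have c: "G u 0 * t - t * G u 0 = 0"
    using right.linear_independence[OF t, of "{..a}" "\<lambda>u. G u 0 * t - t * G u 0" u] 0(3) by simp
  have "G u x * t - t * G u x = 0" for x
    using c G[OF 0(3), of x] by simp
  then show ?case unfolding dl.simps by blast
next
  case (Suc e)
  define F where "F x = (\<Sum>u\<le>a. G u x * x * t ^ u)" for x
  define \<Lambda> where "\<Lambda> h H x = H (x + t * h) - H x - t * (H (x + h) - H x)" for h and H :: "'a \<Rightarrow> 'a" and x
  define K where "K h u x = G u (x + t * h) * t - t * G u (x + h)" for h u x
  define G' where "G' h u x = (if u \<le> a then \<Lambda> (h * t) (G u) x else 0)
    - (case u of 0 \<Rightarrow> 0 | Suc v \<Rightarrow> \<Lambda> h (G v) x)" for h u x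
  have dlF: "dl t (Suc e) (\<Lambda> h F)" for h
    using Suc.prems(2) unfolding F_def[abs_def] \<Lambda>_def[abs_def] by simp
  have dgG: "dg (Suc e) (\<Lambda> h (G v))" if "v \<le> a" for h v
    unfolding \<Lambda>_def[abs_def] by (rule dg_twisted_diff[OF Suc.prems(1)[OF that]])
  have step: "dl t e (\<lambda>x. G' h u x * t - t * G' h u x)" if "u \<le> Suc a" for h u
  proof (rule Suc.IH[OF _ _ that])
    fix u assume u: "u \<le> Suc a"
    show "dg (Suc e) (G' h u)"
      unfolding G'_def[abs_def] by (rule dg_shifted_coefficients[OF dgG dgG u])
  next
    have \<Lambda>F: "\<Lambda> k F x = (\<Sum>u\<le>a. \<Lambda> k (G u) x * x * t ^ u) + (\<Sum>u\<le>a. K k u x * k * t ^ u)" for k x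
      unfolding \<Lambda>_def K_def F_def sum_subtractf[symmetric] sum.distrib[symmetric] sum_distrib_left
      by (intro sum.cong refl) (simp add: algebra_simps)
    have "(\<Sum>u\<le>Suc a. G' h u x * x * t ^ u)
      = \<Lambda> (h * t) F x - \<Lambda> h F x * t - (\<Sum>u\<le>a. (K (h * t) u x - K h u x) * h * t ^ Suc u)" for x
    proof -
      have "(\<Sum>u\<le>a. K (h * t) u x * (h * t) * t ^ u) = (\<Sum>u\<le>a. K (h * t) u x * h * t ^ Suc u)"
        by (intro sum.cong refl) (simp only: mult.assoc power_Suc)
      moreover have "(\<Sum>u\<le>a. A u * y * t ^ u) * t = (\<Sum>u\<le>a. A u * y * t ^ Suc u)" for A y
        unfolding sum_distrib_right by (intro sum.cong refl) (simp only: mult.assoc power_Suc2)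
      ultimately show ?thesis
        unfolding G'_def right.sum_Suc_coefficients \<Lambda>F
        by (simp add: distrib_right left_diff_distrib sum_subtractf del: power_Suc)
    qed
    moreover have "dl t (Suc e) (\<lambda>x. \<Lambda> (h * t) F x - \<Lambda> h F x * t
        - (\<Sum>u\<le>a. (K (h * t) u x - K h u x) * h * t ^ Suc u))"
    proof (intro dl_diff dl_rmult dlF dg_imp_dl dg_sum dg_rmult)
      fix u assume "u \<in> {..a}"
      then have G: "dg (Suc (Suc e)) (G u)" using Suc.prems(1) by simp
      have "dg (Suc e) (\<lambda>x. (G u (x + t * (h * t)) - G u (x + t * h)) * t
          - t * (G u (x + h * t) - G u (x + h)))"
        by (rule dg_diff[OF dg_rmult[OF dg_diff_shift[OF G]] dg_lmult[OF dg_diff_shift[OF G]]])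
      moreover have "(G u (x + t * (h * t)) - G u (x + t * h)) * t - t * (G u (x + h * t) - G u (x + h))
          = K (h * t) u x - K h u x" for x
        by (simp add: K_def algebra_simps)
      ultimately show "dg (Suc e) (\<lambda>x. K (h * t) u x - K h u x)" by (simp only:)
    qed
    ultimately show "dl t (Suc e) (\<lambda>x. \<Sum>u\<le>Suc a. G' h u x * x * t ^ u)"
      by (simp only:)
  qed
  define C where "C u x = G u x * t - t * G u x" for u x
  have \<Lambda>C: "\<Lambda> k (C u) x = \<Lambda> k (G u) x * t - t * \<Lambda> k (G u) x" for k u x
    unfolding \<Lambda>_def C_def by (simp add: algebra_simps)
  have t0: "t \<noteq> 0" by (rule transcendental_nonzero[OF t])
  have "\<forall>k. dl t e (\<Lambda> k (C u))"
    using Suc.prems(3)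
  proof (induction u)
    case 0
    show ?case
    proof
      fix k
      have "dl t e (\<lambda>x. G' (k * inverse t) 0 x * t - t * G' (k * inverse t) 0 x)"
        by (rule step) simp
      then show "dl t e (\<Lambda> k (C 0))"
        using t0 by (simp add: G'_def \<Lambda>C[abs_def] mult.assoc)
    qed
  next
    case (Suc v)
    show ?case
    proof
      fix k
      define h where "h = k * inverse t"
      have ht: "h * t = k" using t0 by (simp add: h_def mult.assoc)
      have "dl t e (\<lambda>x. G' h (Suc v) x * t - t * G' h (Suc v) x)" using Suc.prems by (intro step) simp
      moreover have "dl t e (\<Lambda> h (C v))" using Suc by simp
      ultimately have "dl t e (\<lambda>x. (G' h (Suc v) x * t - t * G' h (Suc v) x) + \<Lambda> h (C v) x)" by (rule dl_add)
      moreover have "(G' h (Suc v) x * t - t * G' h (Suc v) x) + \<Lambda> h (C v) x = \<Lambda> k (C (Suc v)) x" for x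
        using Suc.prems by (simp add: G'_def \<Lambda>C ht algebra_simps)
      ultimately show "dl t e (\<Lambda> k (C (Suc v)))" by simp
    qed
  qed
  then show ?case unfolding \<Lambda>_def[abs_def] C_def by simp
qed

text \<open>For twisted differences one factor \<open>x\<close> on the far left is free, so the
  \<open>\<beta>\<close> term already satisfies the bound, and hence so does the
  \<open>\<alpha>\<close> term. Its power of \<open>x\<close> is then removed one factor at a
  time.\<close>

lemma two_sided_degree_drop:
  fixes t :: "'a::division_ring"
  assumes t: "transcendental t" and w: "dg (Suc r) w" and s: "s > 0"
    and \<alpha>: "\<alpha> \<in> center" "\<alpha> \<noteq> 0"
    and W: "dg (s + r) (\<lambda>x. \<alpha> * (w x * x ^ s) + \<beta> * (x ^ s * w x))" and \<beta>: "\<beta> \<in> center"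
  shows "dl t r (\<lambda>x. w x * t - t * w x)"
proof -
  obtain s' where s': "s = Suc s'" using s by (cases s) auto
  have "dg (Suc (s' + r)) (\<lambda>x. \<beta> * (x ^ s' * w x))"
    by (intro dg_lmult dg_mult[OF dg_power w])
  then have "dl t (Suc (s' + r)) (\<lambda>x. x * (\<beta> * (x ^ s' * w x)))"
    using dl_left_linear[of 0 "s' + r" "\<lambda>_ x. \<beta> * (x ^ s' * w x)" t] by (simp del: dl.simps dg.simps)
  moreover have "x * (\<beta> * (x ^ s' * w x)) = \<beta> * (x ^ s * w x)" for x
    using centerD[OF \<beta>, of x] by (simp add: s' mult.assoc[symmetric])
  ultimately have "dl t (s + r) (\<lambda>x. \<beta> * (x ^ s * w x))" by (simp only: s' add_Suc)
  from dl_diff[OF dg_imp_dl[OF W] this]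
  have "dl t (s + r) (\<lambda>x. \<alpha> * (w x * x ^ s))" by simp
  then have "dl t (s + r) (\<lambda>x. inverse \<alpha> * (\<alpha> * (w x * x ^ s)))"
  proof (rule dl_map[rotated 2])
    show "inverse \<alpha> * (t * x) = t * (inverse \<alpha> * x)" for x
      using centerD[OF center_inverse[OF \<alpha>(1)], of t] by (simp only: mult.assoc[symmetric])
  qed (simp add: right_diff_distrib)
  moreover have "inverse \<alpha> * (\<alpha> * (w x * x ^ s)) = w x * x ^ s' * x" for x
    by (simp only: mult.assoc[symmetric] left_inverse[OF \<alpha>(2)] mult_1_left s' power_Suc2)
  ultimately have top: "dl t (Suc (s' + r)) (\<lambda>x. w x * x ^ s' * x)"
    by (simp only: s' add_Suc)
  have dgw: "dg (Suc (j + r)) (\<lambda>x. w x * x ^ j)" for j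
    using dg_mult[OF w dg_power] by (simp only: add.commute)
  have "dl t (s' + r) (\<lambda>x. w x * x ^ s' * t - t * (w x * x ^ s'))"
    using dl_strip_family[OF t, of 0 "s' + r" "\<lambda>_ x. w x * x ^ s'" 0] dgw top by (simp del: dl.simps dg.simps)
  moreover have "dl t (j + r) (\<lambda>x. w x * x ^ j * t - t * (w x * x ^ j)) \<Longrightarrow> ?thesis" for j
  proof (induction j)
    case (Suc j)
    \<comment> \<open>The commutator of \<open>w x * x ^ Suc j\<close> with \<open>t\<close> is a
      family in \<open>t ^ 0\<close> and \<open>t ^ 1\<close>; stripping the coefficient of
      \<open>t ^ 1\<close> yields the commutator for \<open>j\<close>.\<close>
    define G where "G u x = (if u = 0 then - (t * (w x * x ^ j)) else w x * x ^ j)" for u :: nat and x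
    have dgG: "dg (Suc (j + r)) (G u)" for u
      unfolding G_def[abs_def] using dgw[of j] dg_uminus[OF dg_lmult[OF dgw[of j]]]
      by (cases "u = 0") (simp_all del: dg.simps)
    have "(\<Sum>u\<le>1. G u x * x * t ^ u) = w x * x ^ Suc j * t - t * (w x * x ^ Suc j)" for x
      by (simp add: G_def power_Suc2 mult.assoc del: power_Suc)
    then have "dl t (Suc (j + r)) (\<lambda>x. \<Sum>u\<le>1. G u x * x * t ^ u)"
      using Suc.prems by (simp only: add_Suc)
    from dl_strip_family[OF t dgG this, of 1]
    have "dl t (j + r) (\<lambda>x. w x * x ^ j * t - t * (w x * x ^ j))"
      by (simp add: G_def del: dl.simps)
    then show ?case by (rule Suc.IH)
  qed simp
  ultimately show ?thesis by blast
qed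

text \<open>Both \<open>n choose n\<close> and \<open>m choose m\<close> are 1, so the least index
  lies below both exponents. It marks the first correction to the leading term of the
  sandwich.\<close>

lemma least_binomial_index:
  assumes "n > 0" "m > 0"
  shows "\<exists>s>0. s \<le> n \<and> s \<le> m \<and>
    (of_nat (n choose s) \<noteq> (0::'a::division_ring) \<or> of_nat (m choose s) \<noteq> (0::'a)) \<and>
    (\<forall>a. 0 < a \<and> a < s \<longrightarrow> of_nat (n choose a) = (0::'a) \<and> of_nat (m choose a) = (0::'a))"
proof -
  define P where "P a \<longleftrightarrow> a > 0 \<and> (of_nat (n choose a) \<noteq> (0::'a) \<or> of_nat (m choose a) \<noteq> (0::'a))" for a
  define s where "s = (LEAST a. P a)"
  have Pn: "P n" "P m" using assms by (simp_all add: P_def)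
  then have "P s" unfolding s_def by (intro LeastI)
  moreover have "s \<le> n" "s \<le> m" unfolding s_def using Pn by (auto intro: Least_le)
  moreover have "\<not> P a" if "a < s" for a using that not_less_Least unfolding s_def by blast
  ultimately show ?thesis unfolding P_def by blast
qed

text \<open>Index the expansion by the losses \<open>a\<close>, \<open>b\<close> in the two powers
  of \<open>x\<close>. By minimality of \<open>s\<close>, apart from the leading term,
  \<open>(s, 0)\<close> and \<open>(0, s)\<close>, each surviving term loses more than
  \<open>s\<close> and has low degree. The two remaining terms share \<open>x ^ (n - s)\<close> and
  \<open>x ^ (m - s)\<close>, which are cancelled.\<close>

lemma sandwich_top_part:
  fixes t :: "'a::division_ring" and w :: "'a \<Rightarrow> 'a"
  assumes t: "transcendental t" and w: "dg (Suc r) w" and s: "s > 0" "s \<le> n" "s \<le> m"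
    and zero: "\<And>a. 0 < a \<Longrightarrow> a < s \<Longrightarrow> of_nat (n choose a) = (0::'a) \<and> of_nat (m choose a) = (0::'a)"
    and E: "dg (n + m - s + r) (\<lambda>x. (1 + x) ^ n * w x * (1 + x) ^ m - x ^ n * w x * x ^ m)"
  shows "dg (s + r) (\<lambda>x. of_nat (n choose s) * (w x * x ^ s) + of_nat (m choose s) * (x ^ s * w x))"
proof -
  define V where "V x = of_nat (n choose s) * (w x * x ^ s) + of_nat (m choose s) * (x ^ s * w x)" for x
  define T where "T x = (\<lambda>(a, b). of_nat ((n choose a) * (m choose b)) * (x ^ (n - a) * w x * x ^ (m - b)))" for x
  define R where "R = {..n} \<times> {..m} - {(0, 0), (s, 0), (0, s)}"
  have nat: "x ^ k * (of_nat c * y) = of_nat c * (x ^ k * y)" for x y :: 'a and c k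
    using mult_of_nat_commute[of c "x ^ k"] by (simp only: mult.assoc[symmetric])
  have expand: "(1 + x) ^ n * w x * (1 + x) ^ m = (\<Sum>p\<in>{..n} \<times> {..m}. T x p)" for x
    using sandwich_binomial[of 1 x n "w x" m] by (simp add: T_def)
  have split: "(\<Sum>p\<in>{..n} \<times> {..m}. T x p) = T x (0, 0) + T x (s, 0) + T x (0, s) + (\<Sum>p\<in>R. T x p)" for x
  proof -
    have "{..n} \<times> {..m} = {(0, 0), (s, 0), (0, s)} \<union> R" using s by (auto simp: R_def)
    then have "(\<Sum>p\<in>{..n} \<times> {..m}. T x p) = (\<Sum>p\<in>{(0, 0), (s, 0), (0, s)}. T x p) + (\<Sum>p\<in>R. T x p)"
      by (metis (no_types, lifting) R_def Diff_disjoint finite.emptyI finite_Diff finite_SigmaI finite_atMost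
          finite.insertI sum.union_disjoint)
    then show ?thesis using s by (simp add: add_ac)
  qed
  have low: "T x (s, 0) + T x (0, s) = x ^ (n - s) * V x * x ^ (m - s)" for x
  proof -
    have "x ^ m = x ^ s * x ^ (m - s)" "x ^ n = x ^ (n - s) * x ^ s"
      using s by (simp_all add: power_add[symmetric])
    then have "T x (s, 0) = of_nat (n choose s) * (x ^ (n - s) * (w x * (x ^ s * x ^ (m - s))))"
      "T x (0, s) = of_nat (m choose s) * (x ^ (n - s) * (x ^ s * (w x * x ^ (m - s))))"
      by (simp_all only: T_def) (simp_all add: mult.assoc)
    then show ?thesis by (simp add: V_def distrib_left distrib_right mult.assoc nat)
  qed
  have T0: "T x (0, 0) = x ^ n * w x * x ^ m" for x by (simp add: T_def)
  have "x ^ (n - s) * V x * x ^ (m - s)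
      = ((1 + x) ^ n * w x * (1 + x) ^ m - x ^ n * w x * x ^ m) - (\<Sum>p\<in>R. T x p)" for x
    by (simp only: expand split T0 low[symmetric]) simp
  moreover have "dg (n + m - s + r) (\<lambda>x. \<Sum>p\<in>R. T x p)"
  proof (rule dg_sum)
    fix p assume p: "p \<in> R"
    obtain a b where ab1: "p = (a, b)" by (cases p)
    have ab: "p = (a, b)" "a \<le> n" "b \<le> m" "(a, b) \<noteq> (0, 0)" "(a, b) \<noteq> (s, 0)" "(a, b) \<noteq> (0, s)"
      using p unfolding ab1 R_def by simp_all
    show "dg (n + m - s + r) (\<lambda>x. T x p)"
    proof (cases "of_nat (n choose a) = (0::'a) \<or> of_nat (m choose b) = (0::'a)")
      case True
      then have "T x p = 0" for x by (auto simp: T_def ab(1))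
      then show ?thesis by (simp add: dg_zero del: dg.simps)
    next
      case False
      then have "a = 0 \<or> s \<le> a" "b = 0 \<or> s \<le> b" using zero[of a] zero[of b] by (meson neq0_conv not_le)+
      with ab s have "a + b > s" by auto
      then have "Suc (n - a + (m - b) + r) \<le> n + m - s + r" using ab s by linarith
      moreover have "dg (Suc (n - a + (m - b) + r)) (\<lambda>x. T x p)"
        unfolding T_def ab(1) prod.case by (intro dg_lmult dg_sandwich w)
      ultimately show ?thesis by (rule dg_mono)
    qed
  qed
  ultimately have "dg (n + m - s + r) (\<lambda>x. x ^ (n - s) * V x * x ^ (m - s))"
    using dg_diff[OF E] by (simp only:)
  moreover have "n + m - s + r = (s + r) + (n - s) + (m - s)" using s by simp
  ultimately have 1: "dg ((s + r) + (n - s) + (m - s)) (\<lambda>x. x ^ (n - s) * V x * x ^ (m - s))"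
    by (simp only:)
  have dgV: "dg (Suc (s + r)) V"
    unfolding V_def[abs_def]
    using dg_mult[OF w dg_power[of s]] dg_mult[OF dg_power[of s] w]
    by (intro dg_add dg_lmult) (simp_all only: add.commute)
  have "dg ((s + r) + (n - s)) (\<lambda>x. x ^ (n - s) * V x)"
    by (rule strip_right_power[OF t dg_mult[OF dg_power dgV] 1])
  then show ?thesis using strip_left_power[OF t dgV] unfolding V_def by blast
qed

text \<open>Used with constant \<open>w\<close> (\<open>r = 0\<close>) and with additive
  \<open>w\<close> (\<open>r = 1\<close>). If \<open>n choose s\<close> vanishes, only
  \<open>x ^ s * w x\<close> is left in the top part, and cancelling \<open>x ^ s\<close> bounds
  \<open>w\<close> itself.\<close>

lemma sandwich_commutator_degree:
  fixes t :: "'a::division_ring" and w :: "'a \<Rightarrow> 'a"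
  assumes t: "transcendental t" and w: "dg (Suc r) w" and nm: "n > 0" "m > 0"
    and E: "\<And>s. s \<le> n \<Longrightarrow> s \<le> m \<Longrightarrow>
      dg (n + m - s + r) (\<lambda>x. (1 + x) ^ n * w x * (1 + x) ^ m - x ^ n * w x * x ^ m)"
  shows "dl t r (\<lambda>x. w x * t - t * w x)"
proof -
  obtain s where s: "s > 0" "s \<le> n" "s \<le> m"
    and nz: "of_nat (n choose s) \<noteq> (0::'a) \<or> of_nat (m choose s) \<noteq> (0::'a)"
    and zero: "\<And>a. 0 < a \<Longrightarrow> a < s \<Longrightarrow> of_nat (n choose a) = (0::'a) \<and> of_nat (m choose a) = (0::'a)"
    using least_binomial_index[OF nm, where 'a = 'a] by blast
  have V: "dg (s + r) (\<lambda>x. of_nat (n choose s) * (w x * x ^ s) + of_nat (m choose s) * (x ^ s * w x))"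
    by (rule sandwich_top_part[OF t w s zero E[OF s(2,3)]])
  show ?thesis
  proof (cases "of_nat (n choose s) = (0::'a)")
    case False
    show ?thesis
      by (rule two_sided_degree_drop[OF t w s(1) _ False V]) simp_all
  next
    case True
    define b where "b = (of_nat (m choose s) :: 'a)"
    have b: "b \<noteq> 0" using nz True by (simp add: b_def)
    have "b * (x ^ s * w x) = x ^ s * (b * w x)" for x
      using mult_of_nat_commute[of "m choose s" "x ^ s"] unfolding b_def by (simp only: mult.assoc[symmetric])
    then have "dg (r + s) (\<lambda>x. x ^ s * (b * w x))"
      using V True unfolding b_def[symmetric] by (simp add: add.commute del: dg.simps)
    then have "dg r (\<lambda>x. b * w x)" by (rule strip_left_power[OF t dg_lmult[OF w]])
    then have "dg r (\<lambda>x. inverse b * (b * w x))" by (rule dg_lmult)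
    then have "dg r w" using b by (simp add: mult.assoc[symmetric] del: dg.simps)
    then show ?thesis by (intro dg_imp_dl dg_diff dg_lmult dg_rmult)
  qed
qed

text \<open>With \<open>s\<close> the least index of a nonzero coefficient, the leading term of the
  difference has degree \<open>N - s\<close>, at least 2 since \<open>s \<le> d\<close>. Cancelling
  \<open>x ^ (N - s)\<close> leaves a constant forced to be zero.\<close>

lemma power_sum_not_additive:
  fixes t c :: "'a::division_ring"
  assumes t: "transcendental t" and c: "c \<in> center"
    and d: "0 < d" "d + 2 \<le> N" "of_nat (N choose d) \<noteq> (0::'a)"
    and E: "dg (Suc (Suc 0)) (\<lambda>x. (1 + x) ^ N * c - x ^ N * c)"
  shows "c = 0"
proof -
  define P where "P a \<longleftrightarrow> a > 0 \<and> of_nat (N choose a) \<noteq> (0::'a)" for a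
  define s where "s = (LEAST a. P a)"
  have "P d" using d by (simp add: P_def)
  then have s: "P s" "s \<le> d" unfolding s_def by (auto intro: LeastI Least_le)
  have least: "\<not> P a" if "a < s" for a using that not_less_Least unfolding s_def by blast
  have s0: "s > 0" "of_nat (N choose s) \<noteq> (0::'a)" using s by (simp_all add: P_def)
  define T where "T x a = of_nat (N choose a) * x ^ (N - a) * c" for x a
  have "of_nat (N choose s) * c * x ^ (N - s) = ((1 + x) ^ N * c - x ^ N * c) - (\<Sum>a\<in>{..N} - {0, s}. T x a)" for x
  proof -
    have "(1 + x) ^ N * c = (\<Sum>a\<le>N. T x a)"
      using binomial_commuting[of 1 x N] by (simp add: T_def sum_distrib_right)
    also have "\<dots> = T x 0 + T x s + (\<Sum>a\<in>{..N} - {0, s}. T x a)"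
      using s0 s(2) d(2) by (subst sum.subset_diff[of "{0, s}"]) (auto simp: add_ac)
    finally have "(1 + x) ^ N * c = x ^ N * c + T x s + (\<Sum>a\<in>{..N} - {0, s}. T x a)"
      by (simp add: T_def)
    moreover have "of_nat (N choose s) * c * x ^ (N - s) = T x s"
      using centerD[OF c, of "x ^ (N - s)"] by (simp add: T_def mult.assoc)
    ultimately show ?thesis by (simp add: algebra_simps)
  qed
  moreover have "dg (N - s) (\<lambda>x. \<Sum>a\<in>{..N} - {0, s}. T x a)"
  proof (rule dg_sum)
    fix a assume a: "a \<in> {..N} - {0, s}"
    show "dg (N - s) (\<lambda>x. T x a)"
    proof (cases "of_nat (N choose a) = (0::'a)")
      case True
      then show ?thesis by (simp add: T_def dg_zero del: dg.simps)
    next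
      case False
      then have "P a" using a by (auto simp: P_def)
      then have "\<not> a < s" using least by blast
      then have "s < a" using a by auto
      then have "Suc (N - a) \<le> N - s" using a by auto
      moreover have "dg (Suc (N - a)) (\<lambda>x. T x a)"
        unfolding T_def by (intro dg_rmult dg_lmult dg_power)
      ultimately show ?thesis by (rule dg_mono)
    qed
  qed
  moreover have "dg (N - s) (\<lambda>x. (1 + x) ^ N * c - x ^ N * c)"
    using s(2) d(2) E by (intro dg_mono[of "Suc (Suc 0)" "N - s"]) auto
  ultimately have "dg (0 + (N - s)) (\<lambda>x. of_nat (N choose s) * c * x ^ (N - s))"
    using dg_diff by (simp only: add_0)
  then have "dg 0 (\<lambda>x::'a. of_nat (N choose s) * c)"
    by (rule strip_right_power[OF t dg_const])
  with s0 show ?thesis by simp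
qed

lemma plus_solution_zero_transcendental:
  fixes f :: "'a::division_ring \<Rightarrow> 'a"
  assumes char: "CHAR('a) = p" "prime p" "p \<noteq> 2" and two: "(2::'a) \<noteq> 0"
    and ex: "transcendental (t :: 'a)"
    and near: "\<And>x :: 'a. \<not> transcendental x \<Longrightarrow>
      \<exists>t. t * x = x * t \<and> transcendental t \<and> transcendental (t + x) \<and> transcendental (2 * t + x)"
    and nm: "n > 0" "m > 0" "even (n + m)" "n + m > 2"
    and f: "inv_solution 1 n m f"
  shows "f r = 0"
proof -
  note A = plus_solution_additive[OF f nm(1-3)]
  define c where "c = f 1"
  have "dg (Suc (Suc 0)) (\<lambda>x. 2 * f x + c)"
    by (intro dg_add dg_lmult dg_additive inv_solution_add[OF f] dg_Suc[OF dg_const])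
  moreover have "2 * f x + c = (1 + x) ^ n * c * (1 + x) ^ m - x ^ n * c * x ^ m" for x
    unfolding A c_def by simp
  ultimately have E: "dg (Suc (Suc 0)) (\<lambda>x. (1 + x) ^ n * c * (1 + x) ^ m - x ^ n * c * x ^ m)"
    by (simp only:)
  have comm: "c * t = t * c" if t: "transcendental t" for t
  proof -
    have "dl t 0 (\<lambda>x. c * t - t * c)"
    proof (rule sandwich_commutator_degree[OF t dg_const nm(1,2)])
      fix s assume "s \<le> n" "s \<le> m"
      \<comment> \<open>As \<open>s\<close> is at most the smaller exponent,
        \<open>n + m - s\<close> is at least the larger one, which is at least 2.\<close>
      then have "Suc (Suc 0) \<le> n + m - s + 0" using nm by auto
      then show "dg (n + m - s + 0) (\<lambda>x. (1 + x) ^ n * c * (1 + x) ^ m - x ^ n * c * x ^ m)"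
        using E by (rule dg_mono)
    qed
    then show ?thesis by simp
  qed
  have "c * x = x * c" for x
  proof (cases "transcendental x")
    case False
    then obtain t where "transcendental t" "transcendental (t + x)" using near by blast
    then have "c * t = t * c" "c * (t + x) = (t + x) * c" by (auto intro: comm)
    then show ?thesis by (simp add: distrib_left distrib_right)
  qed (rule comm)
  then have c: "c \<in> center" unfolding center_def by blast
  obtain d where d: "2 \<le> d" "d < n + m" "\<not> p dvd (n + m choose d)"
    using exists_binomial_nonzero[OF char(2,3) nm(3,4)] by blast
  have "c = 0"
  \<comment> \<open>The bound \<open>2 \<le> d\<close> becomes the required distance from
    \<open>n + m\<close> after passing to the complementary index.\<close>
  proof (rule power_sum_not_additive[OF ex c, of "n + m - d" "n + m"])
    have "(n + m choose (n + m - d)) = (n + m choose d)"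
      using d by (simp add: binomial_symmetric[of d "n + m"])
    then show "of_nat (n + m choose (n + m - d)) \<noteq> (0::'a)"
      using d(3) char(1) by (simp add: of_nat_eq_0_iff_char_dvd)
    have "y ^ n * c * y ^ m = y ^ (n + m) * c" for y
      using centerD[OF c, of "y ^ m"] by (simp add: mult.assoc power_add)
    then show "dg (Suc (Suc 0)) (\<lambda>x. (1 + x) ^ (n + m) * c - x ^ (n + m) * c)"
      using E by (simp only:)
  qed (use d in auto)
  then have "2 * f r = 0" unfolding A c_def[symmetric] by simp
  with two show ?thesis by simp
qed

text \<open>\<open>(x, y) \<mapsto> [f x, y]\<close> is a derivation in each argument, hence a central multiple of \<open>[x, y]\<close>.\<close>

lemma commuting_additive_map:
  fixes f :: "'a::division_ring \<Rightarrow> 'a"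
  assumes noncomm: "(center :: 'a set) \<noteq> UNIV"
    and add: "\<And>x y. f (x + y) = f x + f y" and comm: "\<And>x. x * f x = f x * x"
  obtains l where "l \<in> center" "\<And>x. f x - l * x \<in> center"
proof -
  define B where "B x y = f x * y - y * f x" for x y
  have B': "B x y = x * f y - f y * x" for x y
  proof -
    have "(x + y) * f (x + y) = f (x + y) * (x + y)" by (rule comm)
    then have "x * f y + y * f x = f x * y + f y * x"
      by (simp add: add distrib_left distrib_right comm add_ac)
    then show ?thesis by (simp add: B_def algebra_simps)
  qed
  have B1: "B (x * z) y = B x y * z + x * B z y" for x y z
    by (simp add: B' algebra_simps)
  have B2: "B x (y * z) = B x y * z + y * B x z" for x y z
    by (simp add: B_def algebra_simps)
  \<comment> \<open>Expand \<open>B (x * z) (y * u)\<close> by the two derivation rules in both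
    orders and compare.\<close>
  have key: "B x y * (z * u - u * z) = (x * y - y * x) * B z u" for x y z u
  proof -
    have "B (x * z) (y * u) = B x y * u * z + y * B x u * z + x * (B z y * u + y * B z u)"
      unfolding B1[of x z "y * u"] unfolding B2 by (simp add: distrib_right)
    moreover have "B (x * z) (y * u) = (B x y * z + x * B z y) * u + y * (B x u * z + x * B z u)"
      unfolding B2[of "x * z" y u] unfolding B1 by (rule refl)
    ultimately show ?thesis by (simp add: algebra_simps)
  qed
  have key': "B x y * v * (z * u - u * z) = (x * y - y * x) * v * B z u" for x y z u v
  proof -
    have "B x y * ((v * z) * u - u * (v * z)) = (x * y - y * x) * B (v * z) u" by (rule key)
    moreover have "(v * z) * u - u * (v * z) = v * (z * u - u * z) + (v * u - u * v) * z"
      by (simp add: algebra_simps)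
    ultimately have "B x y * v * (z * u - u * z) + B x y * (v * u - u * v) * z
        = (x * y - y * x) * B v u * z + (x * y - y * x) * v * B z u"
      by (simp add: B1 distrib_left mult.assoc)
    then show ?thesis by (simp add: key)
  qed
  from noncomm obtain z :: 'a where "z \<notin> center" by blast
  then obtain u where zu: "z * u \<noteq> u * z" by (auto simp: center_def)
  define k where "k = z * u - u * z"
  have k: "k \<noteq> 0" using zu by (simp add: k_def)
  define l where "l = B z u * inverse k"
  have lk: "B z u = l * k" using k by (simp add: l_def mult.assoc)
  have "l * v = v * l" for v
  proof -
    have "B z u * (inverse k * v) * k = k * (inverse k * v) * B z u"
      using key'[of z u "inverse k * v" z u] by (simp only: k_def[symmetric])
    then have "l * v * k = v * l * k"
      using k by (simp add: l_def lk[symmetric] mult.assoc) (simp add: mult.assoc[symmetric])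
    with k show ?thesis by simp
  qed
  then have l: "l \<in> center" unfolding center_def by blast
  have "B x y = l * (x * y - y * x)" for x y
  proof -
    have "B x y * k = (x * y - y * x) * (l * k)"
      using key[of x y z u] by (simp only: k_def[symmetric] lk)
    then have "B x y * k = (x * y - y * x) * l * k" by (simp only: mult.assoc)
    with k have "B x y = (x * y - y * x) * l" by simp
    then show ?thesis using centerD[OF l, of "x * y - y * x"] by simp
  qed
  then have "(f x - l * x) * y = y * (f x - l * x)" for x y
  proof -
    assume *: "\<And>x y. B x y = l * (x * y - y * x)"
    have "f x * y - y * f x = l * (x * y) - l * (y * x)"
      using *[of x y] by (simp add: B_def right_diff_distrib)
    moreover have "y * (l * x) = l * (y * x)"
      using centerD[OF l, of y] by (simp only: mult.assoc[symmetric])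
    ultimately show ?thesis by (simp add: left_diff_distrib right_diff_distrib mult.assoc algebra_simps)
  qed
  then have "f x - l * x \<in> center" for x unfolding center_def by blast
  with l show thesis by (rule that)
qed

lemma minus_solution_zero_transcendental:
  fixes f :: "'a::division_ring \<Rightarrow> 'a"
  assumes noncomm: "(center :: 'a set) \<noteq> UNIV" and two: "(2::'a) \<noteq> 0"
    and near: "\<And>x :: 'a. \<not> transcendental x \<Longrightarrow>
      \<exists>t. t * x = x * t \<and> transcendental t \<and> transcendental (t + x) \<and> transcendental (2 * t + x)"
    and nm: "n > 0" "m > 0" "even (n + m)" "n + m > 2"
    and f: "inv_solution (-1) n m f"
  shows "f r = 0"
proof -
  have f1: "f 1 = 0" by (rule minus_solution_1[OF f two])
  have f_add: "f (x + y) = f x + f y" for x y by (rule inv_solution_add[OF f])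
  have f0: "f 0 = 0" by (rule inv_solution_0[OF f])
  have dgf: "dg (Suc (Suc 0)) f" by (rule dg_additive[OF f_add])
  have comm_t: "t * f t = f t * t" if t: "transcendental t" for t
  proof -
    have "dl t (Suc 0) (\<lambda>x. f x * t - t * f x)"
    proof (rule sandwich_commutator_degree[OF t dgf nm(1,2)])
      fix s assume s: "s \<le> n" "s \<le> m"
      have id: "dg (Suc (Suc 0)) (\<lambda>x::'a. x)" by (rule dg_additive) simp
      have "dg (Suc (Suc 0 + Suc 0)) (\<lambda>x::'a. x * x)" by (rule dg_mult[OF id id])
      then have "dg (Suc (Suc 0 + Suc 0)) (\<lambda>x. f (x * x))"
        by (rule dg_map[rotated]) (rule inv_solution_diff[OF f])
      moreover have "dg (Suc (Suc 0 + Suc 0)) f" using dgf by (rule dg_mono[rotated]) simp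
      ultimately have "dg (Suc (Suc 0 + Suc 0)) (\<lambda>x. f x + f (x * x))" by (rule dg_add[rotated])
      moreover have "f x + f (x * x) = (1 + x) ^ n * f x * (1 + x) ^ m - x ^ n * f x * x ^ m" for x
        using inv_solution_square[OF f _ nm(1-3), of x] f1 by simp
      ultimately have "dg (Suc (Suc 0 + Suc 0)) (\<lambda>x. (1 + x) ^ n * f x * (1 + x) ^ m - x ^ n * f x * x ^ m)"
        by (simp only:)
      moreover have "Suc (Suc 0 + Suc 0) \<le> n + m - s + Suc 0" using s nm by auto
      ultimately show "dg (n + m - s + Suc 0) (\<lambda>x. (1 + x) ^ n * f x * (1 + x) ^ m - x ^ n * f x * x ^ m)"
        by (rule dg_mono[rotated])
    qed
    \<comment> \<open>The twisted difference at 0 in direction 1; as \<open>f 0 = f 1 = 0\<close>,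
      only the commutator of \<open>f t\<close> and \<open>t\<close> remains.\<close>
    then have "(f (0 + t * 1) * t - t * f (0 + t * 1)) - (f 0 * t - t * f 0)
        - t * ((f (0 + 1) * t - t * f (0 + 1)) - (f 0 * t - t * f 0)) = 0"
      unfolding dl.simps by (elim allE)
    then show ?thesis by (simp add: f0 f1)
  qed
  have comm: "x * f x = f x * x" for x
  proof (cases "transcendental x")
    case False
    then obtain t where t: "transcendental t" "transcendental (t + x)" "transcendental (2 * t + x)"
      using near by blast
    \<comment> \<open>Commutation at \<open>t + x\<close> and \<open>2 * t + x\<close> reads
      \<open>D + Q = 0\<close> and \<open>2 * D + Q = 0\<close>, the pure \<open>t\<close> part
      being zero.\<close>
    define D where "D = (t * f x - f x * t) + (x * f t - f t * x)"
    define Q where "Q = x * f x - f x * x"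
    have "(t + x) * f (t + x) = f (t + x) * (t + x)" by (rule comm_t[OF t(2)])
    then have "D + Q = 0" using comm_t[OF t(1)]
      by (simp add: D_def Q_def f_add algebra_simps)
    moreover have "(2 * t + x) * f (2 * t + x) = f (2 * t + x) * (2 * t + x)" by (rule comm_t[OF t(3)])
    then have "2 * D + Q = 0" using comm_t[OF t(1)]
      by (simp add: D_def Q_def f_add mult_2 algebra_simps)
    ultimately have "Q = 0" by (simp add: mult_2 add.assoc)
    then show ?thesis by (simp add: Q_def)
  qed (rule comm_t)
  obtain l where l: "l \<in> center" "\<And>x. f x - l * x \<in> center"
    using commuting_additive_map[OF noncomm f_add comm] by blast
  have f_t: "f a = 0" if a: "transcendental a" for a
  proof -
    have a0: "a \<noteq> 0" by (rule transcendental_nonzero[OF a])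
    define N where "N = n + m"
    have N: "N > 2" using nm by (simp add: N_def)
    define u v where "u = f a - l * a" and "v = f (inverse a) - l * inverse a"
    have uv: "u \<in> center" "v \<in> center" unfolding u_def v_def by (rule l(2))+
    have fa: "f a = u + l * a" "f (inverse a) = v + l * inverse a" by (simp_all add: u_def v_def)
    have "f a = - (a ^ n * f (inverse a) * a ^ m)"
      using inv_solution_eq[OF f a0] by simp
    moreover have "a ^ n * f (inverse a) * a ^ m = v * a ^ N + l * a ^ (N - 1)"
    proof -
      have "a ^ n * v = v * a ^ n" "a ^ n * l = l * a ^ n"
        using centerD[OF uv(2), of "a ^ n"] centerD[OF l(1), of "a ^ n"] by simp_all
      then have "a ^ n * f (inverse a) * a ^ m = v * (a ^ n * a ^ m) + l * (a ^ n * inverse a * a ^ m)"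
        by (simp add: fa distrib_left distrib_right mult.assoc[symmetric])
      moreover obtain n' where n': "n = Suc n'" using nm by (cases n) auto
      have "a ^ n * inverse a * a ^ m = a ^ (N - 1)"
        using a0 by (simp add: N_def n' power_Suc2 mult.assoc power_add del: power_Suc)
      ultimately show ?thesis by (simp add: N_def power_add)
    qed
    ultimately have eq: "u + l * a + (v * a ^ N + l * a ^ (N - 1)) = 0"
      by (simp add: fa)
    \<comment> \<open>Inversion has produced a central polynomial relation for \<open>a\<close>.
      Since \<open>N > 2\<close>, the exponents 0, 1, \<open>N - 1\<close> and \<open>N\<close> are
      distinct, so \<open>u\<close> and \<open>l\<close> vanish, and with them
      \<open>f a\<close>.\<close>
    define z where "z i = (if i = 0 then u else if i = N then v else l)" for i
    have zc: "z i \<in> center" for i using uv l by (simp add: z_def)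
    have "N - 1 \<noteq> N" using N by simp
    have "(\<Sum>i\<in>{0, 1, N - 1, N}. z i * a ^ i) = 0"
      using eq N \<open>N - 1 \<noteq> N\<close> by (simp add: z_def add_ac)
    then have "z i = 0" if "i \<in> {0, 1, N - 1, N}" for i
      using transcendental_sum[OF a, of "{0, 1, N - 1, N}" z i] zc that by blast
    from this[of 0] this[of 1] N show ?thesis by (simp add: fa z_def)
  qed
  show ?thesis
  proof (cases "transcendental r")
    case False
    then obtain t where "transcendental t" "transcendental (t + r)" using near by blast
    then have "f t = 0" "f (t + r) = 0" by (auto intro: f_t)
    then show ?thesis by (simp add: f_add)
  qed (rule f_t)
qed

section \<open>Finite center\<close>

text \<open>A concrete substitute for being algebraic over the prime field: zero, or a root of
  unity.\<close>

definition periodic :: "'a::division_ring \<Rightarrow> bool"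
  where "periodic x \<longleftrightarrow> finite (range (\<lambda>i::nat. x ^ i))"

text \<open>In positive characteristic natural coefficients give the full span over the prime field,
  since negatives come for free.\<close>

definition nat_span :: "'a::division_ring set \<Rightarrow> 'a set"
  where "nat_span B = range (\<lambda>k. \<Sum>b\<in>B. of_nat (k b) * b)"

lemma nat_span_add: "x \<in> nat_span B \<Longrightarrow> y \<in> nat_span B \<Longrightarrow> x + y \<in> nat_span B"
proof -
  assume "x \<in> nat_span B" "y \<in> nat_span B"
  then obtain k l where "x = (\<Sum>b\<in>B. of_nat (k b) * b)" "y = (\<Sum>b\<in>B. of_nat (l b) * b)"
    by (auto simp: nat_span_def)
  then have "x + y = (\<Sum>b\<in>B. of_nat (k b + l b) * b)"
    by (simp add: distrib_right sum.distrib)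
  then show ?thesis unfolding nat_span_def by (rule range_eqI[of _ _ "\<lambda>b. k b + l b"])
qed

lemma nat_span_0: "0 \<in> nat_span B"
  unfolding nat_span_def by (rule range_eqI[of _ _ "\<lambda>_. 0"]) simp

lemma nat_span_base: "finite B \<Longrightarrow> b \<in> B \<Longrightarrow> b \<in> nat_span B"
proof -
  assume b: "finite B" "b \<in> B"
  have "(\<Sum>c\<in>B. of_nat (if c = b then 1 else 0) * c) = (\<Sum>c\<in>B. if c = b then c else 0)"
    by (intro sum.cong) auto
  then have "b = (\<Sum>c\<in>B. of_nat (if c = b then 1 else 0) * c)" using b by simp
  then show ?thesis unfolding nat_span_def by (rule range_eqI[of _ _ "\<lambda>c. if c = b then 1 else 0"])
qed

lemma nat_span_sum: "(\<And>i. i \<in> I \<Longrightarrow> f i \<in> nat_span B) \<Longrightarrow> (\<Sum>i\<in>I. f i) \<in> nat_span B"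
  by (induction I rule: infinite_finite_induct) (auto simp: nat_span_0 nat_span_add)

lemma nat_span_of_nat: "x \<in> nat_span B \<Longrightarrow> of_nat k * x \<in> nat_span B"
  by (induction k) (auto simp: nat_span_0 nat_span_add distrib_right)

lemma nat_span_map:
  assumes "x \<in> nat_span B" and add: "\<And>x y. \<phi> (x + y) = \<phi> x + \<phi> y" and B: "\<And>b. b \<in> B \<Longrightarrow> \<phi> b \<in> nat_span C"
  shows "\<phi> x \<in> nat_span C"
proof -
  obtain k where k: "x = (\<Sum>b\<in>B. of_nat (k b) * b)" using assms(1) by (auto simp: nat_span_def)
  have z: "\<phi> 0 = 0" using add[of 0 0] by simp
  have "\<phi> (\<Sum>b\<in>I. f b) = (\<Sum>b\<in>I. \<phi> (f b))" for f :: "'a \<Rightarrow> 'a" and I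
    by (induction I rule: infinite_finite_induct) (simp_all add: z add)
  moreover have "\<phi> (of_nat i * b) = of_nat i * \<phi> b" for i b
    by (induction i) (simp_all add: z add distrib_right)
  ultimately have "\<phi> x = (\<Sum>b\<in>B. of_nat (k b) * \<phi> b)" by (simp add: k)
  then show ?thesis using B by (auto intro: nat_span_sum nat_span_of_nat)
qed

lemma nat_span_mult:
  assumes "x \<in> nat_span B" "y \<in> nat_span B" and "\<And>b c. b \<in> B \<Longrightarrow> c \<in> B \<Longrightarrow> b * c \<in> nat_span B"
  shows "x * y \<in> nat_span B"
proof (rule nat_span_map[OF assms(1), of "\<lambda>x. x * y"])
  fix b assume b: "b \<in> B"
  show "b * y \<in> nat_span B"
    by (rule nat_span_map[OF assms(2), of "(*) b"]) (auto simp: distrib_left assms(3) b)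
qed (simp add: distrib_right)

lemma nat_span_commutes:
  assumes "x \<in> nat_span B" "\<And>b. b \<in> B \<Longrightarrow> b * c = c * b"
  shows "x * c = c * x"
proof -
  obtain k where k: "x = (\<Sum>b\<in>B. of_nat (k b) * b)" using assms(1) by (auto simp: nat_span_def)
  have "of_nat i * b * c = c * (of_nat i * b)" if "b \<in> B" for i b
    using assms(2)[OF that] mult_of_nat_commute[of i c] by (metis mult.assoc)
  then show ?thesis by (simp add: k sum_distrib_left sum_distrib_right)
qed

lemma finite_nat_span:
  assumes p: "of_nat p = (0::'a::division_ring)" "p > 0" and B: "finite (B :: 'a set)"
  shows "finite (nat_span B)"
proof (rule finite_subset)
  show "nat_span B \<subseteq> (\<lambda>k. \<Sum>b\<in>B. of_nat (k b) * b) ` (PiE B (\<lambda>_. {..<p}))"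
  proof
    fix x assume "x \<in> nat_span B"
    then obtain k where k: "x = (\<Sum>b\<in>B. of_nat (k b) * b)" by (auto simp: nat_span_def)
    have mod: "of_nat (i mod p) = (of_nat i :: 'a)" for i
    proof -
      have "(of_nat i :: 'a) = of_nat (p * (i div p) + i mod p)" by simp
      also have "\<dots> = of_nat (i mod p)" by (simp only: of_nat_add of_nat_mult p(1)) simp
      finally show ?thesis by simp
    qed
    have "x = (\<Sum>b\<in>B. of_nat (restrict (\<lambda>b. k b mod p) B b) * b)"
      unfolding k by (intro sum.cong) (auto simp: mod)
    then show "x \<in> (\<lambda>k. \<Sum>b\<in>B. of_nat (k b) * b) ` (PiE B (\<lambda>_. {..<p}))"
      by (rule image_eqI[of _ _ "restrict (\<lambda>b. k b mod p) B"]) (use p(2) in auto)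
  qed
  show "finite ((\<lambda>k. \<Sum>b\<in>B. of_nat (k b) * b) ` (PiE B (\<lambda>_. {..<p})))"
    using B by (intro finite_imageI finite_PiE) auto
qed

lemma not_inj_nat:
  assumes "\<not> inj (h :: nat \<Rightarrow> 'a)"
  obtains i j where "i < j" "h i = h j"
  using assms by (metis injI linorder_neqE_nat)

lemma periodic_order:
  assumes "periodic x" "x \<noteq> 0"
  shows "\<exists>k>0. x ^ k = 1"
proof -
  have "\<not> inj (\<lambda>i::nat. x ^ i)"
    using assms(1) finite_imageD[of "\<lambda>i::nat. x ^ i" UNIV] by (auto simp: periodic_def)
  then obtain i j where ij: "i < j" "x ^ i = x ^ j" by (rule not_inj_nat)
  have "x ^ i * x ^ (j - i) = x ^ (i + (j - i))" by (simp only: power_add)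
  then have "x ^ i * x ^ (j - i) = x ^ i * 1" using ij by (simp del: mult_cancel_left)
  with assms(2) have "x ^ (j - i) = 1" by simp
  with ij show ?thesis by (intro exI[of _ "j - i"]) auto
qed

lemma periodicI: "finite S \<Longrightarrow> (\<And>i. x ^ i \<in> S) \<Longrightarrow> periodic x"
  unfolding periodic_def by (rule finite_subset[of _ S]) auto

lemma periodic_if_stable:
  assumes "finite S" "1 \<in> S" "\<And>y. y \<in> S \<Longrightarrow> x * y \<in> S"
  shows "periodic x"
proof (rule periodicI[OF assms(1)])
  fix i show "x ^ i \<in> S" by (induction i) (auto simp: assms)
qed

definition monomials :: "'a::division_ring \<Rightarrow> 'a \<Rightarrow> 'a set"
  where "monomials x y = {x ^ i * y ^ j | i j. True}"

lemma finite_monomials: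
  assumes "periodic x" "periodic y"
  shows "finite (monomials x y)"
proof -
  have "monomials x y = (\<lambda>(u, v). u * v) ` (range ((^) x) \<times> range ((^) y))" by (auto simp: monomials_def)
  then show ?thesis using assms by (simp add: periodic_def)
qed

lemma periodic_add:
  assumes p: "of_nat p = (0::'a::division_ring)" "p > 0"
    and x: "periodic x" and y: "periodic y" and xy: "x * y = y * (x :: 'a)"
  shows "periodic (x + y)"
proof -
  define B where "B = monomials x y"
  have fB: "finite B" unfolding B_def by (rule finite_monomials[OF x y])
  show ?thesis
  proof (rule periodic_if_stable[OF finite_nat_span[OF p fB]])
    have "x ^ 0 * y ^ 0 \<in> B" unfolding B_def monomials_def by blast
    then show "1 \<in> nat_span B" using nat_span_base[OF fB] by simp
    fix u assume "u \<in> nat_span B"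
    then show "(x + y) * u \<in> nat_span B"
    proof (rule nat_span_map)
      fix b assume "b \<in> B"
      then obtain i j where b: "b = x ^ i * y ^ j" by (auto simp: B_def monomials_def)
      have "y * x ^ i = x ^ i * y" using power_commuting_commutes[OF xy, of i] by simp
      then have "y * b = x ^ i * y ^ Suc j" by (simp add: b mult.assoc[symmetric])
      moreover have "x * b = x ^ Suc i * y ^ j" by (simp add: b mult.assoc)
      ultimately have "x * b \<in> B" "y * b \<in> B" unfolding B_def monomials_def by blast+
      then show "(x + y) * b \<in> nat_span B"
        by (simp add: distrib_right nat_span_add nat_span_base[OF fB])
    qed (simp add: distrib_left)
  qed
qed

lemma periodic_minus:
  assumes "periodic x"
  shows "periodic (- x)"
proof (rule periodicI)
  show "finite (range ((^) x) \<union> uminus ` range ((^) x))" using assms by (simp add: periodic_def)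
  show "(- x) ^ i \<in> range ((^) x) \<union> uminus ` range ((^) x)" for i
    by (cases "even i") (auto simp: power_minus_odd)
qed

lemma periodic_of_nat_mult:
  assumes p: "of_nat p = (0::'a::division_ring)" "p > 0" and "periodic (x :: 'a)"
  shows "periodic (of_nat k * x)"
proof (induction k)
  case 0
  have "(0::'a) ^ i \<in> {0, 1}" for i by (cases i) auto
  then show ?case by (intro periodicI[of "{0, 1}"]) auto
next
  case (Suc k)
  have "periodic (x + of_nat k * x)"
    by (intro periodic_add[OF p assms(3) Suc])
       (simp only: mult.assoc[symmetric] mult_of_nat_commute[of k x, symmetric])
  then show ?case by (simp add: distrib_right)
qed

lemma nonperiodic_add:
  assumes p: "of_nat p = (0::'a::division_ring)" "p > 0" "odd p"
    and t: "\<not> periodic t" and x: "periodic x" and tx: "t * x = x * (t :: 'a)"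
  shows "\<not> periodic (t + x)" "\<not> periodic (2 * t + x)"
proof -
  have *: "periodic u" if "periodic (u + x)" "u * x = x * u" for u
  proof -
    have "periodic (u + x + (- x))"
      by (rule periodic_add[OF p(1,2) that(1) periodic_minus[OF x]]) (simp add: algebra_simps that(2))
    then show ?thesis by simp
  qed
  show "\<not> periodic (t + x)" using * t tx by blast
  show "\<not> periodic (2 * t + x)"
  proof
    assume "periodic (2 * t + x)"
    moreover have "2 * t * x = x * (2 * t)" using tx by (simp add: mult_2 distrib_left distrib_right)
    ultimately have "periodic (2 * t)" by (rule *)
    \<comment> \<open>For odd \<open>p\<close> the number \<open>(p + 1) / 2\<close> inverts 2
      modulo \<open>p\<close>.\<close>
    then have "periodic (of_nat (Suc p div 2) * (2 * t))"
      by (rule periodic_of_nat_mult[OF p(1,2)])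
    moreover have "of_nat (Suc p div 2) * (2 * t) = of_nat (Suc p div 2 * 2) * t"
      by (simp add: mult.assoc)
    moreover have "even (Suc p)" using p(3) by simp
    then have "Suc p div 2 * 2 = Suc p" by (rule dvd_div_mult_self)
    ultimately have "periodic (of_nat (Suc p) * t)" by simp
    with t p(1) show False by simp
  qed
qed

text \<open>A relation of degree \<open>e\<close> over a finite center confines all powers of
  \<open>x\<close> to the finite span of the \<open>c * x ^ v\<close> with \<open>c\<close> central
  and \<open>v < e\<close>.\<close>

lemma transcendental_if_nonperiodic:
  fixes x :: "'a::division_ring"
  assumes p: "of_nat p = (0::'a)" "p > 0" and fin: "finite (center :: 'a set)" and x: "\<not> periodic x"
  shows "transcendental x"
  unfolding transcendental_def
proof (intro allI impI)
  fix d z u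
  assume z: "range z \<subseteq> (center :: 'a set)" and zero: "(\<Sum>u\<le>d. z u * x ^ u) = 0" and "u \<le> d"
  show "z u = 0"
  proof (rule ccontr)
    assume "z u \<noteq> 0"
    define e where "e = Max {v. v \<le> d \<and> z v \<noteq> 0}"
    have fe: "finite {v. v \<le> d \<and> z v \<noteq> 0}" by simp
    have ne: "{v. v \<le> d \<and> z v \<noteq> 0} \<noteq> {}" using \<open>u \<le> d\<close> \<open>z u \<noteq> 0\<close> by blast
    have e: "e \<le> d" "z e \<noteq> 0" using Max_in[OF fe ne] by (auto simp: e_def)
    have above: "z v = 0" if "v \<le> d" "e < v" for v
      using Max_ge[OF fe, of v] that unfolding e_def[symmetric] by force
    have "(\<Sum>u\<le>d. z u * x ^ u) = (\<Sum>u\<le>e. z u * x ^ u)"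
      by (rule sum.mono_neutral_right) (use e above in auto)
    then have rel: "z e * x ^ e = - (\<Sum>u<e. z u * x ^ u)"
      using zero by (simp add: lessThan_Suc_atMost[symmetric] eq_neg_iff_add_eq_0 add.commute)
    define y where "y v = - (inverse (z e) * z v)" for v
    have yc: "y v \<in> center" for v
      unfolding y_def using z by (intro center_minus center_mult center_inverse) auto
    have xe: "x ^ e = (\<Sum>v<e. y v * x ^ v)"
    proof -
      have "x ^ e = inverse (z e) * (z e * x ^ e)" using e(2) by (simp add: mult.assoc[symmetric])
      also have "\<dots> = (\<Sum>v<e. y v * x ^ v)"
        unfolding rel by (simp add: y_def sum_distrib_left sum_negf mult.assoc)
      finally show ?thesis .
    qed
    have e0: "e > 0"
    proof (rule ccontr)
      assume "\<not> e > 0"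
      with xe show False by simp
    qed
    define B where "B = (\<lambda>(c, v). c * x ^ v) ` ((center :: 'a set) \<times> {..<e})"
    have fB: "finite B" unfolding B_def using fin by simp
    have inB: "c * x ^ v \<in> nat_span B" if "c \<in> center" "v < e" for c v
      using that by (intro nat_span_base[OF fB]) (auto simp: B_def)
    have "periodic x"
    proof (rule periodic_if_stable[OF finite_nat_span[OF p fB]])
      show "1 \<in> nat_span B" using inB[of 1 0] e0 by simp
      fix u assume "u \<in> nat_span B"
      then show "x * u \<in> nat_span B"
      proof (rule nat_span_map)
        fix b assume "b \<in> B"
        then obtain c v where b: "b = c * x ^ v" "c \<in> center" "v < e" by (auto simp: B_def)
        have xb: "x * b = c * x ^ Suc v"
          using centerD[OF b(2), of x] by (simp add: b(1) mult.assoc[symmetric])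
        show "x * b \<in> nat_span B"
        proof (cases "Suc v < e")
          case True
          then show ?thesis unfolding xb by (rule inB[OF b(2)])
        next
          case False
          with b(3) have "Suc v = e" by simp
          then have "x * b = (\<Sum>v<e. (c * y v) * x ^ v)"
            unfolding xb by (simp only: xe sum_distrib_left mult.assoc)
          then show ?thesis using b(2) yc by (auto intro!: nat_span_sum inB center_mult)
        qed
      qed (rule distrib_left)
    qed
    with x show False by blast
  qed
qed

text \<open>Inside a division ring this is a finite field: zero is a multiple of one, and inverses
  are powers.\<close>

locale finite_comm_subring =
  fixes F :: "'a::division_ring set" and p :: nat
  assumes p: "of_nat p = (0::'a)" "p > 0"
    and fin: "finite F" and one: "1 \<in> F"
    and add: "x \<in> F \<Longrightarrow> y \<in> F \<Longrightarrow> x + y \<in> F"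
    and mult: "x \<in> F \<Longrightarrow> y \<in> F \<Longrightarrow> x * y \<in> F"
    and comm: "x \<in> F \<Longrightarrow> y \<in> F \<Longrightarrow> x * y = y * x"
begin

lemma zero: "0 \<in> F"
proof -
  have "of_nat (Suc k) \<in> F" for k by (induction k) (auto simp: one add)
  from this[of "p - 1"] p show ?thesis by simp
qed

lemma power: "x \<in> F \<Longrightarrow> x ^ k \<in> F"
  by (induction k) (auto simp: one mult)

lemma sum: "(\<And>i. i \<in> I \<Longrightarrow> f i \<in> F) \<Longrightarrow> (\<Sum>i\<in>I. f i) \<in> F"
  by (induction I rule: infinite_finite_induct) (auto simp: zero add)

lemma order:
  assumes "x \<in> F" "x \<noteq> 0"
  shows "\<exists>k>0. x ^ k = 1"
  by (rule periodic_order[OF periodicI[OF fin] assms(2)]) (rule power[OF assms(1)])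

lemma inverse: "x \<in> F \<Longrightarrow> inverse x \<in> F"
proof (cases "x = 0")
  case False
  assume x: "x \<in> F"
  obtain k where k: "k > 0" "x ^ k = 1" using order[OF x False] by blast
  then obtain l where "k = Suc l" by (cases k) auto
  with k have "x * x ^ l = 1" by simp
  then have "inverse x = x ^ l" by (rule inverse_unique)
  then show ?thesis using power[OF x] by simp
qed (simp add: zero)

text \<open>Adding 1 permutes \<open>F\<close>; comparing the sums over \<open>F\<close> leaves
  \<open>card F\<close> copies of 1.\<close>

lemma card_zero: "of_nat (card F) = (0::'a)"
proof -
  have inj: "inj_on (\<lambda>x. x + 1) F" by (auto simp: inj_on_def)
  have "(\<lambda>x. x + 1) ` F = F"
    by (rule endo_inj_surj[OF fin _ inj]) (auto simp: add one)
  then have "(\<Sum>x\<in>F. x) = (\<Sum>x\<in>F. x + 1)"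
    using sum.reindex[OF inj, of "\<lambda>x. x"] by simp
  then show ?thesis by (simp add: sum.distrib)
qed

definition exponent :: nat
  where "exponent = (LEAST M. M > 0 \<and> (\<forall>x\<in>F - {0}. x ^ M = 1))"

lemma exponent: "exponent > 0" "x \<in> F \<Longrightarrow> x \<noteq> 0 \<Longrightarrow> x ^ exponent = 1"
  and exponent_least: "0 < i \<Longrightarrow> i < exponent \<Longrightarrow> \<exists>x\<in>F - {0}. x ^ i \<noteq> 1"
proof -
  let ?P = "\<lambda>M. M > 0 \<and> (\<forall>x\<in>F - {0}. x ^ M = 1)"
  obtain k where k: "\<And>x. x \<in> F - {0} \<Longrightarrow> k x > 0 \<and> x ^ k x = 1"
    using order by (metis DiffE singletonI)
  have "?P (\<Prod>x\<in>F - {0}. k x)"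
  proof (intro conjI ballI)
    show "0 < (\<Prod>x\<in>F - {0}. k x)" using k by (intro prod_pos) auto
    fix x assume x: "x \<in> F - {0}"
    then have "k x dvd (\<Prod>x\<in>F - {0}. k x)" using fin by (intro dvd_prodI) auto
    then obtain r where r: "(\<Prod>x\<in>F - {0}. k x) = k x * r" by (elim dvdE)
    show "x ^ (\<Prod>x\<in>F - {0}. k x) = 1" unfolding r using k[OF x] by (simp add: power_mult)
  qed
  then have P: "?P exponent" unfolding exponent_def by (rule LeastI)
  then show "exponent > 0" "x \<in> F \<Longrightarrow> x \<noteq> 0 \<Longrightarrow> x ^ exponent = 1" by auto
  show "0 < i \<Longrightarrow> i < exponent \<Longrightarrow> \<exists>x\<in>F - {0}. x ^ i \<noteq> 1"
    using not_less_Least[of i ?P] unfolding exponent_def by blast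
qed

text \<open>Multiplication by some \<open>u\<close> with \<open>u ^ i \<noteq> 1\<close> permutes
  the summands and multiplies the sum by \<open>u ^ i\<close>.\<close>

lemma power_sum_zero:
  assumes "0 < i" "i < exponent"
  shows "(\<Sum>x\<in>F - {0}. x ^ i) = 0"
proof -
  obtain u where u: "u \<in> F" "u \<noteq> 0" "u ^ i \<noteq> 1" using exponent_least[OF assms] by blast
  have inj: "inj_on ((*) u) (F - {0})" using u by (auto simp: inj_on_def)
  have "(*) u ` (F - {0}) = F - {0}"
    by (rule endo_inj_surj[OF _ _ inj]) (use fin u mult in auto)
  then have "(\<Sum>x\<in>F - {0}. x ^ i) = (\<Sum>x\<in>F - {0}. (u * x) ^ i)"
    using sum.reindex[OF inj, of "\<lambda>x. x ^ i"] by simp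
  also have "\<dots> = (\<Sum>x\<in>F - {0}. u ^ i * x ^ i)"
    by (intro sum.cong refl power_mult_commuting comm) (use u in auto)
  also have "\<dots> = u ^ i * (\<Sum>x\<in>F - {0}. x ^ i)" by (simp add: sum_distrib_left)
  finally have "(u ^ i - 1) * (\<Sum>x\<in>F - {0}. x ^ i) = 0" by (simp add: left_diff_distrib)
  with u show ?thesis by simp
qed

text \<open>\<open>spectral l a\<close> is, up to sign, the projection onto the solutions of \<open>v a = l v\<close>.\<close>

definition spectral :: "'a \<Rightarrow> 'a \<Rightarrow> 'a \<Rightarrow> 'a"
  where "spectral l a y = (\<Sum>i<exponent. l ^ (exponent - i) * y * a ^ i)"

lemma spectral_eigenvector:
  assumes l: "l \<in> F" "l \<noteq> 0" and a: "a ^ exponent = 1"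
  shows "spectral l a y * a = l * spectral l a y"
proof -
  define h where "h i = l ^ (Suc exponent - i) * y * a ^ i" for i
  have "spectral l a y * a = (\<Sum>i<exponent. h (Suc i))"
    unfolding spectral_def sum_distrib_right h_def
    by (intro sum.cong refl) (simp add: mult.assoc power_commutes)
  moreover have "l * spectral l a y = (\<Sum>i<exponent. h i)"
    unfolding spectral_def sum_distrib_left h_def
    by (intro sum.cong refl) (simp add: mult.assoc[symmetric] Suc_diff_le)
  moreover have "h exponent = h 0" using exponent l a by (simp add: h_def)
  moreover have "(\<Sum>i<Suc exponent. h i) = h 0 + (\<Sum>i<exponent. h (Suc i))"
    by (rule sum.lessThan_Suc_shift)
  ultimately show ?thesis by simp
qed

text \<open>Power sums kill all terms but \<open>i = 0\<close>, where the sum of ones is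
  \<open>card F - 1 = -1\<close>. So every \<open>y\<close> is a sum of eigenvectors.\<close>

lemma spectral_sum: "(\<Sum>l\<in>F - {0}. spectral l a y) = - y"
proof -
  have "(\<Sum>l\<in>F - {0}. spectral l a y)
      = (\<Sum>i<exponent. (\<Sum>l\<in>F - {0}. l ^ (exponent - i)) * y * a ^ i)"
    unfolding spectral_def sum_distrib_right by (rule sum.swap)
  also have "\<dots> = (\<Sum>i\<in>{0}. (\<Sum>l\<in>F - {0}. l ^ (exponent - i)) * y * a ^ i)"
    by (rule sum.mono_neutral_right) (use exponent power_sum_zero in auto)
  also have "\<dots> = (\<Sum>l\<in>F - {0}. 1) * y"
    using exponent by simp
  also have "(\<Sum>l\<in>F - {0}. 1) = (of_nat (card (F - {0})) :: 'a)" by simp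
  also have "of_nat (card (F - {0})) = (of_nat (card F) - 1 :: 'a)"
    using fin zero card_gt_0_iff[of F] by (subst card_Diff_singleton) (auto simp: of_nat_diff Suc_le_eq)
  finally show ?thesis by (simp add: card_zero)
qed

text \<open>For \<open>a\<close> in \<open>F\<close> the value lies in the commutative
  \<open>F\<close>, so the eigenvector equation forces it to vanish unless \<open>a = l\<close>. It
  serves as an indicator that separates eigenvalues.\<close>

lemma spectral_one:
  assumes "l \<in> F" "l \<noteq> 0" "a \<in> F" "a \<noteq> 0"
  shows "spectral l a 1 = (if a = l then -1 else 0)"
proof -
  have 0: "spectral k b 1 = 0" if "k \<in> F" "k \<noteq> 0" "b \<in> F" "b \<noteq> 0" "b \<noteq> k" for k b
  proof -
    have "spectral k b 1 \<in> F"
      unfolding spectral_def using that by (intro sum mult power one) auto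
    then have "b * spectral k b 1 = k * spectral k b 1"
      using spectral_eigenvector[OF that(1,2) exponent(2)[OF that(3,4)], of 1] comm[OF that(3)] by simp
    with that(5) show ?thesis by simp
  qed
  show ?thesis
  proof (cases "a = l")
    case True
    have "- 1 = (\<Sum>k\<in>F - {0}. spectral k a 1)" by (rule spectral_sum[symmetric])
    also have "\<dots> = (\<Sum>k\<in>{a}. spectral k a 1)"
      by (rule sum.mono_neutral_right) (use fin assms 0 in auto)
    finally show ?thesis using True by simp
  qed (use 0 assms in simp)
qed

end

section \<open>Orbit counting, and finite fields normalized by an outside element\<close>

lemma card_eq_mult_fibers:
  assumes "finite A" "\<And>a. a \<in> A \<Longrightarrow> card {x \<in> A. h x = h a} = s"
  shows "card A = card (h ` A) * s"
proof -
  have "card A = (\<Sum>x\<in>A. 1)" by simp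
  also have "\<dots> = (\<Sum>y\<in>h ` A. \<Sum>x\<in>{x \<in> A. h x = y}. 1)"
    by (rule sum.image_gen[OF assms(1)])
  also have "\<dots> = (\<Sum>y\<in>h ` A. s)"
    by (intro sum.cong refl) (use assms(2) in auto)
  finally show ?thesis by simp
qed

text \<open>A finite field normalized, but not centralized, by \<open>g\<close> cannot contain a positive power of \<open>g\<close>.
  Hilbert's Theorem 90 and counting produce \<open>u = b g\<close> with \<open>u ^ k = 1\<close>, so that \<open>1 + u + \<dots> + u ^ (k - 1) = 0\<close>;
  but the powers of \<open>u\<close> are eigenvectors of conjugation with different eigenvalues.\<close>

lemma (in finite_comm_subring) no_cyclic_extension:
  assumes g: "g \<noteq> 0" and norm: "\<And>x. x \<in> F \<Longrightarrow> g * x * inverse g \<in> F"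
    and a: "a \<in> F" and k: "k > 1" "g ^ k \<in> F" and least: "\<And>i. 0 < i \<Longrightarrow> i < k \<Longrightarrow> g ^ i * a \<noteq> a * g ^ i"
  shows False
proof -
  define \<sigma> where "\<sigma> x = g * x * inverse g" for x
  define U where "U = F - {0}"
  have finU: "finite U" using fin by (simp add: U_def)
  have a0: "a \<noteq> 0" using least[of 1] k by auto
  have \<sigma>F: "\<sigma> x \<in> F" if "x \<in> F" for x using norm[OF that] by (simp add: \<sigma>_def)
  have \<sigma>0: "\<sigma> x = 0 \<longleftrightarrow> x = 0" for x using g by (simp add: \<sigma>_def)
  have \<sigma>U: "\<sigma> x \<in> U" if "x \<in> U" for x using that \<sigma>F \<sigma>0 by (simp add: U_def)
  have \<sigma>iF: "(\<sigma> ^^ i) x \<in> F" if "x \<in> F" for i x by (induction i) (auto simp: that \<sigma>F)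
  have UU: "x * y \<in> U" "inverse x \<in> U" if "x \<in> U" "y \<in> U" for x y
    using that mult inverse by (auto simp: U_def)
  have shift: "(b * g) * x = \<sigma> x * (b * g)" if "b \<in> F" "x \<in> F" for b x
  proof -
    have "b * (g * x) = b * \<sigma> x * g" using g by (simp add: \<sigma>_def mult.assoc)
    also have "b * \<sigma> x = \<sigma> x * b" using that \<sigma>F by (intro comm) auto
    finally show ?thesis by (simp add: mult.assoc)
  qed
  have shift_power: "(b * g) ^ i * x = (\<sigma> ^^ i) x * (b * g) ^ i" if b: "b \<in> F" and x: "x \<in> F" for b x i
  proof (induction i)
    case (Suc i)
    have "(b * g) ^ Suc i * x = (b * g) * ((b * g) ^ i * x)" by (simp only: power_Suc mult.assoc)
    also have "\<dots> = ((b * g) * (\<sigma> ^^ i) x) * (b * g) ^ i" by (simp only: Suc mult.assoc)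
    also have "(b * g) * (\<sigma> ^^ i) x = \<sigma> ((\<sigma> ^^ i) x) * (b * g)" by (rule shift[OF b \<sigma>iF[OF x]])
    finally show ?case by (simp only: power_Suc mult.assoc funpow.simps o_apply)
  qed simp
  have distinct: "(\<sigma> ^^ i) a \<noteq> a" if "0 < i" "i < k" for i
    using shift_power[OF one a, of i] least[OF that] by auto
  have \<sigma>ia0: "(\<sigma> ^^ i) a \<noteq> 0" for i using a0 by (induction i) (auto simp: \<sigma>0)
  \<comment> \<open>Moving \<open>a\<close> past \<open>(b * g) ^ i\<close> replaces it by its
    \<open>i\<close>-th conjugate. These differ from \<open>a\<close> for \<open>0 < i < k\<close>,
    so the indicator of \<open>spectral_one\<close> isolates the term \<open>i = 0\<close>.\<close>
  have twisted: "(\<Sum>j<exponent. a ^ (exponent - j) * (\<Sum>i<k. (b * g) ^ i * a ^ j * c i)) = - c 0"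
    if b: "b \<in> F" for b c
  proof -
    have pw: "(b * g) ^ i * a ^ j = ((\<sigma> ^^ i) a) ^ j * (b * g) ^ i" for i j
    proof (induction j)
      case (Suc j)
      have "(b * g) ^ i * a ^ Suc j = ((b * g) ^ i * a) * a ^ j" by (simp only: power_Suc mult.assoc)
      also have "\<dots> = (\<sigma> ^^ i) a * ((b * g) ^ i * a ^ j)"
        unfolding shift_power[OF b a] by (simp only: mult.assoc)
      finally show ?case by (simp only: Suc power_Suc mult.assoc)
    qed simp
    have "(\<Sum>j<exponent. a ^ (exponent - j) * (\<Sum>i<k. (b * g) ^ i * a ^ j * c i))
      = (\<Sum>j<exponent. \<Sum>i<k. a ^ (exponent - j) * ((\<sigma> ^^ i) a) ^ j * ((b * g) ^ i * c i))"
      unfolding sum_distrib_left by (intro sum.cong refl) (simp only: pw mult.assoc)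
    also have "\<dots> = (\<Sum>i<k. \<Sum>j<exponent. a ^ (exponent - j) * ((\<sigma> ^^ i) a) ^ j * ((b * g) ^ i * c i))"
      by (rule sum.swap)
    also have "\<dots> = (\<Sum>i<k. spectral a ((\<sigma> ^^ i) a) 1 * ((b * g) ^ i * c i))"
      by (simp add: spectral_def sum_distrib_right)
    also have "\<dots> = (\<Sum>i\<in>{0}. spectral a ((\<sigma> ^^ i) a) 1 * ((b * g) ^ i * c i))"
      by (rule sum.mono_neutral_right)
        (use k spectral_one[OF a a0 \<sigma>iF[OF a] \<sigma>ia0] distinct in auto)
    finally show ?thesis using spectral_one[OF a a0 a a0] by simp
  qed
  have power_form: "\<exists>c\<in>U. (b * g) ^ i = c * g ^ i" if b: "b \<in> U" for b i
  proof (induction i)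
    case 0
    show ?case using one by (intro bexI[of _ 1]) (auto simp: U_def)
  next
    case (Suc i)
    then obtain c where c: "c \<in> U" "(b * g) ^ i = c * g ^ i" by blast
    have "(b * g) ^ Suc i = b * (g * c) * g ^ i" by (simp add: c(2) mult.assoc)
    also have "g * c = \<sigma> c * g" using shift[OF one, of c] c(1) by (simp add: U_def)
    finally have "(b * g) ^ Suc i = (b * \<sigma> c) * g ^ Suc i" by (simp add: mult.assoc)
    then show ?case using UU(1)[OF b \<sigma>U[OF c(1)]] by blast
  qed
  \<comment> \<open>A twisted norm: up to the factor \<open>g ^ k\<close> it is the product of the
    first \<open>k\<close> conjugates of \<open>b\<close>. Its values commute with
    \<open>b * g\<close> and with \<open>b\<close>, hence with \<open>g\<close>, and so fall in
    \<open>E\<close>.\<close>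
  define \<nu> where "\<nu> b = (b * g) ^ k" for b
  have bg0: "b * g \<noteq> 0" if "b \<in> U" for b using that g by (simp add: U_def)
  have \<nu>U: "\<nu> b \<in> U" if "b \<in> U" for b
  proof -
    obtain c where "c \<in> U" "\<nu> b = c * g ^ k" using power_form[OF \<open>b \<in> U\<close>] unfolding \<nu>_def by blast
    then show ?thesis using k(2) mult g by (auto simp: U_def)
  qed
  define E where "E = {x \<in> U. g * x = x * g}"
  have finE: "finite E" using finU by (simp add: E_def)
  have oneE: "1 \<in> E" using one by (simp add: E_def U_def)
  have \<nu>E: "\<nu> b \<in> E" if b: "b \<in> U" for b
  proof -
    have bF: "b \<in> F" "b \<noteq> 0" using b by (auto simp: U_def)
    have vF: "\<nu> b \<in> F" using \<nu>U[OF b] by (simp add: U_def)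
    have "b * (g * \<nu> b) = b * (\<nu> b * g)"
    proof -
      have "(b * g) * \<nu> b = \<nu> b * (b * g)" unfolding \<nu>_def by (rule power_commutes[symmetric])
      also have "\<dots> = b * (\<nu> b * g)" using comm[OF vF bF(1)] by (simp only: mult.assoc[symmetric])
      finally show ?thesis by (simp only: mult.assoc)
    qed
    with bF have "g * \<nu> b = \<nu> b * g" by simp
    then show ?thesis using \<nu>U[OF b] by (simp add: E_def)
  qed
  \<comment> \<open>Conjugation in disguise: \<open>act b c * g\<close> is
    \<open>c * (b * g) * inverse c\<close>.\<close>
  define act where "act b c = c * b * inverse (\<sigma> c)" for b c
  have act_iff: "act b c = b' \<longleftrightarrow> c * (b * g) = (b' * g) * c" if "b' \<in> U" "c \<in> U" for b b' c
  proof -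
    have c: "c \<in> F" "\<sigma> c \<noteq> 0" "b' \<in> F" using that \<sigma>0 by (auto simp: U_def)
    have "act b c = b' \<longleftrightarrow> c * b = b' * \<sigma> c"
    proof
      assume "act b c = b'"
      then have "c * b * (inverse (\<sigma> c) * \<sigma> c) = b' * \<sigma> c" by (simp only: act_def mult.assoc[symmetric])
      then show "c * b = b' * \<sigma> c" using c by simp
    next
      assume "c * b = b' * \<sigma> c"
      then show "act b c = b'" using c by (simp add: act_def mult.assoc)
    qed
    also have "\<dots> \<longleftrightarrow> c * b * g = b' * \<sigma> c * g" using g by simp
    also have "b' * \<sigma> c * g = (b' * g) * c"
      using shift[OF c(3,1)] comm[OF c(3) \<sigma>F[OF c(1)]] by (simp add: mult.assoc[symmetric])
    finally show ?thesis by (simp only: mult.assoc)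
  qed
  have act_U: "act b c \<in> U" if "b \<in> U" "c \<in> U" for b c
    unfolding act_def using that by (intro UU(1) UU(2)[OF \<sigma>U \<sigma>U]) auto
  have fiber: "{b' \<in> U. \<nu> b' = \<nu> b} = act b ` U" if b: "b \<in> U" for b
  proof (intro equalityI subsetI)
    fix b' assume "b' \<in> act b ` U"
    then obtain c where c: "c \<in> U" "b' = act b c" by blast
    have b'U: "b' \<in> U" using act_U[OF b c(1)] c(2) by simp
    have e: "c * (b * g) = (b' * g) * c" using act_iff[OF b'U c(1), of b] c(2) by simp
    have "c * (b * g) ^ i = (b' * g) ^ i * c" for i
    proof (induction i)
      case (Suc i)
      have "c * (b * g) ^ Suc i = (c * (b * g)) * (b * g) ^ i" by (simp only: power_Suc mult.assoc)
      also have "\<dots> = (b' * g) * (c * (b * g) ^ i)" by (simp only: e mult.assoc)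
      finally show ?case by (simp only: Suc power_Suc mult.assoc)
    qed simp
    then have "c * \<nu> b = \<nu> b' * c" unfolding \<nu>_def .
    moreover have "c * \<nu> b = \<nu> b * c" using c(1) \<nu>U[OF b] by (intro comm) (auto simp: U_def)
    moreover have "c \<noteq> 0" using c(1) by (simp add: U_def)
    ultimately have "\<nu> b' = \<nu> b" by (metis mult_right_cancel)
    with b'U show "b' \<in> {b' \<in> U. \<nu> b' = \<nu> b}" by simp
  next
    fix b' assume "b' \<in> {b' \<in> U. \<nu> b' = \<nu> b}"
    then have b': "b' \<in> U" "\<nu> b' = \<nu> b" by auto
    \<comment> \<open>Hilbert 90 by averaging. Equal norms make the sum close up cyclically, so
      \<open>T x\<close> intertwines \<open>b * g\<close> with \<open>b' * g\<close>; by
      \<open>twisted\<close> it cannot vanish at all powers of \<open>a\<close>.\<close>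
    define T where "T x = (\<Sum>i<k. (b' * g) ^ i * x * inverse ((b * g) ^ i))" for x
    have T_comm: "T x * (b * g) = (b' * g) * T x" if x: "x \<in> F" for x
    proof -
      define h where "h i = (b' * g) ^ i * x * inverse ((b * g) ^ i) * (b * g)" for i
      have bg: "b * g \<noteq> 0" by (rule bg0[OF b])
      have "inverse (w ^ Suc i) * w = inverse (w ^ i)" if "w \<noteq> 0" for w :: 'a and i
        using that by (simp add: nonzero_inverse_mult_distrib mult.assoc)
      note inv = this[OF bg]
      have "T x * (b * g) = (\<Sum>i<k. h i)" by (simp add: T_def h_def sum_distrib_right)
      moreover have "(b' * g) * T x = (\<Sum>i<k. h (Suc i))"
        unfolding T_def h_def sum_distrib_left
      proof (intro sum.cong refl)
        fix i
        have "(b' * g) ^ Suc i * x * inverse ((b * g) ^ Suc i) * (b * g)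
          = (b' * g) ^ Suc i * x * (inverse ((b * g) ^ Suc i) * (b * g))" by (simp only: mult.assoc)
        then show "b' * g * ((b' * g) ^ i * x * inverse ((b * g) ^ i))
          = (b' * g) ^ Suc i * x * inverse ((b * g) ^ Suc i) * (b * g)"
          unfolding inv by (simp only: power_Suc mult.assoc)
      qed
      moreover have "h k = h 0"
      proof -
        have "\<nu> b \<noteq> 0" "\<nu> b \<in> F" using \<nu>U[OF b] by (auto simp: U_def)
        then have "\<nu> b * x * inverse (\<nu> b) = x" using comm[of "\<nu> b" x] x by (simp add: mult.assoc)
        then show ?thesis unfolding h_def using b'(2) by (simp add: \<nu>_def)
      qed
      moreover have "(\<Sum>i<Suc k. h i) = h 0 + (\<Sum>i<k. h (Suc i))" by (rule sum.lessThan_Suc_shift)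
      ultimately show ?thesis by simp
    qed
    have T_F: "T x \<in> F" if x: "x \<in> F" for x
      unfolding T_def
    proof (rule sum)
      fix i
      obtain c where c: "c \<in> U" "(b * g) ^ i = c * g ^ i" using power_form[OF b] by blast
      obtain c' where c': "c' \<in> U" "(b' * g) ^ i = c' * g ^ i" using power_form[OF b'(1)] by blast
      have b'F: "b' \<in> F" and c0: "c \<noteq> 0" using b'(1) c by (auto simp: U_def)
      have "(b' * g) ^ i * x * inverse ((b * g) ^ i) = (\<sigma> ^^ i) x * (c' * (g ^ i * inverse (c * g ^ i)))"
        unfolding shift_power[OF b'F x] unfolding c(2) c'(2) by (simp only: mult.assoc)
      also have "g ^ i * inverse (c * g ^ i) = inverse c"
        using c0 g by (simp add: nonzero_inverse_mult_distrib mult.assoc[symmetric])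
      finally have "(b' * g) ^ i * x * inverse ((b * g) ^ i) = (\<sigma> ^^ i) x * (c' * inverse c)" .
      then show "(b' * g) ^ i * x * inverse ((b * g) ^ i) \<in> F"
        using c c' \<sigma>iF[OF x] by (auto simp: U_def intro!: mult inverse)
    qed
    have "\<exists>j. T (a ^ j) \<noteq> 0"
    proof (rule ccontr)
      assume "\<not> (\<exists>j. T (a ^ j) \<noteq> 0)"
      then have "(\<Sum>j<exponent. a ^ (exponent - j) * T (a ^ j)) = 0" by simp
      moreover have "b' \<in> F" using b'(1) by (simp add: U_def)
      ultimately show False
        using twisted[of b' "\<lambda>i. inverse ((b * g) ^ i)"] by (simp add: T_def)
    qed
    then obtain j where j: "T (a ^ j) \<noteq> 0" by blast
    define c where "c = T (a ^ j)"
    have cU: "c \<in> U" using j T_F[OF power[OF a]] by (simp add: U_def c_def)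
    have "act b c = b'"
      unfolding act_iff[OF b'(1) cU] using T_comm[OF power[OF a]] by (simp add: c_def)
    with cU show "b' \<in> act b ` U" by blast
  qed
  \<comment> \<open>Two elements act equally on \<open>b\<close> iff their quotient commutes with
    \<open>b * g\<close>, that is, with \<open>g\<close>; the fibers are therefore cosets of
    \<open>E\<close>.\<close>
  have orbit: "card U = card (act b ` U) * card E" if b: "b \<in> U" for b
  proof (rule card_eq_mult_fibers[OF finU])
    fix c assume c: "c \<in> U"
    have cF: "c \<in> F" "c \<noteq> 0" "b \<in> F" "b \<noteq> 0" using b c by (auto simp: U_def)
    have "{x \<in> U. act b x = act b c} = (*) c ` E"
    proof (intro equalityI subsetI)
      fix x assume "x \<in> {x \<in> U. act b x = act b c}"
      then have x: "x \<in> U" "act b x = act b c" by auto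
      define b' where "b' = act b c"
      have b'U: "b' \<in> U" unfolding b'_def by (rule act_U[OF b c])
      have "x * (b * g) = (b' * g) * x" "c * (b * g) = (b' * g) * c"
        using act_iff[OF b'U x(1), of b] act_iff[OF b'U c, of b] x(2) by (simp_all add: b'_def)
      then have b': "b' * g = c * (b * g) * inverse c"
        using cF by (simp add: mult.assoc)
      define y where "y = inverse c * x"
      have xy: "x = c * y" using cF by (simp add: y_def mult.assoc[symmetric])
      have yU: "y \<in> U" unfolding y_def using UU(1)[OF UU(2)[OF c c] x(1)] .
      have "c * (y * (b * g)) = x * (b * g)" by (simp only: xy mult.assoc)
      also have "\<dots> = (b' * g) * x" by fact
      also have "\<dots> = c * ((b * g) * y)" unfolding b' y_def by (simp only: mult.assoc)
      finally have "c * (y * (b * g)) = c * ((b * g) * y)" .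
      then have "y * (b * g) = (b * g) * y" using cF by simp
      moreover have "y * b = b * y" using yU cF by (intro comm) (auto simp: U_def)
      ultimately have "b * (y * g) = b * (g * y)" by (simp add: mult.assoc[symmetric])
      then have "y \<in> E" using cF yU by (simp add: E_def)
      then show "x \<in> (*) c ` E" using xy by blast
    next
      fix x assume "x \<in> (*) c ` E"
      then obtain y where y: "y \<in> E" "x = c * y" by blast
      then have yU: "y \<in> U" and yg: "g * y = y * g" by (auto simp: E_def)
      have \<sigma>y: "\<sigma> y = y" using yg g by (simp add: \<sigma>_def mult.assoc)
      have y0: "y \<noteq> 0" "y \<in> F" using yU by (auto simp: U_def)
      have "\<sigma> x = \<sigma> c * y"
        unfolding \<sigma>_def y(2) using commutes_inverse[OF yg] by (simp only: mult.assoc)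
      moreover have "\<sigma> c \<noteq> 0" using cF \<sigma>0 by simp
      ultimately have "act b x = c * (y * b * inverse y) * inverse (\<sigma> c)"
        using y0 by (simp add: act_def y(2) nonzero_inverse_mult_distrib mult.assoc)
      also have "y * b * inverse y = b" using comm[OF y0(2) cF(3)] y0 by (simp add: mult.assoc)
      finally have "act b x = act b c" by (simp add: act_def)
      then show "x \<in> {x \<in> U. act b x = act b c}" using UU(1)[OF c yU] y(2) by simp
    qed
    moreover have "inj_on ((*) c) E" using cF by (auto simp: inj_on_def)
    ultimately show "card {x \<in> U. act b x = act b c} = card E" by (simp add: card_image)
  qed
  have oneU: "1 \<in> U" using one by (simp add: U_def)
  \<comment> \<open>Norm fibers are orbits and all orbits have \<open>card U / card E\<close>
    elements. So the norm takes \<open>card E\<close> values in \<open>E\<close>, and 1 is one of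
    them.\<close>
  have "card U = card (\<nu> ` U) * card (act 1 ` U)"
  proof (rule card_eq_mult_fibers[OF finU])
    fix b assume b: "b \<in> U"
    have "card E > 0" using finE oneE card_gt_0_iff by blast
    then have "card (act b ` U) = card (act 1 ` U)"
      using orbit[OF b] orbit[OF oneU] by simp
    then show "card {x \<in> U. \<nu> x = \<nu> b} = card (act 1 ` U)" by (simp add: fiber[OF b])
  qed
  moreover have "card (act 1 ` U) > 0" using finU oneU by (auto simp: card_gt_0_iff)
  ultimately have "card (\<nu> ` U) = card E" using orbit[OF oneU] by simp
  then have "\<nu> ` U = E" using \<nu>E finE by (intro card_subset_eq) auto
  then obtain b where b: "b \<in> U" "\<nu> b = 1" using oneE by (metis imageE)
  define u where "u = b * g"
  have bF: "b \<in> F" using b by (simp add: U_def)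
  have uk: "u ^ k = 1" using b(2) by (simp add: \<nu>_def u_def)
  have "u \<noteq> 1"
  proof
    assume "u = 1"
    then have "a = \<sigma> a" using shift[OF bF a] by (simp add: u_def)
    with distinct[of 1] k show False by simp
  qed
  moreover have "(u - 1) * (\<Sum>i<k. u ^ i) = 0"
  proof -
    have "(\<Sum>i<Suc k. u ^ i) = u ^ 0 + (\<Sum>i<k. u ^ Suc i)" by (rule sum.lessThan_Suc_shift)
    also have "(\<Sum>i<k. u ^ Suc i) = u * (\<Sum>i<k. u ^ i)" by (simp only: sum_distrib_left power_Suc)
    finally show ?thesis by (simp add: uk left_diff_distrib)
  qed
  ultimately have S: "(\<Sum>i<k. u ^ i) = 0" by simp
  have "(\<Sum>i<k. u ^ i * a ^ j * 1) = 0" for j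
    using S by (simp add: sum_distrib_right[symmetric])
  with twisted[OF bF, of "\<lambda>_. 1"] show False by (simp add: u_def)
qed

text \<open>Otherwise an eigenvector \<open>g\<close> with \<open>g * a = l * g\<close>,
  \<open>l \<noteq> a\<close>, normalizes the field generated by \<open>a\<close>. Its first power
  commuting with \<open>a\<close> is periodic, and adjoining it gives a finite field that
  \<open>no_cyclic_extension\<close> forbids.\<close>

lemma nonperiodic_in_centralizer:
  fixes a :: "'a::division_ring"
  assumes p: "of_nat p = (0::'a)" "p > 0" and a: "periodic a" "a \<notin> center"
  shows "\<exists>t. t * a = a * t \<and> \<not> periodic t"
proof (rule ccontr)
  assume "\<not> ?thesis"
  then have all: "\<And>t. t * a = a * t \<Longrightarrow> periodic t" by blast
  have subring: "finite_comm_subring (nat_span (monomials a c)) p"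
    if c: "periodic c" "a * c = c * a" for c
  proof -
    define B where "B = monomials a c"
    have fB: "finite B" unfolding B_def by (rule finite_monomials[OF a(1) c(1)])
    have ca: "c ^ j * a ^ i = a ^ i * c ^ j" for i j
      using power_commuting_commutes[OF power_commuting_commutes[OF c(2)], of j i, symmetric]
        power_commuting_commutes[OF c(2)] by (metis power_commuting_commutes c(2))
    have prod: "(a ^ i * c ^ j) * (a ^ i' * c ^ j') = a ^ (i + i') * c ^ (j + j')" for i j i' j'
    proof -
      have "(a ^ i * c ^ j) * (a ^ i' * c ^ j') = a ^ i * (c ^ j * a ^ i') * c ^ j'" by (simp only: mult.assoc)
      then show ?thesis by (simp only: ca power_add mult.assoc)
    qed
    have BB: "b * b' \<in> B" "b * b' = b' * b" if "b \<in> B" "b' \<in> B" for b b'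
    proof -
      from that(1) obtain i j where b: "b = a ^ i * c ^ j" by (auto simp: B_def monomials_def)
      from that(2) obtain i' j' where b': "b' = a ^ i' * c ^ j'" by (auto simp: B_def monomials_def)
      show "b * b' \<in> B" unfolding b b' prod B_def monomials_def by blast
      show "b * b' = b' * b" unfolding b b' prod by (simp only: add.commute)
    qed
    show ?thesis
      unfolding B_def[symmetric]
    proof unfold_locales
      have "a ^ 0 * c ^ 0 \<in> B" unfolding B_def monomials_def by blast
      then show "1 \<in> nat_span B" using nat_span_base[OF fB] by simp
      show "x * y \<in> nat_span B" if "x \<in> nat_span B" "y \<in> nat_span B" for x y
        using that by (rule nat_span_mult) (intro nat_span_base[OF fB] BB)
      show "x * y = y * x" if x: "x \<in> nat_span B" and y: "y \<in> nat_span B" for x y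
      proof (rule nat_span_commutes[OF x])
        fix b assume b: "b \<in> B"
        show "b * y = y * b" by (rule nat_span_commutes[OF y, symmetric]) (rule BB(2)[OF _ b])
      qed
    qed (simp_all add: p finite_nat_span[OF p fB] nat_span_add)
  qed
  have monomial: "a ^ i * c ^ j \<in> nat_span (monomials a c)" if "periodic c" for c i j
    by (rule nat_span_base[OF finite_monomials[OF a(1) that]]) (auto simp: monomials_def)
  have per1: "periodic (1::'a)" by (rule periodicI[of "{1}"]) auto
  define F0 where "F0 = nat_span (monomials a 1)"
  interpret F0: finite_comm_subring F0 p unfolding F0_def by (rule subring[OF per1]) simp
  have aF0: "a \<in> F0" using monomial[OF per1, of 1 0] by (simp add: F0_def)
  have a0: "a \<noteq> 0" using a(2) by auto
  obtain y where y: "a * y \<noteq> y * a" using a(2) by (auto simp: center_def)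
  have aM: "a ^ F0.exponent = 1" by (rule F0.exponent(2)[OF aF0 a0])
  \<comment> \<open>If only the component for \<open>l = a\<close> survived, \<open>y\<close> would
    commute with \<open>a\<close>.\<close>
  have "\<exists>l\<in>F0 - {0}. l \<noteq> a \<and> F0.spectral l a y \<noteq> 0"
  proof (rule ccontr)
    assume no: "\<not> ?thesis"
    have "- y = (\<Sum>l\<in>F0 - {0}. F0.spectral l a y)" by (rule F0.spectral_sum[symmetric])
    also have "\<dots> = (\<Sum>l\<in>{a}. F0.spectral l a y)"
      by (rule sum.mono_neutral_right) (use F0.fin aF0 a0 no in auto)
    finally have "- y = F0.spectral a a y" by simp
    then have "- y * a = a * - y" using F0.spectral_eigenvector[OF aF0 a0 aM, of y] by simp
    with y show False by simp
  qed
  then obtain l where l: "l \<in> F0" "l \<noteq> 0" "l \<noteq> a" "F0.spectral l a y \<noteq> 0" by blast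
  define g where "g = F0.spectral l a y"
  have g0: "g \<noteq> 0" and ga: "g * a = l * g"
    using l F0.spectral_eigenvector[OF l(1,2) aM] by (simp_all add: g_def)
  have conj_power: "g * x ^ i * inverse g = (g * x * inverse g) ^ i" for x i
  proof (induction i)
    case (Suc i)
    have "(g * x * inverse g) ^ Suc i = g * x * (inverse g * g) * x ^ i * inverse g"
      unfolding power_Suc Suc[symmetric] by (simp only: mult.assoc)
    also have "inverse g * g = 1" using g0 by simp
    finally show ?case by (simp only: power_Suc mult_1_right mult.assoc)
  qed (use g0 in simp)
  have la: "g * a * inverse g = l" using ga g0 by (simp add: mult.assoc)
  have F0F: "F0 \<subseteq> nat_span (monomials a c)" if "periodic c" for c
  proof
    fix x assume "x \<in> F0"
    then show "x \<in> nat_span (monomials a c)"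
      unfolding F0_def
    proof (rule nat_span_map[of _ _ "\<lambda>x. x"])
      fix b assume "b \<in> monomials a 1"
      then obtain i where "b = a ^ i" by (auto simp: monomials_def)
      then show "b \<in> nat_span (monomials a c)" using monomial[OF that, of i 0] by simp
    qed simp
  qed
  have conj_span: "g * x * inverse g \<in> nat_span (monomials a c)"
    if c: "periodic c" "a * c = c * a" "g * c = c * g" and x: "x \<in> nat_span (monomials a c)" for c x
  proof (rule nat_span_map[OF x, of "\<lambda>x. g * x * inverse g"])
    interpret F: finite_comm_subring "nat_span (monomials a c)" p by (rule subring[OF c(1,2)])
    fix b assume "b \<in> monomials a c"
    then obtain i j where b: "b = a ^ i * c ^ j" by (auto simp: monomials_def)
    have "g * c * inverse g = c" using g0 c(3) by (simp add: mult.assoc)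
    then have "g * c ^ j * inverse g = c ^ j" by (simp add: conj_power)
    moreover have "g * b * inverse g = (g * a ^ i * inverse g) * (g * c ^ j * inverse g)"
      using g0 by (simp add: b mult.assoc) (simp add: mult.assoc[symmetric])
    ultimately have "g * b * inverse g = l ^ i * c ^ j" by (simp add: conj_power la)
    moreover have "l \<in> nat_span (monomials a c)" using F0F[OF c(1)] l(1) by blast
    moreover have "c ^ j \<in> nat_span (monomials a c)" using monomial[OF c(1), of 0 j] by simp
    ultimately show "g * b * inverse g \<in> nat_span (monomials a c)"
      using F.mult F.power by simp
  qed (simp add: distrib_left distrib_right)
  have giF0: "g ^ i * a * inverse (g ^ i) \<in> F0" for i
  proof (induction i)
    case (Suc i)
    have "g ^ Suc i * a * inverse (g ^ Suc i) = g * (g ^ i * a * inverse (g ^ i)) * inverse g"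
      using g0 by (simp add: nonzero_inverse_mult_distrib mult.assoc)
    then show ?case using conj_span[OF per1 _ _ Suc[unfolded F0_def]] by (simp add: F0_def)
  qed (simp add: aF0)
  \<comment> \<open>Pigeonhole: the conjugates of \<open>a\<close> by powers of \<open>g\<close>
    stay in the finite \<open>F0\<close>.\<close>
  have "\<exists>k>0. g ^ k * a = a * g ^ k"
  proof -
    have "\<not> inj (\<lambda>i. g ^ i * a * inverse (g ^ i))"
    proof
      assume "inj (\<lambda>i. g ^ i * a * inverse (g ^ i))"
      then have "infinite (range (\<lambda>i. g ^ i * a * inverse (g ^ i)))" using finite_imageD by blast
      moreover have "range (\<lambda>i. g ^ i * a * inverse (g ^ i)) \<subseteq> F0" using giF0 by blast
      ultimately show False using F0.fin finite_subset by blast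
    qed
    then obtain i j where ij: "i < j" "g ^ i * a * inverse (g ^ i) = g ^ j * a * inverse (g ^ j)"
      by (rule not_inj_nat)
    define d where "d = j - i"
    have gj: "g ^ j = g ^ i * g ^ d" using ij(1) by (simp add: d_def power_add[symmetric])
    have "g ^ i * (a * g ^ d) = g ^ i * a * 1 * g ^ d" by (simp only: mult_1_right mult.assoc)
    also have "1 = inverse (g ^ i) * g ^ i" using g0 by simp
    also have "g ^ i * a * (inverse (g ^ i) * g ^ i) * g ^ d = (g ^ i * a * inverse (g ^ i)) * (g ^ i * g ^ d)"
      by (simp only: mult.assoc)
    also have "\<dots> = g ^ j * a * (inverse (g ^ j) * g ^ j)"
      unfolding ij(2) gj[symmetric] by (simp only: mult.assoc)
    also have "inverse (g ^ j) * g ^ j = 1" using g0 by simp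
    also have "g ^ j * a * 1 = g ^ i * (g ^ d * a)" by (simp only: gj mult_1_right mult.assoc)
    finally have "a * g ^ d = g ^ d * a" using g0 by simp
    with ij(1) show ?thesis by (intro exI[of _ d]) (simp add: d_def)
  qed
  note ex = this
  define k where "k = (LEAST k. k > 0 \<and> g ^ k * a = a * g ^ k)"
  have k: "k > 0" "g ^ k * a = a * g ^ k" using LeastI_ex[OF ex] unfolding k_def by simp_all
  have least: "g ^ i * a \<noteq> a * g ^ i" if "0 < i" "i < k" for i
    using not_less_Least[of i "\<lambda>k. k > 0 \<and> g ^ k * a = a * g ^ k"] that unfolding k_def by blast
  have "k \<noteq> 1"
  proof
    assume "k = 1"
    then have "l * g = a * g" using k(2) ga by simp
    with g0 have "l = a" by simp
    with l(3) show False ..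
  qed
  then have k1: "k > 1" using k(1) by simp
  define c where "c = g ^ k"
  have c: "periodic c" "a * c = c * a" using all[OF k(2)] k(2) by (simp_all add: c_def)
  define F where "F = nat_span (monomials a c)"
  interpret F: finite_comm_subring F p unfolding F_def by (rule subring[OF c])
  have aF: "a \<in> F" using monomial[OF c(1), of 1 0] by (simp add: F_def)
  have cF: "c \<in> F" using monomial[OF c(1), of 0 1] by (simp add: F_def)
  have gc: "g * c = c * g" unfolding c_def by (rule power_commutes[symmetric])
  have gF: "g * x * inverse g \<in> F" if "x \<in> F" for x
    using conj_span[OF c gc] that unfolding F_def .
  show False
    by (rule F.no_cyclic_extension[OF g0 gF aF k1 _ least]) (simp_all add: cF[unfolded c_def])
qed

lemma finite_center_transcendental_near:
  assumes p: "of_nat p = (0::'a::division_ring)" "p > 0" "odd p"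
    and fin: "finite (center :: 'a set)" and noncomm: "(center :: 'a set) \<noteq> UNIV"
    and x: "\<not> transcendental (x :: 'a)"
  shows "\<exists>t. t * x = x * t \<and> transcendental t \<and> transcendental (t + x) \<and> transcendental (2 * t + x)"
proof -
  have x: "periodic x"
    using transcendental_if_nonperiodic[OF p(1,2) fin] x by blast
  obtain t where t: "t * x = x * t" "\<not> periodic t"
  proof (cases "x \<in> center")
    case True
    from noncomm obtain a :: 'a where a: "a \<notin> center" by blast
    \<comment> \<open>Either \<open>a\<close> itself is not periodic, or its centralizer contains
      such an element; a central \<open>x\<close> commutes with either.\<close>
    obtain t :: 'a where "\<not> periodic t" using nonperiodic_in_centralizer[OF p(1,2) _ a] by blast
    then show thesis using that[of t] centerD[OF True, of t] by simp
  next
    case False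
    then show thesis using that nonperiodic_in_centralizer[OF p(1,2) x] by blast
  qed
  show ?thesis
    using t nonperiodic_add[OF p t(2) x t(1)]
    by (intro exI[of _ t] conjI transcendental_if_nonperiodic[OF p(1,2) fin])
qed

section \<open>Combination of the cases\<close>

lemma inv_solution_zero:
  fixes f :: "'a::division_ring \<Rightarrow> 'a"
  assumes noncomm: "(center :: 'a set) \<noteq> UNIV" and char: "CHAR('a) \<noteq> 2"
    and nm: "n > 0" "m > 0" "n + m > 2" and s: "s = 1 \<or> s = -1" and f: "inv_solution s n m f"
  shows "f y = 0"
proof (cases "CHAR('a) = 0")
  case True
  then show ?thesis using inv_solution_char_0[OF f s _ nm(3)] by blast
next
  case False
  define p where "p = CHAR('a)"
  have prime: "prime p" unfolding p_def using prime_CHAR_division_ring False by blast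
  have p2: "p \<noteq> 2" using char by (simp add: p_def)
  then have odd: "odd p" using prime prime_odd_nat[of p] prime_ge_2_nat[of p] by simp
  have p0: "of_nat p = (0::'a)" by (simp add: p_def)
  have pos: "p > 0" using prime by (rule prime_gt_0_nat)
  have two: "(2::'a) \<noteq> 0" using char by (rule two_nonzero)
  show ?thesis
  proof (cases "even (n + m)")
    case False
    show ?thesis by (rule inv_solution_odd[OF f two False])
  next
    case even: True
    note nm' = nm(1,2) even nm(3)
    show ?thesis
    proof (cases "finite (center :: 'a set)")
      case True
      note near = finite_center_transcendental_near[OF p0 pos odd True noncomm]
      from noncomm obtain a :: 'a where "a \<notin> center" by blast
      obtain t :: 'a where t: "transcendental t"
      proof (cases "transcendental a")
        case False
        with near show thesis using that by blast
      qed (use that in blast)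
      from s show ?thesis
      proof
        assume "s = 1"
        with f have f: "inv_solution 1 n m f" by simp
        show ?thesis
          by (rule plus_solution_zero_transcendental[OF p_def[symmetric] prime p2 two t near nm' f])
      next
        assume "s = -1"
        with f have f: "inv_solution (-1) n m f" by simp
        show ?thesis
          by (rule minus_solution_zero_transcendental[OF noncomm two near nm' f])
      qed
    next
      case False
      from s show ?thesis
      proof
        assume "s = 1"
        with f have f: "inv_solution 1 n m f" by simp
        show ?thesis
          by (rule plus_solution_zero_infinite_center[OF False noncomm p_def[symmetric] prime p2 two nm' f])
      next
        assume "s = -1"
        with f have f: "inv_solution (-1) n m f" by simp
        show ?thesis
          by (rule minus_solution_infinite_center[OF False noncomm p_def[symmetric] prime p2 two nm' f])
      qed
    qed
  qed
qed

theorem theorem1p6: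
  fixes g1 g2 :: "'a::division_ring \<Rightarrow> 'a" and m n :: nat
  assumes noncomm: "\<exists>x y :: 'a. x * y \<noteq> y * x"
    and char: "CHAR('a) \<noteq> 2"
    and m_pos: "m > 0" and n_pos: "n > 0" and mn: "(m, n) \<noteq> (1, 1)"
    and add1: "additive g1" and add2: "additive g2"
    and identity: "\<forall>y. y \<noteq> 0 \<longrightarrow> g1 y * y powi (- int m) + y ^ n * g2 (inverse y) = 0"
  shows "g1 = (\<lambda>_. 0) \<and> g2 = (\<lambda>_. 0)"
proof -
  have center: "(center :: 'a set) \<noteq> UNIV" using noncomm by (auto simp: center_def set_eq_iff)
  have nm: "n + m > 2" using m_pos n_pos mn by (cases m; cases n) auto
  have add: "g1 (x + y) = g1 x + g1 y" "g2 (x + y) = g2 x + g2 y" for x y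
    using add1 add2 by (simp_all add: additive.add)
  have g1: "g1 y = - (y ^ n * g2 (inverse y) * y ^ m)" if "y \<noteq> 0" for y
  proof -
    have "g1 y * inverse (y ^ m) = - (y ^ n * g2 (inverse y))"
      using identity that by (simp add: power_int_minus eq_neg_iff_add_eq_0)
    then have "g1 y * (inverse (y ^ m) * y ^ m) = - (y ^ n * g2 (inverse y)) * y ^ m"
      by (simp only: mult.assoc[symmetric])
    then show ?thesis using that by simp
  qed
  have g2: "g2 y = - (y ^ n * g1 (inverse y) * y ^ m)" if "y \<noteq> 0" for y
  proof -
    have "y ^ n * g1 (inverse y) * y ^ m
        = - (y ^ n * (inverse y) ^ n * g2 y * ((inverse y) ^ m * y ^ m))"
      using g1[of "inverse y"] that by (simp add: mult.assoc)
    also have "y ^ n * (inverse y) ^ n = 1" using that by (simp add: power_inverse)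
    also have "(inverse y) ^ m * y ^ m = 1" using that by (simp add: power_inverse)
    finally show ?thesis by simp
  qed
  have "g1 y - g2 y = 1 * (y ^ n * (g1 (inverse y) - g2 (inverse y)) * y ^ m)" if "y \<noteq> 0" for y
    unfolding g1[OF that] g2[OF that] by (simp add: left_diff_distrib right_diff_distrib)
  moreover have "g1 (x + y) - g2 (x + y) = (g1 x - g2 x) + (g1 y - g2 y)" for x y by (simp add: add)
  ultimately have "inv_solution 1 n m (\<lambda>y. g1 y - g2 y)"
    unfolding inv_solution_def by blast
  then have "g1 y - g2 y = 0" for y
    by (rule inv_solution_zero[OF center char n_pos m_pos nm, rotated]) simp
  then have diff: "g2 = g1" by (intro ext) (metis right_minus_eq)
  \<comment> \<open>Once \<open>g1 = g2\<close>, the given identity is itself the minus equation for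
    \<open>g1\<close>.\<close>
  have "g1 y = -1 * (y ^ n * g1 (inverse y) * y ^ m)" if "y \<noteq> 0" for y
    using g1[OF that, unfolded diff] by (simp only: mult_minus1)
  then have "inv_solution (-1) n m g1"
    unfolding inv_solution_def using add(1) by blast
  then have "g1 y = 0" for y
    by (rule inv_solution_zero[OF center char n_pos m_pos nm, rotated]) simp
  then show ?thesis unfolding diff by blast
qed

end
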